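(* Let $m,n,r,d$ be integers such that $m,n\ge 2$, $d\ge 1$ and $1\le r\le \min\{m,n\}-1$. For each $a=0,1,\dots,rd$ put $\alpha=\lfloor a/(n-r)\rfloor$, $s=a \bmod (n-r)$, $\beta=\lfloor (rd-a)/(m-r)\rfloor$, $t=(rd-a)\bmod (m-r)$, and let $\mathcal K_a$ be the complete eigenstructure of $m\times n$ matrix polynomials of grade $d$ consisting of: no elementary divisors at all (neither finite nor infinite); the right minimal indices $$\underbrace{\alpha+1,\dots,\alpha+1}_{s},\ \underbrace{\alpha,\dots,\alpha}_{n-r-s};$$ and the left minimal indices $$\underbrace{\beta+1,\dots,\beta+1}_{t},\ \underbrace{\beta,\dots,\beta}_{m-r-t}.$$ Then: (i) For each $a=0,1,\dots,rd$ there exists an $m\times n$ complex matrix polynomial $K_a$ of degree exactly $d$ and rank exactly $r$ with the complete eigenstructure $\mathcal K_a$. (ii) For every $m\times n$ complex matrix polynomial $M$ of grade $d$ with rank at most $r$, there exists an integer $a\in\{0,1,\dots,rd\}$ such that $\overline{\mathrm{O}}(K_a)\supseteq \overline{\mathrm{O}}(M)$. (iii) $\overline{\mathrm{O}}(K_a)\not\supseteq \overline{\mathrm{O}}(K_{a'})$ whenever $a\ne a'$ (with $a,a'\in\{0,1,\dots,rd\}$). (iv) The set of $m\times n$ complex matrix polynomials of grade $d$ with rank at most $r$ is a closed subset of $\mathrm{POL}_{d,m\times n}$ equal to $\bigcup_{0\le a\le rd}\overline{\mathrm{O}}(K_a)$.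
   Context: All matrices are complex. An $m\times n$ matrix polynomial of grade $d$ is an expression $P(\lambda)=\lambda^dA_d+\dots+\lambda A_1+A_0$ with $A_i\in\mathbb C^{m\times n}$ (so its degree is at most $d$; $A_d=0$ is allowed). $\mathrm{POL}_{d,m\times n}$ is the vector space of all of these, with the metric $d(P,P')=\big(\sum_{i=0}^d\|A_i-A_i'\|_F^2\big)^{1/2}$ ($\|\cdot\|_F$ the Frobenius norm). Rank means normal rank, i.e. the rank of $P(\lambda)$ over the field $\mathbb C(\lambda)$. By the Smith form, if $P$ has rank $r$ there are matrix polynomials $U(\lambda),V(\lambda)$ with nonzero constant determinants such that $U(\lambda)P(\lambda)V(\lambda)$ is zero except for diagonal entries $g_1(\lambda),\dots,g_r(\lambda)$ in the leading $r\times r$ block, where the $g_j$ are monic and $g_j\mid g_{j+1}$; these $g_j$ are unique. Write $g_j(\lambda)=\prod_k(\lambda-\alpha_k)^{\delta_{jk}}$ with distinct $\alpha_k$ and $\delta_{jk}>0$. The $\alpha_k$ are the finite eigenvalues, and the factors $(\lambda-\alpha_k)^{\delta_{jk}}$, collected over all $j$ with repetitions, are the elementary divisors associated with finite eigenvalues. For $P$ of grade $d$, let $\mathrm{rev}\,P(\lambda)=\lambda^dP(1/\lambda)$; the elementary divisors of $P$ associated with the eigenvalue $\infty$ are the elementary divisors $\lambda^{\gamma}$, $\gamma>0$, of $\mathrm{rev}\,P$ associated with its eigenvalue $0$. A minimal basis of a subspace $\mathcal V$ of a space of vectors over $\mathbb C(\lambda)$ is a basis of $\mathcal V$ consisting of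 vector polynomials whose sum of degrees is minimal among all such bases; the ordered list of degrees is the same for every minimal basis and is called the list of minimal indices of $\mathcal V$. The right minimal indices of $P$ are the $n-r$ minimal indices of $\{x(\lambda)\in\mathbb C(\lambda)^{n\times 1}: P(\lambda)x(\lambda)=0\}$ and the left minimal indices of $P$ are the $m-r$ minimal indices of $\{y(\lambda)^T\in\mathbb C(\lambda)^{1\times m}: y(\lambda)^TP(\lambda)=0\}$. The complete eigenstructure of $P$ (of grade $d$) consists of all its eigenvalues, finite and infinite, the corresponding elementary divisors, and its left and right minimal indices. $\mathrm{O}(P)$ denotes the set of all matrix polynomials of the same size, the same grade $d$ and with the same complete eigenstructure as $P$; $\overline{\mathrm{O}}(P)$ denotes its closure in the metric space $\mathrm{POL}_{d,m\times n}$. *)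

theory Defs
  imports
    "HOL-Computational_Algebra.Polynomial_Factorial"
    "HOL-Analysis.Abstract_Metric_Spaces"
    "HOL-Analysis.L2_Norm"
    "Jordan_Normal_Form.DL_Rank"
    "Jordan_Normal_Form.Matrix_Kernel"
begin

section \<open>Matrix polynomials of a given grade\<close>

text \<open>A matrix polynomial is a matrix over \<open>complex poly\<close>. Having grade \<open>d\<close> is a bound on the
  degrees of the entries; the grade is not recorded in the matrix, so every notion that depends on
  it (reversal, eigenvalue \<open>\<infinity>\<close>, orbit, metric) takes \<open>d\<close> as an argument.\<close>

definition POL :: "nat \<Rightarrow> nat \<Rightarrow> nat \<Rightarrow> complex poly mat set" where
  "POL d m n = {P \<in> carrier_mat m n. \<forall>i<m. \<forall>j<n. degree (P $$ (i, j)) \<le> d}"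

text \<open>The coefficient of \<open>\<lambda>^i\<close>. The size is an argument so that the metric below is symmetric on
  the whole type, as the locale \<open>Metric_space\<close> demands.\<close>

definition coeff_mat :: "nat \<Rightarrow> nat \<Rightarrow> complex poly mat \<Rightarrow> nat \<Rightarrow> complex mat" where
  "coeff_mat m n P i = mat m n (\<lambda>(k, l). coeff (P $$ (k, l)) i)"

definition frobenius_norm :: "complex mat \<Rightarrow> real" where
  "frobenius_norm A = sqrt (\<Sum>i<dim_row A. \<Sum>j<dim_col A. (cmod (A $$ (i, j)))\<^sup>2)"

definition POL_dist :: "nat \<Rightarrow> nat \<Rightarrow> nat \<Rightarrow> complex poly mat \<Rightarrow> complex poly mat \<Rightarrow> real" where
  "POL_dist d m n P Q =
     sqrt (\<Sum>i\<le>d. (frobenius_norm (coeff_mat m n P i - coeff_mat m n Q i))\<^sup>2)"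

lemma POL_dist_L2_set:
  "POL_dist d m n P Q =
     L2_set (\<lambda>(i, k, l). cmod (coeff (P $$ (k, l)) i - coeff (Q $$ (k, l)) i))
       ({..d} \<times> {..<m} \<times> {..<n})"
proof -
  have "(frobenius_norm (coeff_mat m n P i - coeff_mat m n Q i))\<^sup>2 =
    (\<Sum>k<m. \<Sum>l<n. (cmod (coeff (P $$ (k, l)) i - coeff (Q $$ (k, l)) i))\<^sup>2)" for i
    unfolding frobenius_norm_def by (simp add: sum_nonneg coeff_mat_def)
  then show ?thesis
    unfolding POL_dist_def L2_set_def
    by (simp add: sum.cartesian_product case_prod_unfold)
qed

lemma Metric_space_POL: "Metric_space (POL d m n) (POL_dist d m n)"
proof
  let ?I = "{..d} \<times> {..<m} \<times> {..<n}"
  fix P Q R :: "complex poly mat"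
  show "0 \<le> POL_dist d m n P Q"
    unfolding POL_dist_L2_set by (rule L2_set_nonneg)
  show "POL_dist d m n P Q = POL_dist d m n Q P"
    unfolding POL_dist_L2_set by (simp add: norm_minus_commute)
  show "POL_dist d m n P Q = 0 \<longleftrightarrow> P = Q" if "P \<in> POL d m n" "Q \<in> POL d m n"
  proof
    assume "POL_dist d m n P Q = 0"
    then have eq: "coeff (P $$ (k, l)) i = coeff (Q $$ (k, l)) i" if "i \<le> d" "k < m" "l < n" for i k l
      using that unfolding POL_dist_L2_set by (subst (asm) L2_set_eq_0_iff) auto
    show "P = Q"
    proof (rule eq_matI)
      fix k l assume kl: "k < dim_row Q" "l < dim_col Q"
      then have kl': "k < m" "l < n" using that by (auto simp: POL_def)
      show "P $$ (k, l) = Q $$ (k, l)"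
      proof (rule poly_eqI)
        fix i
        show "coeff (P $$ (k, l)) i = coeff (Q $$ (k, l)) i"
        proof (cases "i \<le> d")
          case True
          then show ?thesis using eq kl' by blast
        next
          case False
          moreover have "degree (P $$ (k, l)) \<le> d" "degree (Q $$ (k, l)) \<le> d"
            using that kl' by (auto simp: POL_def)
          ultimately show ?thesis by (simp add: coeff_eq_0)
        qed
      qed
    qed (use that in \<open>auto simp: POL_def\<close>)
  qed (simp add: POL_dist_L2_set L2_set_def case_prod_unfold)
  show "POL_dist d m n P R \<le> POL_dist d m n P Q + POL_dist d m n Q R"
  proof -
    have "POL_dist d m n P R \<le>
      L2_set (\<lambda>x. (case x of (i, k, l) \<Rightarrow> cmod (coeff (P $$ (k, l)) i - coeff (Q $$ (k, l)) i))
        + (case x of (i, k, l) \<Rightarrow> cmod (coeff (Q $$ (k, l)) i - coeff (R $$ (k, l)) i))) ?I"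
      unfolding POL_dist_L2_set
      by (intro L2_set_mono) (auto simp: dist_triangle simp flip: dist_norm)
    also have "\<dots> \<le> POL_dist d m n P Q + POL_dist d m n Q R"
      unfolding POL_dist_L2_set by (rule L2_set_triangle_ineq)
    finally show ?thesis .
  qed
qed

abbreviation POL_topology :: "nat \<Rightarrow> nat \<Rightarrow> nat \<Rightarrow> complex poly mat topology" where
  "POL_topology d m n \<equiv> Metric_space.mtopology (POL d m n) (POL_dist d m n)"

text \<open>The degree of the zero matrix polynomial (and of the zero vector polynomial) is \<open>0\<close>, as for
  \<open>degree\<close>.\<close>

definition mat_degree :: "complex poly mat \<Rightarrow> nat" where
  "mat_degree P = Max (insert 0 (degree ` elements_mat P))"

definition vec_degree :: "complex poly vec \<Rightarrow> nat" where
  "vec_degree v = Max (insert 0 (degree ` vec_set v))"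

section \<open>Elementary divisors\<close>

abbreviation rat_mat :: "complex poly mat \<Rightarrow> complex poly fract mat" where
  "rat_mat \<equiv> map_mat to_fract"

definition normal_rank :: "complex poly mat \<Rightarrow> nat" where
  "normal_rank P = vec_space.rank (dim_row P) (rat_mat P)"

definition unimodular :: "nat \<Rightarrow> complex poly mat \<Rightarrow> bool" where
  "unimodular k U \<longleftrightarrow> U \<in> carrier_mat k k \<and> (\<exists>c. c \<noteq> 0 \<and> det U = [:c:])"

definition is_smith_form :: "complex poly mat \<Rightarrow> complex poly list \<Rightarrow> bool" where
  "is_smith_form P gs \<longleftrightarrow>
     length gs = normal_rank P \<and>
     (\<forall>g\<in>set gs. lead_coeff g = 1) \<and>
     (\<forall>j. Suc j < length gs \<longrightarrow> gs ! j dvd gs ! Suc j) \<and>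
     (\<exists>U V. unimodular (dim_row P) U \<and> unimodular (dim_col P) V \<and>
        U * P * V =
          mat (dim_row P) (dim_col P) (\<lambda>(i, j). if i = j \<and> i < length gs then gs ! i else 0))"

definition invariant_polynomials :: "complex poly mat \<Rightarrow> complex poly list" where
  "invariant_polynomials P = (THE gs. is_smith_form P gs)"

text \<open>The elementary divisors \<open>(\<lambda> - \<alpha>)^\<delta>\<close> with \<open>\<delta> > 0\<close> associated with \<open>\<alpha>\<close>, with repetitions.
  The result is empty exactly if \<open>\<alpha>\<close> is not an eigenvalue.\<close>

definition elementary_divisors :: "complex poly mat \<Rightarrow> complex \<Rightarrow> complex poly multiset" where
  "elementary_divisors P \<alpha> =
     {# [:- \<alpha>, 1:] ^ Polynomial.order \<alpha> g | g \<in># mset (invariant_polynomials P). poly g \<alpha> = 0 #}"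

definition rev_poly :: "nat \<Rightarrow> complex poly \<Rightarrow> complex poly" where
  "rev_poly d p = (\<Sum>i\<le>d. Polynomial.monom (coeff p i) (d - i))"

definition rev_mat :: "nat \<Rightarrow> complex poly mat \<Rightarrow> complex poly mat" where
  "rev_mat d P = map_mat (rev_poly d) P"

section \<open>Minimal indices\<close>

text \<open>Here \<open>V\<close> is a subspace of the space of all vectors of length \<open>k\<close> over the field of rational
  functions \<open>complex poly fract\<close>.\<close>

definition polynomial_basis ::
    "nat \<Rightarrow> complex poly fract vec set \<Rightarrow> complex poly vec list \<Rightarrow> bool" where
  "polynomial_basis k V B \<longleftrightarrow>
     distinct B \<and>
     vectorspace.basis class_ring (module_vec TYPE(complex poly fract) k\<lparr>carrier := V\<rparr>)
       (map_vec to_fract ` set B)"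

definition minimal_basis ::
    "nat \<Rightarrow> complex poly fract vec set \<Rightarrow> complex poly vec list \<Rightarrow> bool" where
  "minimal_basis k V B \<longleftrightarrow>
     polynomial_basis k V B \<and>
     (\<forall>B'. polynomial_basis k V B' \<longrightarrow>
        sum_list (map vec_degree B) \<le> sum_list (map vec_degree B'))"

text \<open>Listed in non-increasing order.\<close>

definition minimal_indices :: "nat \<Rightarrow> complex poly fract vec set \<Rightarrow> nat list" where
  "minimal_indices k V =
     (THE l. \<exists>B. minimal_basis k V B \<and> l = rev (sort (map vec_degree B)))"

definition right_minimal_indices :: "complex poly mat \<Rightarrow> nat list" where
  "right_minimal_indices P = minimal_indices (dim_col P) (mat_kernel (rat_mat P))"

text \<open>Row vectors \<open>y\<^sup>T\<close> with \<open>y\<^sup>T P = 0\<close> are represented by the columns \<open>y\<close>, for which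
  \<open>P\<^sup>T y = 0\<close>.\<close>

definition left_minimal_indices :: "complex poly mat \<Rightarrow> nat list" where
  "left_minimal_indices P = minimal_indices (dim_row P) (mat_kernel (transpose_mat (rat_mat P)))"

section \<open>Complete eigenstructures and orbits\<close>

text \<open>The eigenvalues themselves are recorded as the places where the multisets of elementary
  divisors are nonempty.\<close>

record eigenstructure =
  finite_divisors :: "complex \<Rightarrow> complex poly multiset"
  infinite_divisors :: "complex poly multiset"
  right_indices :: "nat list"
  left_indices :: "nat list"

definition complete_eigenstructure :: "nat \<Rightarrow> complex poly mat \<Rightarrow> eigenstructure" where
  "complete_eigenstructure d P =
     \<lparr>finite_divisors = elementary_divisors P,
      infinite_divisors = elementary_divisors (rev_mat d P) 0,
      right_indices = right_minimal_indices P,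
      left_indices = left_minimal_indices P\<rparr>"

definition orbit :: "nat \<Rightarrow> complex poly mat \<Rightarrow> complex poly mat set" where
  "orbit d P = {Q \<in> POL d (dim_row P) (dim_col P).
     complete_eigenstructure d Q = complete_eigenstructure d P}"

definition orbit_closure :: "nat \<Rightarrow> complex poly mat \<Rightarrow> complex poly mat set" where
  "orbit_closure d P = POL_topology d (dim_row P) (dim_col P) closure_of orbit d P"

definition generic_eigenstructure :: "nat \<Rightarrow> nat \<Rightarrow> nat \<Rightarrow> nat \<Rightarrow> nat \<Rightarrow> eigenstructure" where
  "generic_eigenstructure m n r d a =
     (let \<alpha> = a div (n - r); s = a mod (n - r);
          \<beta> = (r * d - a) div (m - r); t = (r * d - a) mod (m - r)
      in \<lparr>finite_divisors = (\<lambda>_. {#}),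
          infinite_divisors = {#},
          right_indices = replicate s (\<alpha> + 1) @ replicate (n - r - s) \<alpha>,
          left_indices = replicate t (\<beta> + 1) @ replicate (m - r - t) \<beta>\<rparr>)"

definition is_generic ::
    "nat \<Rightarrow> nat \<Rightarrow> nat \<Rightarrow> nat \<Rightarrow> nat \<Rightarrow> complex poly mat \<Rightarrow> bool" where
  "is_generic m n r d a P \<longleftrightarrow>
     P \<in> POL d m n \<and> mat_degree P = d \<and> normal_rank P = r \<and>
     complete_eigenstructure d P = generic_eigenstructure m n r d a"

end

theory Submission
  imports Defs "HOL-Computational_Algebra.Fundamental_Theorem_Algebra"
begin

text \<open>Every \<open>M\<close> of rank \<open>\<rho> \<le> r\<close> and grade \<open>d\<close> factors as \<open>M = L R\<close> with \<open>R\<close> a minimal basis of its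
  row space: if \<open>\<delta>\<^sub>l\<close> are the row degrees of \<open>R\<close>, then column \<open>l\<close> of \<open>L\<close> has degree at most
  \<open>d - \<delta>\<^sub>l\<close>, and \<open>\<Sum>\<delta>\<^sub>l\<close> is the sum \<open>a\<close> of the right minimal indices of \<open>M\<close>. After padding with
  zeros to \<open>r\<close> rows and columns, a small perturbation of \<open>L\<close> and \<open>R\<close> within these degree bounds has
  Sylvester matrices of maximal rank, and this forces \<open>L R\<close> to have eigenstructure \<open>\<K>\<^sub>a\<close>; so \<open>M\<close> lies
  in the closure of the orbit of \<open>K\<^sub>a\<close>, where \<open>a\<close> depends on the eigenstructure of \<open>M\<close> only.
  Conversely, the dimension of the space of polynomial vectors of degree below \<open>K\<close> annihilated by \<open>M\<close>
  is upper semicontinuous in \<open>M\<close>. For large \<open>K\<close> it is \<open>(n - r) K - a\<close> on the orbit of \<open>K\<^sub>a\<close>, and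
  the left kernel gives \<open>(m - r) K - (r d - a)\<close>, so limits of that orbit have rank at most \<open>r\<close> and
  the orbits for different \<open>a\<close> do not degenerate into each other.\<close>

section \<open>Injective matrices over finite index sets\<close>

text \<open>All ranks are rephrased as injectivity (\<open>inj_mat\<close>), with surjectivity read
  as injectivity of the transpose. Over an integral domain the same notion says that polynomial
  columns are independent over the rational functions, denominators being cleared. The factorization
  halves the problem: only one rectangular factor with prescribed row degrees is analysed, and the
  left side follows by transposing and replacing \<open>\<delta>\<close> by
  \<open>d - \<delta>\<close>. The columns of \<open>L\<close> have degrees at most
  \<open>d - \<delta>\<^sub>l\<close> to keep the product within grade \<open>d\<close>; hence the
  generic left indices sum to \<open>r d - a\<close>, and \<open>\<delta>\<^sub>l \<le> d\<close>
  for \<open>r\<close> rows gives the range of \<open>a\<close>. Maximal rank of Sylvester matrices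
  is a workable notion of genericity because these matrices are complex, of fixed size and linear in
  the factor: on a line in the direction of one good example all but finitely many points are good.
  So each list of degrees needs one example that is good for two consecutive sizes at once, which
  the zigzag matrices provide.\<close>

definition inj_mat :: "'i set \<Rightarrow> 'j set \<Rightarrow> ('i \<Rightarrow> 'j \<Rightarrow> 'a::idom) \<Rightarrow> bool" where
  "inj_mat I J A \<longleftrightarrow> (\<forall>v. (\<forall>i\<in>I. (\<Sum>j\<in>J. A i j * v j) = 0) \<longrightarrow> (\<forall>j\<in>J. v j = 0))"

lemma inj_matD:
  assumes "inj_mat I J A" "\<And>i. i \<in> I \<Longrightarrow> (\<Sum>j\<in>J. A i j * v j) = 0" "j \<in> J"
  shows "v j = 0"
  using assms unfolding inj_mat_def by blast

lemma inj_mat_cong: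
  assumes "\<And>i j. i \<in> I \<Longrightarrow> j \<in> J \<Longrightarrow> A i j = B i j"
  shows "inj_mat I J A \<longleftrightarrow> inj_mat I J B"
proof -
  have "(\<Sum>j\<in>J. A i j * v j) = (\<Sum>j\<in>J. B i j * v j)" if "i \<in> I" for i v
    using that assms by (intro sum.cong) auto
  then show ?thesis unfolding inj_mat_def by simp
qed

lemma inj_mat_det:
  fixes A :: "'j \<Rightarrow> 'j \<Rightarrow> 'a::idom"
  assumes e: "bij_betw e {..<N} J"
  shows "inj_mat J J A \<longleftrightarrow> det (mat N N (\<lambda>(p, q). A (e p) (e q))) \<noteq> 0"
proof -
  let ?M = "mat N N (\<lambda>(p, q). A (e p) (e q))"
  have M: "?M \<in> carrier_mat N N" by simp
  have eJ: "i \<in> e ` {..<N}" if "i \<in> J" for i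
    using that bij_betw_imp_surj_on[OF e] by simp
  have re: "(\<Sum>j\<in>J. f j) = (\<Sum>q<N. f (e q))" for f :: "'j \<Rightarrow> 'a"
    using sum.reindex_bij_betw[OF e, of f] by simp
  have mv: "(?M *\<^sub>v vec N w) $ p = (\<Sum>q<N. A (e p) (e q) * w q)" if "p < N" for w p
    using that by (simp add: scalar_prod_def lessThan_atLeast0)
  show ?thesis
  proof
    assume inj: "inj_mat J J A"
    show "det ?M \<noteq> 0"
    proof
      assume "det ?M = 0"
      then obtain x where x: "x \<in> carrier_vec N" "x \<noteq> 0\<^sub>v N" "?M *\<^sub>v x = 0\<^sub>v N"
        using det_0_iff_vec_prod_zero[OF M] by blast
      define v where "v j = x $ (inv_into {..<N} e j)" for j
      have ve: "v (e q) = x $ q" if "q < N" for q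
        using e that by (simp add: v_def bij_betw_def inv_into_f_f)
      have xv: "x = vec N (\<lambda>q. v (e q))" using x(1) ve by auto
      have "(\<Sum>j\<in>J. A i j * v j) = 0" if "i \<in> J" for i
      proof -
        obtain p where p: "p < N" "i = e p" using eJ[OF \<open>i \<in> J\<close>] by auto
        have "(\<Sum>j\<in>J. A i j * v j) = (?M *\<^sub>v x) $ p"
          unfolding re xv mv[OF p(1)] p(2) ..
        then show ?thesis using x(3) p by simp
      qed
      then have "\<forall>j\<in>J. v j = 0" using inj unfolding inj_mat_def by blast
      then have "x = 0\<^sub>v N" unfolding xv using e by (auto simp: bij_betw_def)
      then show False using x by simp
    qed
  next
    assume d: "det ?M \<noteq> 0"
    show "inj_mat J J A"
      unfolding inj_mat_def
    proof (intro allI impI ballI)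
      fix v j assume v: "\<forall>i\<in>J. (\<Sum>j\<in>J. A i j * v j) = 0" and j: "j \<in> J"
      have "?M *\<^sub>v vec N (\<lambda>q. v (e q)) = 0\<^sub>v N"
      proof (rule eq_vecI)
        fix p assume p: "p < dim_vec (0\<^sub>v N :: 'a vec)"
        then show "(?M *\<^sub>v vec N (\<lambda>q. v (e q))) $ p = 0\<^sub>v N $ p"
          using v e mv[of p] re[of "\<lambda>j. A (e p) j * v j"] unfolding bij_betw_def by fastforce
      qed simp
      then have "vec N (\<lambda>q. v (e q)) = 0\<^sub>v N"
        using d det_0_iff_vec_prod_zero[OF M] by (metis vec_carrier)
      moreover obtain q where "q < N" "j = e q" using eJ[OF j] by auto
      ultimately show "v j = 0" by (metis index_vec index_zero_vec(1))
    qed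
  qed
qed

text \<open>With fewer rows than columns, zero rows pad the matrix to a square one that is still
  injective. Its transpose kills a unit vector, so its determinant vanishes, a
  contradiction.\<close>

lemma inj_mat_card:
  fixes A :: "'i \<Rightarrow> 'j \<Rightarrow> 'a::idom"
  assumes fin: "finite I" "finite J" and inj: "inj_mat I J A"
  shows "card J \<le> card I"
proof (rule ccontr)
  assume "\<not> ?thesis"
  then have less: "card I < card J" by simp
  obtain h where h: "inj_on h I" "h ` I \<subset> J"
  proof -
    obtain J' where J': "J' \<subseteq> J" "card J' = card I"
      using obtain_subset_with_card_n[of "card I" J] less by auto
    moreover have "J' \<noteq> J" using J' less by auto
    ultimately have J': "J' \<subset> J" "card J' = card I" by auto
    then have "finite J'" using fin(2) finite_subset by blast
    then obtain h where "bij_betw h I J'"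
      using finite_same_card_bij[OF fin(1), of J'] J' by auto
    then show thesis using that[of h] J' unfolding bij_betw_def by auto
  qed
  define B where "B j j' = (if j \<in> h ` I then A (inv_into I h j) j' else 0)" for j j'
  have "inj_mat J J B"
    unfolding inj_mat_def
  proof (intro allI impI)
    fix v assume v: "\<forall>i\<in>J. (\<Sum>j\<in>J. B i j * v j) = 0"
    have "(\<Sum>j\<in>J. A i j * v j) = 0" if "i \<in> I" for i
      using bspec[OF v, of "h i"] h that by (auto simp: B_def inv_into_f_f)
    then show "\<forall>j\<in>J. v j = 0" using inj unfolding inj_mat_def by blast
  qed
  obtain e where e: "bij_betw e {..<card J} J"
    using ex_bij_betw_nat_finite[OF fin(2)] by (auto simp: lessThan_atLeast0)
  let ?N = "card J"
  let ?M = "mat ?N ?N (\<lambda>(p, q). B (e p) (e q))"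
  obtain j0 where "j0 \<in> J" "j0 \<notin> h ` I" using h by blast
  moreover have "j0 \<in> e ` {..<?N}" using e \<open>j0 \<in> J\<close> by (simp add: bij_betw_def)
  ultimately obtain p where p: "p < ?N" "e p \<notin> h ` I" by auto
  have T: "?M\<^sup>T \<in> carrier_mat ?N ?N" by simp
  have "?M\<^sup>T *\<^sub>v unit_vec ?N p = 0\<^sub>v ?N"
  proof (rule eq_vecI)
    fix q assume "q < dim_vec (0\<^sub>v ?N :: 'a vec)"
    then show "(?M\<^sup>T *\<^sub>v unit_vec ?N p) $ q = 0\<^sub>v ?N $ q"
      using p by (simp add: B_def)
  qed simp
  moreover have "unit_vec ?N p \<noteq> (0\<^sub>v ?N :: 'a vec)"
    using p by (metis index_unit_vec(1) index_zero_vec(1) zero_neq_one)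
  ultimately have "det (?M\<^sup>T) = 0"
    using det_0_iff_vec_prod_zero[OF T] unit_vec_carrier by blast
  then have "det ?M = 0" by (simp add: det_transpose[of _ ?N])
  then show False using \<open>inj_mat J J B\<close> inj_mat_det[OF e] by blast
qed

lemma inj_mat_comp:
  fixes A :: "'i \<Rightarrow> 'j \<Rightarrow> 'a::idom"
  assumes "inj_mat K J (\<lambda>k j. \<Sum>i\<in>I. C k i * A i j)"
  shows "inj_mat I J A"
  unfolding inj_mat_def
proof (intro allI impI)
  fix v assume v: "\<forall>i\<in>I. (\<Sum>j\<in>J. A i j * v j) = 0"
  have "(\<Sum>j\<in>J. (\<Sum>i\<in>I. C k i * A i j) * v j) = 0" for k
  proof -
    have "(\<Sum>j\<in>J. (\<Sum>i\<in>I. C k i * A i j) * v j) = (\<Sum>i\<in>I. C k i * (\<Sum>j\<in>J. A i j * v j))"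
      by (simp add: sum_distrib_left sum_distrib_right mult.assoc) (rule sum.swap)
    then show ?thesis using v by simp
  qed
  then show "\<forall>j\<in>J. v j = 0" using assms unfolding inj_mat_def by blast
qed

text \<open>Positivity: the Gram form at \<open>v\<close> is the squared norm of \<open>A v\<close>.
  The Gram matrix is square, so determinants become available for rectangular
  \<open>A\<close>.\<close>

lemma inj_mat_gram:
  fixes A :: "'i \<Rightarrow> 'j \<Rightarrow> complex"
  assumes fin: "finite I" and inj: "inj_mat I J A"
  shows "inj_mat J J (\<lambda>j j'. \<Sum>i\<in>I. cnj (A i j) * A i j')"
  unfolding inj_mat_def
proof (intro allI impI)
  fix v assume v: "\<forall>j\<in>J. (\<Sum>j'\<in>J. (\<Sum>i\<in>I. cnj (A i j) * A i j') * v j') = 0"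
  define y where "y i = (\<Sum>j\<in>J. A i j * v j)" for i
  have G: "(\<Sum>j'\<in>J. (\<Sum>i\<in>I. cnj (A i j) * A i j') * v j') = (\<Sum>i\<in>I. cnj (A i j) * y i)" for j
    unfolding y_def
    by (simp add: sum_distrib_left sum_distrib_right mult.assoc) (rule sum.swap)
  have "0 = (\<Sum>j\<in>J. cnj (v j) * (\<Sum>i\<in>I. cnj (A i j) * y i))"
    using v G by (simp add: sum.neutral)
  also have "\<dots> = (\<Sum>i\<in>I. cnj (y i) * y i)"
    unfolding y_def[of "_"] cnj_sum complex_cnj_mult
    by (simp add: sum_distrib_left sum_distrib_right ac_simps) (rule sum.swap)
  also have "\<dots> = complex_of_real (\<Sum>i\<in>I. (cmod (y i))\<^sup>2)"
    by (simp add: complex_norm_square mult.commute del: of_real_power)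
  finally have "(\<Sum>i\<in>I. (cmod (y i))\<^sup>2) = 0"
    using of_real_eq_0_iff by metis
  then have "\<forall>i\<in>I. y i = 0" using fin by (simp add: sum_nonneg_eq_0_iff)
  then show "\<forall>j\<in>J. v j = 0" using inj unfolding inj_mat_def y_def by blast
qed

text \<open>The family is multiplied from the left by the conjugate transpose of the fixed matrix
  \<open>A\<close>, not of the perturbed one. So no conjugate of \<open>s\<close> occurs, the
  determinant is a polynomial in \<open>s\<close>, and at \<open>s = 0\<close> it is the Gram
  determinant of \<open>A\<close>.\<close>

lemma inj_mat_perturb:
  fixes A B :: "'i \<Rightarrow> 'j \<Rightarrow> complex"
  assumes fin: "finite I" "finite J" and inj: "inj_mat I J A"
  shows "finite {s. \<not> inj_mat I J (\<lambda>i j. A i j + s * B i j)}"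
proof -
  obtain e where e: "bij_betw e {..<card J} J"
    using ex_bij_betw_nat_finite[OF fin(2)] by (auto simp: lessThan_atLeast0)
  let ?N = "card J"
  define G where "G s j j' = (\<Sum>i\<in>I. cnj (A i j) * (A i j' + s * B i j'))" for s j j'
  define P where "P = mat ?N ?N (\<lambda>(p, q).
    [:\<Sum>i\<in>I. cnj (A i (e p)) * A i (e q), \<Sum>i\<in>I. cnj (A i (e p)) * B i (e q):])"
  have ev: "poly (det P) s = det (mat ?N ?N (\<lambda>(p, q). G s (e p) (e q)))" for s
  proof -
    interpret h: comm_ring_hom "\<lambda>p. poly p s" by standard auto
    have "poly (det P) s = det (map_mat (\<lambda>p. poly p s) P)" by simp
    also have "map_mat (\<lambda>p. poly p s) P = mat ?N ?N (\<lambda>(p, q). G s (e p) (e q))"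
      unfolding P_def G_def
      by (rule eq_matI) (auto simp: distrib_left sum.distrib sum_distrib_left ac_simps)
    finally show ?thesis .
  qed
  have "inj_mat J J (G 0)" using inj_mat_gram[OF fin(1) inj] unfolding G_def by simp
  then have "det P \<noteq> 0" using ev[of 0] inj_mat_det[OF e, of "G 0"] by auto
  then have "finite {s. poly (det P) s = 0}" by (rule poly_roots_finite)
  moreover have "inj_mat I J (\<lambda>i j. A i j + s * B i j)" if "poly (det P) s \<noteq> 0" for s
  proof -
    have "inj_mat J J (G s)" using that ev[of s] inj_mat_det[OF e, of "G s"] by auto
    then show ?thesis unfolding G_def by (rule inj_mat_comp)
  qed
  ultimately show ?thesis
    by (elim rev_finite_subset) (simp only: subset_eq mem_Collect_eq, blast)
qed

lemma inj_mat_scale: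
  fixes A :: "'i \<Rightarrow> 'j \<Rightarrow> 'a::idom"
  assumes "c \<noteq> 0"
  shows "inj_mat I J (\<lambda>i j. c * A i j) \<longleftrightarrow> inj_mat I J A"
  unfolding inj_mat_def using assms by (simp add: mult.assoc flip: sum_distrib_left)

text \<open>The substitution \<open>s = 1 / t\<close> lets the injective matrix be the direction
  instead of the starting point: an arbitrary \<open>B\<close> becomes injective after almost every
  step towards \<open>A\<close>.\<close>

lemma inj_mat_perturb':
  fixes A B :: "'i \<Rightarrow> 'j \<Rightarrow> complex"
  assumes fin: "finite I" "finite J" and inj: "inj_mat I J A"
  shows "finite {t. \<not> inj_mat I J (\<lambda>i j. B i j + t * A i j)}"
proof -
  let ?S = "{s. \<not> inj_mat I J (\<lambda>i j. A i j + s * B i j)}"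
  have *: "t \<in> insert 0 (inverse ` ?S)" if t: "\<not> inj_mat I J (\<lambda>i j. B i j + t * A i j)" for t
  proof (cases "t = 0")
    case False
    have "(\<lambda>i j. B i j + t * A i j) = (\<lambda>i j. t * (A i j + inverse t * B i j))"
    proof (intro ext)
      fix i j
      have "t * (A i j + inverse t * B i j) = t * A i j + (t * inverse t) * B i j"
        by (simp only: distrib_left mult.assoc)
      then show "B i j + t * A i j = t * (A i j + inverse t * B i j)" using False by simp
    qed
    then have "\<not> inj_mat I J (\<lambda>i j. t * (A i j + inverse t * B i j))" using t by simp
    then have "inverse t \<in> ?S" 
      using inj_mat_scale[OF False, of I J "\<lambda>i j. A i j + inverse t * B i j"] by simp
    then have "inverse (inverse t) \<in> inverse ` ?S" by (rule imageI)
    then show ?thesis by simp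
  qed simp
  have "finite (insert 0 (inverse ` ?S))" using inj_mat_perturb[OF assms, of B] by simp
  moreover have "{t. \<not> inj_mat I J (\<lambda>i j. B i j + t * A i j)} \<subseteq> insert 0 (inverse ` ?S)"
    using * by (simp only: Collect_mono_iff subset_eq mem_Collect_eq) simp
  ultimately show ?thesis by (rule finite_subset[rotated])
qed

lemma tendsto_det:
  fixes M :: "'t \<Rightarrow> complex mat"
  assumes "\<And>t. M t \<in> carrier_mat N N" "L \<in> carrier_mat N N"
    "\<And>i j. i < N \<Longrightarrow> j < N \<Longrightarrow> ((\<lambda>t. M t $$ (i, j)) \<longlongrightarrow> L $$ (i, j)) F"
  shows "((\<lambda>t. det (M t)) \<longlongrightarrow> det L) F"
proof -
  have "((\<lambda>t. \<Sum>p\<in>{p. p permutes {0..<N}}. signof p * (\<Prod>i = 0..<N. M t $$ (i, p i))) \<longlongrightarrow>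
     (\<Sum>p\<in>{p. p permutes {0..<N}}. signof p * (\<Prod>i = 0..<N. L $$ (i, p i)))) F"
    by (intro tendsto_sum tendsto_mult tendsto_const tendsto_prod assms(3))
      (auto simp: permutes_in_image dest!: permutes_in_image[where x = "_ :: nat"])
  then show ?thesis using assms(1,2) by (simp add: det_def'[of _ N])
qed

text \<open>As for perturbations, the left factor is the conjugate transpose of the limit
  \<open>A\<close>; the determinant of the square product is continuous and nonzero in the
  limit.\<close>

lemma inj_mat_eventually:
  fixes A :: "'i \<Rightarrow> 'j \<Rightarrow> complex"
  assumes fin: "finite I" "finite J" and inj: "inj_mat I J A"
    and lim: "\<And>i j. i \<in> I \<Longrightarrow> j \<in> J \<Longrightarrow> ((\<lambda>t. B t i j) \<longlongrightarrow> A i j) F"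
  shows "eventually (\<lambda>t. inj_mat I J (B t)) F"
proof -
  obtain e where e: "bij_betw e {..<card J} J"
    using ex_bij_betw_nat_finite[OF fin(2)] by (auto simp: lessThan_atLeast0)
  then have eJ: "e p \<in> J" if "p < card J" for p using that by (auto simp: bij_betw_def)
  let ?N = "card J"
  let ?m = "\<lambda>G. mat ?N ?N (\<lambda>(p, q). G (e p) (e q)) :: complex mat"
  define G where "G X j j' = (\<Sum>i\<in>I. cnj (A i j) * X i j')" for X :: "'i \<Rightarrow> 'j \<Rightarrow> complex" and j j'
  have "((\<lambda>t. det (?m (G (B t)))) \<longlongrightarrow> det (?m (G A))) F"
    by (rule tendsto_det[where N = ?N])
      (auto simp: G_def intro!: tendsto_sum tendsto_mult tendsto_const lim eJ)
  moreover have "det (?m (G A)) \<noteq> 0"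
    using inj_mat_det[OF e, of "G A"] inj_mat_gram[OF fin(1) inj] unfolding G_def by blast
  ultimately have "eventually (\<lambda>t. det (?m (G (B t))) \<noteq> 0) F"
    by (rule tendsto_imp_eventually_ne)
  then show ?thesis
  proof eventually_elim
    case (elim t)
    then have "inj_mat J J (G (B t))" using inj_mat_det[OF e, of "G (B t)"] by blast
    then show ?case unfolding G_def by (rule inj_mat_comp)
  qed
qed

section \<open>Minimal bases\<close>

definition pker :: "nat \<Rightarrow> nat \<Rightarrow> (nat \<Rightarrow> nat \<Rightarrow> complex poly) \<Rightarrow> (nat \<Rightarrow> complex poly) \<Rightarrow> bool" where
  "pker m n M x \<longleftrightarrow> (\<forall>i<m. (\<Sum>j<n. M i j * x j) = 0)"

definition vdeg :: "nat \<Rightarrow> (nat \<Rightarrow> complex poly) \<Rightarrow> nat" where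
  "vdeg n x = Max (insert 0 ((\<lambda>j. degree (x j)) ` {..<n}))"

text \<open>Degree below \<open>K\<close>, where \<open>K = 0\<close> forces the zero polynomial.\<close>

definition dlt :: "complex poly \<Rightarrow> nat \<Rightarrow> bool" where
  "dlt f K \<longleftrightarrow> (\<forall>t\<ge>K. coeff f t = 0)"

text \<open>A basis of the kernel over the field of rational functions with denominators cleared:
  the factor \<open>q\<close> is a common denominator of the coefficients of
  \<open>x\<close>.\<close>

definition pbasis ::
    "nat \<Rightarrow> nat \<Rightarrow> (nat \<Rightarrow> nat \<Rightarrow> complex poly) \<Rightarrow> nat \<Rightarrow> (nat \<Rightarrow> nat \<Rightarrow> complex poly) \<Rightarrow> bool" where
  "pbasis m n M p b \<longleftrightarrow> (\<forall>l<p. pker m n M (b l)) \<and> inj_mat {..<n} {..<p} (\<lambda>j l. b l j) \<and>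
     (\<forall>x. pker m n M x \<longrightarrow> (\<exists>q c. q \<noteq> 0 \<and> (\<forall>j<n. q * x j = (\<Sum>l<p. b l j * c l))))"

definition pmin ::
    "nat \<Rightarrow> nat \<Rightarrow> (nat \<Rightarrow> nat \<Rightarrow> complex poly) \<Rightarrow> nat \<Rightarrow> (nat \<Rightarrow> nat \<Rightarrow> complex poly) \<Rightarrow> bool" where
  "pmin m n M p b \<longleftrightarrow> pbasis m n M p b \<and>
     (\<forall>b'. pbasis m n M p b' \<longrightarrow> (\<Sum>l<p. vdeg n (b l)) \<le> (\<Sum>l<p. vdeg n (b' l)))"

text \<open>The coefficient bound \<open>K - e l\<close> (truncated, so that the coefficient vanishes for \<open>K \<le> e l\<close>)
  is the predictable degree property of minimal bases.\<close>

definition rbasis ::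
    "nat \<Rightarrow> nat \<Rightarrow> (nat \<Rightarrow> nat \<Rightarrow> complex poly) \<Rightarrow> nat \<Rightarrow> (nat \<Rightarrow> nat \<Rightarrow> complex poly) \<Rightarrow> (nat \<Rightarrow> nat) \<Rightarrow> bool" where
  "rbasis m n M p b e \<longleftrightarrow> (\<forall>l<p. pker m n M (b l)) \<and> (\<forall>l<p. \<forall>j<n. degree (b l j) \<le> e l) \<and>
     inj_mat {..<n} {..<p} (\<lambda>j l. b l j) \<and>
     (\<forall>x K. pker m n M x \<longrightarrow> (\<forall>j<n. dlt (x j) K) \<longrightarrow>
        (\<exists>c. (\<forall>j<n. x j = (\<Sum>l<p. b l j * c l)) \<and> (\<forall>l<p. dlt (c l) (K - e l))))"

lemma pker_comb:
  assumes "\<And>l. l \<in> L \<Longrightarrow> pker m n M (b l)"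
  shows "pker m n M (\<lambda>j. \<Sum>l\<in>L. b l j * c l)"
  unfolding pker_def
proof (intro allI impI)
  fix i assume i: "i < m"
  have "(\<Sum>j<n. M i j * (\<Sum>l\<in>L. b l j * c l)) = (\<Sum>l\<in>L. (\<Sum>j<n. M i j * b l j) * c l)"
    by (simp add: sum_distrib_left sum_distrib_right mult.assoc) (rule sum.swap)
  also have "\<dots> = 0" using assms i by (intro sum.neutral) (auto simp: pker_def)
  finally show "(\<Sum>j<n. M i j * (\<Sum>l\<in>L. b l j * c l)) = 0" .
qed

lemma pker_cong: "(\<And>j. j < n \<Longrightarrow> x j = y j) \<Longrightarrow> pker m n M x \<longleftrightarrow> pker m n M y"
  unfolding pker_def by (metis (no_types, lifting) lessThan_iff sum.cong)

lemma pker_cancel: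
  assumes "q \<noteq> 0" "pker m n M (\<lambda>j. q * x j)"
  shows "pker m n M x"
proof -
  have "(\<Sum>j<n. M i j * (q * x j)) = q * (\<Sum>j<n. M i j * x j)" for i
    by (simp add: sum_distrib_left mult.left_commute)
  then show ?thesis using assms by (simp add: pker_def)
qed

lemma degree_le_vdeg: "j < n \<Longrightarrow> degree (x j) \<le> vdeg n x"
  unfolding vdeg_def by (rule Max_ge) auto

lemma vdeg_le: "(\<And>j. j < n \<Longrightarrow> degree (x j) \<le> d) \<Longrightarrow> vdeg n x \<le> d"
  unfolding vdeg_def by auto

text \<open>A family of maximal size among independent families in the kernel. Adding any
  \<open>x\<close> makes it dependent, and the coefficient of \<open>x\<close> in that dependency
  serves as \<open>q\<close>.\<close>

lemma pbasis_exists: "\<exists>p b. p \<le> n \<and> pbasis m n M p b"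
proof -
  define S where "S = {p :: nat. \<exists>b. (\<forall>l<p. pker m n M (b l)) \<and> inj_mat {..<n} {..<p} (\<lambda>j l. b l j)}"
  have le: "p \<le> n" if "p \<in> S" for p
    using that inj_mat_card[of "{..<n}" "{..<p}"] unfolding S_def by fastforce
  have "0 \<in> S" by (simp add: S_def inj_mat_def)
  have finS: "finite S" using le by (meson atMost_iff finite_atMost finite_subset subsetI)
  define p where "p = Max S"
  have pS: "p \<in> S" unfolding p_def using finS \<open>0 \<in> S\<close> by (intro Max_in) auto
  then obtain b where b: "\<forall>l<p. pker m n M (b l)" "inj_mat {..<n} {..<p} (\<lambda>j l. b l j)"
    unfolding S_def by blast
  have "\<exists>q c. q \<noteq> 0 \<and> (\<forall>j<n. q * x j = (\<Sum>l<p. b l j * c l))" if x: "pker m n M x" for x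
  proof -
    define b' where "b' = b(p := x)"
    have "Suc p \<notin> S" using finS unfolding p_def by (meson Max_ge Suc_n_not_le_n)
    moreover have "\<forall>l<Suc p. pker m n M (b' l)" using b(1) x by (auto simp: b'_def less_Suc_eq)
    ultimately have "\<not> inj_mat {..<n} {..<Suc p} (\<lambda>j l. b' l j)" unfolding S_def by blast
    then obtain v l0 where v: "\<And>j. j < n \<Longrightarrow> (\<Sum>l<Suc p. b' l j * v l) = 0"
      and l0: "l0 < Suc p" "v l0 \<noteq> 0"
      unfolding inj_mat_def by auto
    have v': "(\<Sum>l<p. b l j * v l) + x j * v p = 0" if "j < n" for j
      using v[OF that] by (simp add: b'_def)
    have "v p \<noteq> 0"
    proof
      assume 0: "v p = 0"
      then have "v l = 0" if "l < p" for l
        using inj_matD[OF b(2), of v l] v' that by simp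
      then show False using l0 0 by (auto simp: less_Suc_eq)
    qed
    moreover have "v p * x j = (\<Sum>l<p. b l j * (- v l))" if "j < n" for j
      using v'[OF that] by (simp add: sum_negf algebra_simps eq_neg_iff_add_eq_0)
    ultimately show ?thesis by (intro exI[of _ "v p"] exI[of _ "\<lambda>l. - v l"]) auto
  qed
  then have "pbasis m n M p b" using b unfolding pbasis_def by blast
  then show ?thesis using le[OF pS] by blast
qed

lemma pmin_exists: "\<exists>p b. p \<le> n \<and> pmin m n M p b"
proof -
  obtain p b where pb: "p \<le> n" "pbasis m n M p b" using pbasis_exists by blast
  obtain b' where "pbasis m n M p b'"
    "\<And>b''. pbasis m n M p b'' \<Longrightarrow> (\<Sum>l<p. vdeg n (b' l)) \<le> (\<Sum>l<p. vdeg n (b'' l))"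
    using arg_min_nat_lemma[of "pbasis m n M p" b "\<lambda>b. \<Sum>l<p. vdeg n (b l)"] pb(2) by blast
  then show ?thesis using pb(1) unfolding pmin_def by blast
qed

text \<open>Steinitz exchange without division: the coefficients are multiplied by \<open>q\<close>
  or by \<open>c l0\<close> before \<open>x\<close> is substituted for \<open>b l0\<close> or the
  other way round.\<close>

lemma pbasis_exchange:
  assumes pb: "pbasis m n M p b" and x: "pker m n M x" and q: "q \<noteq> 0"
    and eq: "\<And>j. j < n \<Longrightarrow> q * x j = (\<Sum>l<p. b l j * c l)" and l0: "l0 < p" "c l0 \<noteq> 0"
  shows "pbasis m n M p (b(l0 := x))"
proof -
  let ?b = "b(l0 := x)" and ?L = "{..<p} - {l0}"
  have split: "(\<Sum>l<p. f l) = f l0 + (\<Sum>l\<in>?L. f l)" for f :: "nat \<Rightarrow> complex poly"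
    using l0 by (subst sum.remove[of _ l0]) auto
  have inj: "inj_mat {..<n} {..<p} (\<lambda>j l. b l j)" using pb by (simp add: pbasis_def)
  have "inj_mat {..<n} {..<p} (\<lambda>j l. ?b l j)"
    unfolding inj_mat_def
  proof (intro allI impI)
    fix v assume v: "\<forall>j\<in>{..<n}. (\<Sum>l<p. ?b l j * v l) = 0"
    define w where "w l = (if l = l0 then c l0 * v l0 else c l * v l0 + q * v l)" for l
    have "(\<Sum>l<p. b l j * w l) = 0" if "j < n" for j
    proof -
      have "(\<Sum>l<p. b l j * w l) = b l0 j * c l0 * v l0 + (\<Sum>l\<in>?L. b l j * (c l * v l0 + q * v l))"
        unfolding split by (simp add: w_def mult.assoc)
      also have "\<dots> = (b l0 j * c l0 + (\<Sum>l\<in>?L. b l j * c l)) * v l0 + q * (\<Sum>l\<in>?L. b l j * v l)"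
        by (simp add: sum_distrib_left sum_distrib_right sum.distrib algebra_simps)
      also have "b l0 j * c l0 + (\<Sum>l\<in>?L. b l j * c l) = q * x j"
        using eq[OF that] unfolding split by simp
      also have "q * x j * v l0 + q * (\<Sum>l\<in>?L. b l j * v l) =
          q * (x j * v l0 + (\<Sum>l\<in>?L. b l j * v l))"
        by (simp add: algebra_simps)
      also have "x j * v l0 + (\<Sum>l\<in>?L. b l j * v l) = (\<Sum>l<p. ?b l j * v l)"
        unfolding split by simp
      finally show ?thesis using v that by simp
    qed
    then have w: "w l = 0" if "l < p" for l using inj_matD[OF inj, of w l] that by simp
    then have v0: "v l0 = 0" using w[OF l0(1)] l0 by (simp add: w_def)
    show "\<forall>l\<in>{..<p}. v l = 0"
    proof
      fix l assume "l \<in> {..<p}"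
      then show "v l = 0" using w[of l] v0 q by (cases "l = l0") (auto simp: w_def)
    qed
  qed
  moreover have "\<exists>q' c'. q' \<noteq> 0 \<and> (\<forall>j<n. q' * y j = (\<Sum>l<p. ?b l j * c' l))" if y: "pker m n M y" for y
  proof -
    obtain q' c' where q': "q' \<noteq> 0" and c': "\<And>j. j < n \<Longrightarrow> q' * y j = (\<Sum>l<p. b l j * c' l)"
      using pb y unfolding pbasis_def by blast
    define d where "d l = (if l = l0 then c' l0 * q else c' l * c l0 - c' l0 * c l)" for l
    have "(c l0 * q') * y j = (\<Sum>l<p. ?b l j * d l)" if "j < n" for j
    proof -
      have "(\<Sum>l<p. ?b l j * d l) = c' l0 * (q * x j) + (\<Sum>l\<in>?L. b l j * (c' l * c l0 - c' l0 * c l))"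
        unfolding split by (simp add: d_def mult.left_commute mult.commute)
      also have "\<dots> = c l0 * (b l0 j * c' l0 + (\<Sum>l\<in>?L. b l j * c' l))"
        unfolding eq[OF that] split
        by (simp add: sum_distrib_left sum_distrib_right sum_subtractf algebra_simps)
      also have "\<dots> = c l0 * (q' * y j)" unfolding c'[OF that] split by simp
      finally show ?thesis by (simp add: mult.assoc)
    qed
    then show ?thesis using q' l0 by (intro exI[of _ "c l0 * q'"] exI[of _ d]) auto
  qed
  moreover have "\<forall>l<p. pker m n M (?b l)" using pb x by (simp add: pbasis_def)
  ultimately show ?thesis unfolding pbasis_def by blast
qed

text \<open>The exchange alters one summand of the degree sum only, and minimality forbids that
  summand to drop.\<close>

lemma pmin_exchange:
  assumes pm: "pmin m n M p b" and x: "pker m n M x" and q: "q \<noteq> 0"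
    and eq: "\<And>j. j < n \<Longrightarrow> q * x j = (\<Sum>l<p. b l j * c l)" and l0: "l0 < p" "c l0 \<noteq> 0"
  shows "vdeg n (b l0) \<le> vdeg n x"
proof -
  have "pbasis m n M p (b(l0 := x))"
    using pbasis_exchange[OF _ x q eq l0] pm by (simp add: pmin_def)
  then have "(\<Sum>l<p. vdeg n (b l)) \<le> (\<Sum>l<p. vdeg n ((b(l0 := x)) l))"
    using pm unfolding pmin_def by blast
  then show ?thesis using l0 by (simp add: sum.remove[of "{..<p}" l0])
qed

lemma ex_max_index:
  fixes e :: "nat \<Rightarrow> nat"
  assumes "finite S" "S \<noteq> {}"
  obtains l where "l \<in> S" "\<And>k. k \<in> S \<Longrightarrow> e k \<le> e l"
proof -
  have "Max (e ` S) \<in> e ` S" using assms by (intro Max_in) auto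
  then obtain l where "l \<in> S" "Max (e ` S) = e l" by auto
  then show thesis using that[of l] Max_ge[of "e ` S"] assms by (metis finite_imageI imageI)
qed

lemma pmin_combination_nonzero:
  assumes pm: "pmin m n M p b" and x: "pker m n M x" and q: "q \<noteq> 0"
    and eq: "\<And>j. j < n \<Longrightarrow> q * x j = (\<Sum>l<p. b l j * c l)" and l0: "l0 < p" "c l0 \<noteq> 0"
  shows "\<exists>j<n. x j \<noteq> 0"
proof (rule ccontr)
  assume "\<not> ?thesis"
  then have "(\<Sum>l<p. b l j * c l) = 0" if "j < n" for j using eq[OF that] that by simp
  then have "c l0 = 0"
    using inj_matD[of "{..<n}" "{..<p}" "\<lambda>j l. b l j" c l0] pm l0
    by (simp add: pmin_def pbasis_def)
  then show False using l0 by simp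
qed

text \<open>A dependency at \<open>z\<close> makes the constant combination of the basis vectors
  divisible by \<open>\<lambda> - z\<close>. The quotient is again in the kernel and has smaller
  degree than the largest basis vector involved, so exchanging that vector would contradict
  minimality.\<close>

lemma pmin_eval_inj:
  assumes pm: "pmin m n M p b"
  shows "inj_mat {..<n} {..<p} (\<lambda>j l. poly (b l j) z)"
proof (rule ccontr)
  assume "\<not> ?thesis"
  then obtain y where y: "\<And>j. j < n \<Longrightarrow> (\<Sum>l<p. poly (b l j) z * y l) = 0"
    and ne: "{l. l < p \<and> y l \<noteq> 0} \<noteq> {}"
    unfolding inj_mat_def by auto
  obtain l0 where "l0 \<in> {l. l < p \<and> y l \<noteq> 0}"
    and max: "\<And>l. l \<in> {l. l < p \<and> y l \<noteq> 0} \<Longrightarrow> vdeg n (b l) \<le> vdeg n (b l0)"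
    using ex_max_index[OF _ ne, of "\<lambda>l. vdeg n (b l)"] by auto
  then have l0: "l0 < p" "y l0 \<noteq> 0" by auto
  define f where "f j = (\<Sum>l<p. b l j * [:y l:])" for j
  have "[:-z, 1:] dvd f j" if "j < n" for j
    unfolding poly_eq_0_iff_dvd[symmetric] f_def using y[OF that] by (simp add: poly_sum mult.commute)
  then obtain x where x: "\<And>j. j < n \<Longrightarrow> f j = [:-z, 1:] * x j"
    unfolding dvd_def by metis
  have kf: "pker m n M f" unfolding f_def
    by (rule pker_comb) (use pm in \<open>auto simp: pmin_def pbasis_def\<close>)
  have "pker m n M (\<lambda>j. [:-z, 1:] * x j)" using kf x pker_cong[of n f] by simp
  then have kx: "pker m n M x" by (rule pker_cancel[rotated]) simp
  have eq: "[:-z, 1:] * x j = (\<Sum>l<p. b l j * [:y l:])" if "j < n" for j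
    using x[OF that] unfolding f_def by simp
  have c0: "[:y l0:] \<noteq> 0" using l0 by simp
  note * = pm kx _ eq l0(1) c0
  have le: "vdeg n (b l0) \<le> vdeg n x" by (rule pmin_exchange[OF *]) auto
  obtain j where j: "j < n" "x j \<noteq> 0" using pmin_combination_nonzero[OF *] by auto
  have degf: "degree (f j) \<le> vdeg n (b l0)" if "j < n" for j
    unfolding f_def
  proof (rule degree_sum_le)
    fix l assume "l \<in> {..<p}"
    then show "degree (b l j * [:y l:]) \<le> vdeg n (b l0)"
      using max[of l] degree_le_vdeg[OF that, of "b l"] by (cases "y l = 0") (auto simp: degree_mult_eq_0)
  qed simp
  have deg: "degree (x j) + 1 \<le> vdeg n (b l0)" if "j < n" "x j \<noteq> 0" for j
    using degf[OF that(1)] that unfolding x[OF that(1)] by (subst (asm) degree_mult_eq) auto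
  have "vdeg n x \<le> vdeg n (b l0) - 1"
  proof (rule vdeg_le)
    fix j assume "j < n"
    then show "degree (x j) \<le> vdeg n (b l0) - 1" using deg[of j] by (cases "x j = 0") auto
  qed
  then show False using le deg[OF j] by linarith
qed

lemma degree_less_if_coeff_0:
  assumes "degree f \<le> d" "coeff f d = 0" "f \<noteq> 0"
  shows "degree f < d"
  using assms by (metis le_neq_implies_less leading_coeff_0_iff)

text \<open>The analogue at infinity: the monomials in \<open>c\<close> raise all vectors involved
  to the degree of the largest one, so that a dependency cancels the top coefficients and yields a
  kernel vector of smaller degree to exchange.\<close>

lemma pmin_lead_inj:
  assumes pm: "pmin m n M p b"
  shows "inj_mat {..<n} {..<p} (\<lambda>j l. coeff (b l j) (vdeg n (b l)))"
proof (rule ccontr)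
  let ?e = "\<lambda>l. vdeg n (b l)"
  assume "\<not> ?thesis"
  then obtain y where y: "\<And>j. j < n \<Longrightarrow> (\<Sum>l<p. coeff (b l j) (?e l) * y l) = 0"
    and ne: "{l. l < p \<and> y l \<noteq> 0} \<noteq> {}"
    unfolding inj_mat_def by auto
  obtain l0 where "l0 \<in> {l. l < p \<and> y l \<noteq> 0}"
    and max: "\<And>l. l \<in> {l. l < p \<and> y l \<noteq> 0} \<Longrightarrow> ?e l \<le> ?e l0"
    using ex_max_index[OF _ ne, of ?e] by auto
  then have l0: "l0 < p" "y l0 \<noteq> 0" by auto
  define c where "c l = Polynomial.monom (y l) (?e l0 - ?e l)" for l
  define x where "x j = (\<Sum>l<p. b l j * c l)" for j
  have kx: "pker m n M x" unfolding x_def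
    by (rule pker_comb) (use pm in \<open>auto simp: pmin_def pbasis_def\<close>)
  have eq: "1 * x j = (\<Sum>l<p. b l j * c l)" if "j < n" for j unfolding x_def by simp
  have c0: "c l0 \<noteq> 0" using l0 by (simp add: c_def)
  note * = pm kx _ eq l0(1) c0
  have le: "?e l0 \<le> vdeg n x" by (rule pmin_exchange[OF *]) auto
  obtain j where j: "j < n" "x j \<noteq> 0" using pmin_combination_nonzero[OF *] by auto
  have degx: "degree (x j) \<le> ?e l0" if "j < n" for j
    unfolding x_def
  proof (rule degree_sum_le)
    fix l assume l: "l \<in> {..<p}"
    show "degree (b l j * c l) \<le> ?e l0"
    proof (cases "y l = 0")
      case False
      have "degree (b l j * c l) \<le> degree (b l j) + degree (c l)" by (rule degree_mult_le)
      also have "\<dots> \<le> ?e l + (?e l0 - ?e l)"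
        using degree_le_vdeg[OF that, of "b l"] by (intro add_mono) (auto simp: c_def degree_monom_le)
      also have "\<dots> = ?e l0" using max[of l] l False by simp
      finally show ?thesis .
    qed (simp add: c_def)
  qed simp
  have "coeff (x j) (?e l0) = 0" if "j < n" for j
  proof -
    have "coeff (b l j * c l) (?e l0) = coeff (b l j) (?e l) * y l" if "l < p" for l
    proof (cases "y l = 0")
      case False
      then have "?e l \<le> ?e l0" using max[of l] that by simp
      then show ?thesis unfolding c_def mult.commute[of "b l j"] coeff_monom_mult by simp
    qed (simp add: c_def)
    then show ?thesis using y[OF that] by (simp add: x_def coeff_sum)
  qed
  then have deg: "degree (x j) < ?e l0" if "j < n" "x j \<noteq> 0" for j
    using degree_less_if_coeff_0[OF degx[OF that(1)]] that by simp
  have "vdeg n x \<le> ?e l0 - 1"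
  proof (rule vdeg_le)
    fix j assume "j < n"
    then show "degree (x j) \<le> ?e l0 - 1" using deg[of j] by (cases "x j = 0") auto
  qed
  then show False using le deg[OF j] by linarith
qed

text \<open>The denominator \<open>q\<close> is removed root by root: at a root \<open>z\<close> the
  right-hand side vanishes, so injectivity at \<open>z\<close> forces every \<open>c l\<close> to be
  divisible by \<open>\<lambda> - z\<close> too.\<close>

lemma pmin_span:
  assumes pm: "pmin m n M p b" and x: "pker m n M x"
  shows "\<exists>c. \<forall>j<n. x j = (\<Sum>l<p. b l j * c l)"
proof -
  have *: "\<exists>c. \<forall>j<n. x j = (\<Sum>l<p. b l j * c l)"
    if "q \<noteq> 0" "\<forall>j<n. q * x j = (\<Sum>l<p. b l j * c l)" for q c
    using that
  proof (induction "degree q" arbitrary: q c rule: less_induct)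
    case less
    show ?case
    proof (cases "degree q = 0")
      case True
      then obtain k where k: "q = [:k:]" by (rule degree_eq_zeroE)
      then have "k \<noteq> 0" using less by simp
      have "x j = (\<Sum>l<p. b l j * ([:1/k:] * c l))" if "j < n" for j
      proof -
        have "x j = [:1/k:] * (q * x j)" using \<open>k \<noteq> 0\<close> k by simp
        also have "q * x j = (\<Sum>l<p. b l j * c l)" using less.prems(2) that by simp
        also have "[:1/k:] * \<dots> = (\<Sum>l<p. b l j * ([:1/k:] * c l))"
          unfolding sum_distrib_left by (simp only: mult.left_commute)
        finally show ?thesis .
      qed
      then show ?thesis by (intro exI[of _ "\<lambda>l. [:1/k:] * c l"] allI impI)
    next
      case False
      then have "\<not> constant (poly q)" using constant_degree[of q] by simp
      from fundamental_theorem_of_algebra[OF this] obtain z where z: "poly q z = 0" ..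
      have "poly (c l) z = 0" if "l < p" for l
      proof (rule inj_matD[OF pmin_eval_inj[OF pm, of z]])
        fix j assume "j \<in> {..<n}"
        then have "poly (q * x j) z = (\<Sum>l<p. poly (b l j) z * poly (c l) z)"
          using less.prems(2) by (simp add: poly_sum)
        then show "(\<Sum>l<p. poly (b l j) z * poly (c l) z) = 0" using z by simp
      qed (use that in simp)
      then have "\<forall>l<p. [:-z, 1:] dvd c l" by (simp add: poly_eq_0_iff_dvd)
      then obtain c' where c': "\<And>l. l < p \<Longrightarrow> c l = [:-z, 1:] * c' l" unfolding dvd_def by metis
      obtain q' where q': "q = [:-z, 1:] * q'" using z unfolding poly_eq_0_iff_dvd dvd_def by blast
      have q0: "q' \<noteq> 0" using q' less.prems by auto
      have "degree q' < degree q" using q0 unfolding q' by (subst degree_mult_eq) auto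
      moreover have "q' * x j = (\<Sum>l<p. b l j * c' l)" if "j < n" for j
      proof -
        have "[:-z, 1:] * (q' * x j) = q * x j" unfolding q' by (simp only: mult.assoc)
        also have "\<dots> = (\<Sum>l<p. b l j * c l)" using less.prems(2) that by simp
        also have "\<dots> = (\<Sum>l<p. b l j * ([:-z, 1:] * c' l))" using c' by (intro sum.cong) auto
        also have "\<dots> = [:-z, 1:] * (\<Sum>l<p. b l j * c' l)"
          unfolding sum_distrib_left by (simp only: mult.left_commute)
        finally have "[:-z, 1:] * (q' * x j) = [:-z, 1:] * (\<Sum>l<p. b l j * c' l)" .
        then show ?thesis by (rule mult_left_cancel[THEN iffD1, rotated]) simp
      qed
      ultimately show ?thesis using less.hyps[of q' c'] q0 by blast
    qed
  qed
  show ?thesis using * pm x unfolding pmin_def pbasis_def by blast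
qed

lemma dlt_iff_degree: "dlt f (Suc k) \<longleftrightarrow> degree f \<le> k"
  unfolding dlt_def by (metis Suc_le_eq coeff_eq_0 degree_le le_less_trans not_le)

text \<open>The highest coefficient of a combination cannot cancel, because the leading coefficients
  of the basis vectors are independent.\<close>

lemma pmin_rbasis:
  assumes pm: "pmin m n M p b"
  shows "rbasis m n M p b (\<lambda>l. vdeg n (b l))"
  unfolding rbasis_def
proof (intro conjI allI impI)
  let ?e = "\<lambda>l. vdeg n (b l)"
  fix x K assume kx: "pker m n M x" and K: "\<forall>j<n. dlt (x j) K"
  obtain c where c: "\<forall>j<n. x j = (\<Sum>l<p. b l j * c l)" using pmin_span[OF pm kx] by blast
  have "dlt (c l) (K - ?e l)" if l: "l < p" for l
  proof (rule ccontr)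
    assume "\<not> ?thesis"
    then obtain t0 where t0: "t0 \<ge> K - ?e l" "coeff (c l) t0 \<noteq> 0" unfolding dlt_def by blast
    define S where "S = {l. l < p \<and> c l \<noteq> 0}"
    have "l \<in> S" using l t0 by (auto simp: S_def)
    then have "S \<noteq> {}" "finite S" by (auto simp: S_def)
    then obtain l1 where l1: "l1 \<in> S"
      and max: "\<And>k. k \<in> S \<Longrightarrow> degree (c k) + ?e k \<le> degree (c l1) + ?e l1"
      using ex_max_index[of S "\<lambda>k. degree (c k) + ?e k"] by blast
    \<comment> \<open>The degree that the combination has if nothing cancels at the top. It is at
      least \<open>K\<close>, so the coefficient of \<open>x\<close> there vanishes by
      assumption.\<close>
    define \<mu> where "\<mu> = degree (c l1) + ?e l1"
    have "K \<le> t0 + ?e l" using t0 by linarith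
    also have "t0 \<le> degree (c l)" using t0 by (intro le_degree)
    then have "t0 + ?e l \<le> \<mu>" using max[OF \<open>l \<in> S\<close>] unfolding \<mu>_def by linarith
    finally have K\<mu>: "K \<le> \<mu>" .
    define y where "y k = (if ?e k \<le> \<mu> then coeff (c k) (\<mu> - ?e k) else 0)" for k
    have tm: "coeff (b k j * c k) \<mu> = coeff (b k j) (?e k) * y k" if k: "k < p" and j: "j < n" for k j
    proof (cases "k \<in> S")
      case True
      then have le: "degree (c k) + ?e k \<le> \<mu>" using max unfolding \<mu>_def by blast
      have db: "degree (b k j) \<le> ?e k" using j by (rule degree_le_vdeg)
      have "coeff (b k j * c k) \<mu> = (\<Sum>i\<le>\<mu>. coeff (b k j) i * coeff (c k) (\<mu> - i))"
        by (rule coeff_mult)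
      also have "\<dots> = (\<Sum>i\<in>{?e k}. coeff (b k j) i * coeff (c k) (\<mu> - i))"
      proof (rule sum.mono_neutral_right)
        show "\<forall>i\<in>{..\<mu>} - {?e k}. coeff (b k j) i * coeff (c k) (\<mu> - i) = 0"
        proof
          fix i assume "i \<in> {..\<mu>} - {?e k}"
          then have "i < ?e k \<or> ?e k < i" "i \<le> \<mu>" by auto
          then show "coeff (b k j) i * coeff (c k) (\<mu> - i) = 0"
            using le db by (auto intro!: coeff_eq_0)
        qed
      qed (use le in auto)
      finally show ?thesis using le by (simp add: y_def)
    next
      case False
      then have "c k = 0" using k by (simp add: S_def)
      then show ?thesis by (simp add: y_def)
    qed
    have "y l1 = 0"
    proof (rule inj_matD[OF pmin_lead_inj[OF pm], of y])
      fix j assume j: "j \<in> {..<n}"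
      have "(\<Sum>k<p. coeff (b k j) (?e k) * y k) = coeff (x j) \<mu>"
        using c j tm by (simp add: coeff_sum)
      also have "\<dots> = 0" using K j K\<mu> by (simp add: dlt_def)
      finally show "(\<Sum>k<p. coeff (b k j) (?e k) * y k) = 0" .
    qed (use l1 in \<open>simp add: S_def\<close>)
    then show False using l1 by (simp add: y_def \<mu>_def S_def)
  qed
  then show "\<exists>c. (\<forall>j<n. x j = (\<Sum>l<p. b l j * c l)) \<and> (\<forall>l<p. dlt (c l) (K - ?e l))"
    using c by blast
qed (use pm in \<open>auto simp: pmin_def pbasis_def intro: degree_le_vdeg\<close>)

text \<open>By the coefficient bound with \<open>K = k + 1\<close>, a kernel vector of degree at
  most \<open>k\<close> involves only those \<open>b l\<close> with \<open>e l \<le> k\<close>. The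
  coefficient matrix of independent vectors of this kind is injective, so there are no more of
  them.\<close>

lemma rbasis_count:
  fixes p' :: nat
  assumes rb: "rbasis m n M p b e" and ker: "\<And>l. l < p' \<Longrightarrow> pker m n M (b' l)"
    and inj: "inj_mat {..<n} {..<p'} (\<lambda>j l. b' l j)"
    and deg: "\<And>l j. l < p' \<Longrightarrow> j < n \<Longrightarrow> degree (b' l j) \<le> e' l"
  shows "card {l. l < p' \<and> e' l \<le> k} \<le> card {l. l < p \<and> e l \<le> k}"
proof -
  let ?S = "{l. l < p \<and> e l \<le> k}" and ?S' = "{l. l < p' \<and> e' l \<le> k}"
  have "\<forall>l\<in>?S'. \<exists>c. (\<forall>j<n. b' l j = (\<Sum>i<p. b i j * c i)) \<and> (\<forall>i<p. dlt (c i) (Suc k - e i))"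
  proof
    fix l assume l: "l \<in> ?S'"
    then have "\<forall>j<n. dlt (b' l j) (Suc k)" using deg by (force simp: dlt_iff_degree)
    then show "\<exists>c. (\<forall>j<n. b' l j = (\<Sum>i<p. b i j * c i)) \<and> (\<forall>i<p. dlt (c i) (Suc k - e i))"
      using rb ker l unfolding rbasis_def by blast
  qed
  from bchoice[OF this] obtain c where "\<forall>l\<in>?S'. (\<forall>j<n. b' l j = (\<Sum>i<p. b i j * c l i)) \<and>
      (\<forall>i<p. dlt (c l i) (Suc k - e i))" ..
  then have c: "\<And>l j. l \<in> ?S' \<Longrightarrow> j < n \<Longrightarrow> b' l j = (\<Sum>i<p. b i j * c l i)"
    and dc: "\<And>l i. l \<in> ?S' \<Longrightarrow> i < p \<Longrightarrow> dlt (c l i) (Suc k - e i)"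
    by simp_all
  have "inj_mat ?S ?S' (\<lambda>i l. c l i)"
    unfolding inj_mat_def
  proof (intro allI impI ballI)
    fix v l assume v: "\<forall>i\<in>?S. (\<Sum>l\<in>?S'. c l i * v l) = 0" and l: "l \<in> ?S'"
    have v': "(\<Sum>l\<in>?S'. c l i * v l) = 0" if "i < p" for i
    proof (cases "e i \<le> k")
      case False
      then have "c l i = 0" if "l \<in> ?S'" for l
        using dc[OF that \<open>i < p\<close>] by (simp add: dlt_def poly_eq_iff)
      then show ?thesis by simp
    qed (use v that in auto)
    define w where "w l = (if l \<in> ?S' then v l else 0)" for l
    have "(\<Sum>l<p'. b' l j * w l) = 0" if "j < n" for j
    proof -
      have "(\<Sum>l<p'. b' l j * w l) = (\<Sum>l\<in>?S'. b' l j * v l)"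
        unfolding w_def by (rule sum.mono_neutral_cong_right) auto
      also have "\<dots> = (\<Sum>l\<in>?S'. (\<Sum>i<p. b i j * c l i) * v l)" using c that by (intro sum.cong) auto
      also have "\<dots> = (\<Sum>i<p. b i j * (\<Sum>l\<in>?S'. c l i * v l))"
        by (simp add: sum_distrib_left sum_distrib_right mult.assoc) (rule sum.swap)
      finally show ?thesis using v' by simp
    qed
    then have "w l = 0" using inj_matD[OF inj, of w l] l by simp
    then show "v l = 0" using l by (simp add: w_def)
  qed
  then show ?thesis by (intro inj_mat_card) auto
qed

lemma mset_eq_if_counts_le:
  fixes e e' :: "nat \<Rightarrow> nat"
  assumes "\<And>k. card {l. l < p \<and> e l \<le> k} = card {l. l < p' \<and> e' l \<le> k}"
  shows "mset (map e [0..<p]) = mset (map e' [0..<p'])"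
proof -
  have cnt: "count (mset (map f [0..<q])) k = card {l. l < q \<and> f l = k}" for f :: "nat \<Rightarrow> nat" and q k
  proof -
    have "count (mset (map f [0..<q])) k = card (f -` {k} \<inter> {0..<q})"
      by (simp add: count_image_mset)
    also have "f -` {k} \<inter> {0..<q} = {l. l < q \<and> f l = k}" by auto
    finally show ?thesis .
  qed
  have dif: "card {l. l < q \<and> f l = k} =
      card {l. l < q \<and> f l \<le> k} - (if k = 0 then 0 else card {l. l < q \<and> f l \<le> k - 1})"
    for f :: "nat \<Rightarrow> nat" and q k
  proof (cases k)
    case (Suc i)
    have "{l. l < q \<and> f l = k} = {l. l < q \<and> f l \<le> k} - {l. l < q \<and> f l \<le> i}" using Suc by auto
    also have "card \<dots> = card {l. l < q \<and> f l \<le> k} - card {l. l < q \<and> f l \<le> i}"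
      using Suc by (intro card_Diff_subset) auto
    finally show ?thesis using Suc by simp
  qed simp
  show ?thesis by (rule multiset_eqI) (simp only: cnt dif assms)
qed

text \<open>The count in both directions. This is what makes the definite description in
  \<open>minimal_indices\<close> refer to something.\<close>

lemma rbasis_unique:
  assumes "rbasis m n M p b e" "rbasis m n M p' b' e'"
  shows "mset (map e [0..<p]) = mset (map e' [0..<p'])"
proof (rule mset_eq_if_counts_le)
  fix k
  show "card {l. l < p \<and> e l \<le> k} = card {l. l < p' \<and> e' l \<le> k}"
    using rbasis_count[OF assms(1), of p' b' e' k] rbasis_count[OF assms(2), of p b e k] assms
    unfolding rbasis_def by (intro antisym) blast+
qed

section \<open>Sylvester matrices\<close>

text \<open>Below \<open>A\<close>, \<open>stack\<close> puts the conjugate transpose of a matrix \<open>B\<close> whose columns span the kernel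
  of \<open>A\<close>. This makes the matrix injective, hence injective for every \<open>A'\<close> near \<open>A\<close>, which bounds the
  dimension of the kernel of \<open>A'\<close> by the number of columns of \<open>B\<close>.\<close>

definition stack :: "('i \<Rightarrow> 'j \<Rightarrow> complex) \<Rightarrow> ('j \<Rightarrow> 'h \<Rightarrow> complex) \<Rightarrow> 'i + 'h \<Rightarrow> 'j \<Rightarrow> complex" where
  "stack A B = case_sum A (\<lambda>h j. cnj (B j h))"

text \<open>A null vector lies in the span of the columns of \<open>B\<close> and is orthogonal to
  them, so its norm is zero.\<close>

lemma stack_inj:
  assumes fin: "finite J"
    and span: "\<And>v. (\<And>i. i \<in> I \<Longrightarrow> (\<Sum>j\<in>J. A i j * v j) = 0) \<Longrightarrow>
      \<exists>w. \<forall>j\<in>J. v j = (\<Sum>h\<in>H. B j h * w h)"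
  shows "inj_mat (I <+> H) J (stack A B)"
  unfolding inj_mat_def
proof (intro allI impI)
  fix v assume v: "\<forall>i\<in>I <+> H. (\<Sum>j\<in>J. stack A B i j * v j) = 0"
  have "(\<Sum>j\<in>J. A i j * v j) = 0" if "i \<in> I" for i
    using bspec[OF v InlI[OF that]] by (simp add: stack_def)
  then obtain w where w: "\<forall>j\<in>J. v j = (\<Sum>h\<in>H. B j h * w h)" using span by blast
  have Bv: "(\<Sum>j\<in>J. cnj (B j h) * v j) = 0" if "h \<in> H" for h
    using bspec[OF v InrI[OF that]] by (simp add: stack_def)
  have "complex_of_real (\<Sum>j\<in>J. (cmod (v j))\<^sup>2) = (\<Sum>j\<in>J. cnj (v j) * v j)"
    by (simp add: complex_norm_square mult.commute del: of_real_power)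
  also have "\<dots> = (\<Sum>j\<in>J. cnj (\<Sum>h\<in>H. B j h * w h) * v j)"
    using w by (intro sum.cong) auto
  also have "\<dots> = (\<Sum>j\<in>J. \<Sum>h\<in>H. cnj (w h) * (cnj (B j h) * v j))"
    unfolding cnj_sum sum_distrib_right complex_cnj_mult by (intro sum.cong refl) (simp only: ac_simps)
  also have "\<dots> = (\<Sum>h\<in>H. \<Sum>j\<in>J. cnj (w h) * (cnj (B j h) * v j))" by (rule sum.swap)
  also have "\<dots> = 0" using Bv by (simp flip: sum_distrib_left)
  finally have "(\<Sum>j\<in>J. (cmod (v j))\<^sup>2) = 0" using of_real_eq_0_iff by metis
  then show "\<forall>j\<in>J. v j = 0" using fin by (simp add: sum_nonneg_eq_0_iff)
qed

text \<open>The columns of \<open>B'\<close> lie in the kernel of \<open>A\<close>, and there the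
  conjugate transpose of \<open>B\<close> alone has to be injective.\<close>

lemma stack_card_le:
  assumes fin: "finite I" "finite J" "finite H" "finite H'"
    and inj: "inj_mat (I <+> H) J (stack A B)" and inj': "inj_mat J H' B'"
    and zero: "\<And>i h. i \<in> I \<Longrightarrow> h \<in> H' \<Longrightarrow> (\<Sum>j\<in>J. A i j * B' j h) = 0"
  shows "card H' \<le> card H"
proof -
  have "inj_mat H H' (\<lambda>h h'. \<Sum>j\<in>J. cnj (B j h) * B' j h')"
    unfolding inj_mat_def
  proof (intro allI impI)
    fix w assume w: "\<forall>h\<in>H. (\<Sum>h'\<in>H'. (\<Sum>j\<in>J. cnj (B j h) * B' j h') * w h') = 0"
    define v where "v j = (\<Sum>h'\<in>H'. B' j h' * w h')" for j
    have *: "(\<Sum>j\<in>J. f j * v j) = (\<Sum>h'\<in>H'. (\<Sum>j\<in>J. f j * B' j h') * w h')" for f :: "_ \<Rightarrow> complex"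
      unfolding v_def by (simp add: sum_distrib_left sum_distrib_right mult.assoc) (rule sum.swap)
    have "(\<Sum>j\<in>J. stack A B k j * v j) = 0" if "k \<in> I <+> H" for k
      using that w zero by (auto simp: stack_def *)
    then have "v j = 0" if "j \<in> J" for j using inj_matD[OF inj, of v j] that by simp
    then show "\<forall>h'\<in>H'. w h' = 0" using inj' unfolding inj_mat_def v_def by blast
  qed
  then show ?thesis by (rule inj_mat_card[OF fin(3,4)])
qed

lemma inj_mat_cnj:
  assumes "inj_mat I J A"
  shows "inj_mat I J (\<lambda>i j. cnj (A i j))"
  unfolding inj_mat_def
proof (intro allI impI ballI)
  fix v j assume v: "\<forall>i\<in>I. (\<Sum>j\<in>J. cnj (A i j) * v j) = 0" and j: "j \<in> J"
  have "(\<Sum>j\<in>J. A i j * cnj (v j)) = 0" if "i \<in> I" for i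
  proof -
    have "(\<Sum>j\<in>J. A i j * cnj (v j)) = cnj (\<Sum>j\<in>J. cnj (A i j) * v j)" by simp
    then show ?thesis using v that by simp
  qed
  then have "cnj (v j) = 0" using inj_matD[OF assms, of "\<lambda>j. cnj (v j)" j] j by simp
  then show "v j = 0" by simp
qed

text \<open>Half of the rank-nullity theorem: the conjugated rows of \<open>A\<close> are orthogonal
  to the columns of \<open>B\<close>, so both families together are independent.\<close>

lemma complex_card_le:
  assumes fin: "finite I" "finite J" "finite H"
    and injA: "inj_mat J I (\<lambda>j i. A i j)" and injB: "inj_mat J H B"
    and zero: "\<And>i h. i \<in> I \<Longrightarrow> h \<in> H \<Longrightarrow> (\<Sum>j\<in>J. A i j * B j h) = (0 :: complex)"
  shows "card I + card H \<le> card J"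
proof -
  define C where "C j k = case_sum (\<lambda>i. cnj (A i j)) (\<lambda>h. B j h) k" for j k
  have "inj_mat J (I <+> H) C"
    unfolding inj_mat_def
  proof (intro allI impI)
    fix v assume v: "\<forall>j\<in>J. (\<Sum>k\<in>I <+> H. C j k * v k) = 0"
    have v: "(\<Sum>i\<in>I. cnj (A i j) * v (Inl i)) + (\<Sum>h\<in>H. B j h * v (Inr h)) = 0" if "j \<in> J" for j
      using bspec[OF v that] fin by (simp add: sum.Plus C_def)
    have G: "inj_mat I I (\<lambda>i i'. \<Sum>j\<in>J. A i j * cnj (A i' j))"
      using inj_mat_gram[OF fin(2) inj_mat_cnj[OF injA]] by simp
    have "(\<Sum>i'\<in>I. (\<Sum>j\<in>J. A i j * cnj (A i' j)) * v (Inl i')) = 0" if i: "i \<in> I" for i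
    proof -
      have "(\<Sum>i'\<in>I. (\<Sum>j\<in>J. A i j * cnj (A i' j)) * v (Inl i')) =
          (\<Sum>j\<in>J. A i j * (\<Sum>i'\<in>I. cnj (A i' j) * v (Inl i')))"
        by (simp add: sum_distrib_left sum_distrib_right mult.assoc) (rule sum.swap)
      also have "\<dots> = (\<Sum>j\<in>J. A i j * (- (\<Sum>h\<in>H. B j h * v (Inr h))))"
        using v by (intro sum.cong refl arg_cong2[where f = "(*)"]) (simp add: eq_neg_iff_add_eq_0)
      also have "\<dots> = - (\<Sum>h\<in>H. (\<Sum>j\<in>J. A i j * B j h) * v (Inr h))"
        by (simp add: sum_distrib_left sum_distrib_right mult.assoc sum_negf) (rule sum.swap)
      also have "\<dots> = 0" using zero[OF i] by simp
      finally show ?thesis .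
    qed
    then have vI: "v (Inl i) = 0" if "i \<in> I" for i
      using inj_matD[OF G, of "\<lambda>i. v (Inl i)" i] that by simp
    then have "(\<Sum>h\<in>H. B j h * v (Inr h)) = 0" if "j \<in> J" for j using v[OF that] by simp
    then have vH: "v (Inr h) = 0" if "h \<in> H" for h
      using inj_matD[OF injB, of "\<lambda>h. v (Inr h)" h] that by simp
    show "\<forall>k\<in>I <+> H. v k = 0" using vI vH by auto
  qed
  then have "card (I <+> H) \<le> card J" using fin by (intro inj_mat_card) auto
  then show ?thesis using fin by (simp add: card_Plus)
qed

section \<open>Sylvester matrices and the dimension of their kernels\<close>

text \<open>Column \<open>(j, t)\<close> stands for the monomial \<open>\<lambda>^t\<close> in the \<open>j\<close>-th unknown, row \<open>(i, s)\<close> for the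
  coefficient of \<open>\<lambda>^s\<close> in the \<open>i\<close>-th equation of \<open>R x = 0\<close>.\<close>

definition syl :: "(nat \<Rightarrow> nat \<Rightarrow> complex poly) \<Rightarrow> nat \<times> nat \<Rightarrow> nat \<times> nat \<Rightarrow> complex" where
  "syl R = (\<lambda>(i, s) (j, t). if t \<le> s then coeff (R i j) (s - t) else 0)"

text \<open>An unknown of degree below \<open>K\<close> times an entry of degree at most
  \<open>dd i\<close> has no coefficients from \<open>K + dd i\<close> on, so these rows express the
  whole equation.\<close>

abbreviation rows_idx :: "(nat \<Rightarrow> nat) \<Rightarrow> nat \<Rightarrow> nat \<Rightarrow> (nat \<times> nat) set" where
  "rows_idx dd r K \<equiv> Sigma {..<r} (\<lambda>i. {..<K + dd i})"

text \<open>Surjectivity of the Sylvester matrix, as injectivity of its transpose.\<close>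

abbreviation (input) syl_surj :: "nat \<Rightarrow> nat \<Rightarrow> (nat \<Rightarrow> nat) \<Rightarrow> nat \<Rightarrow> (nat \<Rightarrow> nat \<Rightarrow> complex poly) \<Rightarrow> bool" where
  "syl_surj r n dd K R \<equiv> inj_mat ({..<n} \<times> {..<K}) (rows_idx dd r K) (\<lambda>jt is. syl R is jt)"

abbreviation (input) shift_coeff :: "complex poly \<Rightarrow> nat \<Rightarrow> nat \<Rightarrow> complex" where
  "shift_coeff f t s \<equiv> (if t \<le> s then coeff f (s - t) else 0)"

definition pv :: "nat \<Rightarrow> (nat \<times> nat \<Rightarrow> complex) \<Rightarrow> nat \<Rightarrow> complex poly" where
  "pv K v j = (\<Sum>t<K. Polynomial.monom (v (j, t)) t)"

lemma coeff_pv: "coeff (pv K v j) t = (if t < K then v (j, t) else 0)"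
  unfolding pv_def coeff_sum coeff_monom by (simp add: sum.delta)

lemma dlt_pv: "dlt (pv K v j) K"
  by (simp add: dlt_def coeff_pv)

lemma coeff_mult_dlt:
  assumes "dlt f K"
  shows "coeff (g * f) s = (\<Sum>t<K. shift_coeff g t s * coeff f t)"
proof -
  have "coeff (g * f) s = (\<Sum>t\<le>s. coeff f t * coeff g (s - t))"
    by (subst mult.commute) (rule coeff_mult)
  also have "\<dots> = (\<Sum>t\<in>{..s} \<inter> {..<K}. coeff f t * coeff g (s - t))"
  proof (intro sum.mono_neutral_right ballI)
    fix i assume "i \<in> {..s} - {..s} \<inter> {..<K}"
    then have "K \<le> i" by auto
    then show "coeff f i * coeff g (s - i) = 0" using assms by (simp add: dlt_def)
  qed auto
  also have "\<dots> = (\<Sum>t<K. shift_coeff g t s * coeff f t)"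
    by (rule sum.mono_neutral_cong_left) auto
  finally show ?thesis .
qed

lemma syl_apply:
  assumes "\<And>j. j < n \<Longrightarrow> dlt (x j) K"
  shows "(\<Sum>jt\<in>{..<n} \<times> {..<K}. syl R (i, s) jt * (case jt of (j, t) \<Rightarrow> coeff (x j) t)) =
    coeff (\<Sum>j<n. R i j * x j) s"
proof -
  have "(\<Sum>jt\<in>{..<n} \<times> {..<K}. syl R (i, s) jt * (case jt of (j, t) \<Rightarrow> coeff (x j) t)) =
      (\<Sum>j<n. \<Sum>t<K. shift_coeff (R i j) t s * coeff (x j) t)"
    unfolding sum.cartesian_product by (intro sum.cong) (auto simp: syl_def)
  also have "\<dots> = (\<Sum>j<n. coeff (R i j * x j) s)"
    by (intro sum.cong refl coeff_mult_dlt[symmetric] assms) simp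
  finally show ?thesis by (simp add: coeff_sum)
qed

lemma syl_pv:
  "(\<Sum>jt\<in>{..<n} \<times> {..<K}. syl R (i, s) jt * v jt) = coeff (\<Sum>j<n. R i j * pv K v j) s"
proof -
  have "(\<Sum>jt\<in>{..<n} \<times> {..<K}. syl R (i, s) jt * v jt) =
      (\<Sum>jt\<in>{..<n} \<times> {..<K}. syl R (i, s) jt * (case jt of (j, t) \<Rightarrow> coeff (pv K v j) t))"
    by (intro sum.cong refl) (auto simp: coeff_pv)
  also have "\<dots> = coeff (\<Sum>j<n. R i j * pv K v j) s" by (rule syl_apply) (rule dlt_pv)
  finally show ?thesis .
qed

lemma dlt_mult:
  assumes "degree g \<le> d" "dlt f K"
  shows "dlt (g * f) (K + d)"
  unfolding dlt_def
proof (intro allI impI)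
  fix s assume s: "s \<ge> K + d"
  have "coeff g (s - t) = 0" if "t < K" for t using that s assms(1) by (intro coeff_eq_0) linarith
  then show "coeff (g * f) s = 0" unfolding coeff_mult_dlt[OF assms(2)] by (intro sum.neutral) auto
qed

lemma dlt_sum: "(\<And>j. j \<in> A \<Longrightarrow> dlt (f j) K) \<Longrightarrow> dlt (\<Sum>j\<in>A. f j) K"
  by (simp add: dlt_def coeff_sum)

lemma dlt_eq_0: "dlt f K \<Longrightarrow> (\<And>s. s < K \<Longrightarrow> coeff f s = 0) \<Longrightarrow> f = 0"
  unfolding dlt_def by (intro poly_eqI) (metis coeff_0 not_le)

lemma syl_pker:
  assumes deg: "\<And>i j. i < r \<Longrightarrow> j < n \<Longrightarrow> degree (R i j) \<le> dd i"
  shows "(\<forall>is\<in>rows_idx dd r K. (\<Sum>jt\<in>{..<n} \<times> {..<K}. syl R is jt * v jt) = 0) \<longleftrightarrow> pker r n R (pv K v)"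
proof -
  have d: "dlt (\<Sum>j<n. R i j * pv K v j) (K + dd i)" if "i < r" for i
    using that deg by (intro dlt_sum dlt_mult dlt_pv) auto
  have "(\<Sum>j<n. R i j * pv K v j) = 0 \<longleftrightarrow> (\<forall>s<K + dd i. coeff (\<Sum>j<n. R i j * pv K v j) s = 0)"
    if "i < r" for i
  proof
    assume "\<forall>s<K + dd i. coeff (\<Sum>j<n. R i j * pv K v j) s = 0"
    then show "(\<Sum>j<n. R i j * pv K v j) = 0" by (intro dlt_eq_0[OF d[OF that]]) simp
  qed simp
  moreover have "(\<forall>is\<in>rows_idx dd r K. (\<Sum>jt\<in>{..<n} \<times> {..<K}. syl R is jt * v jt) = 0) \<longleftrightarrow>
      (\<forall>i<r. \<forall>s<K + dd i. coeff (\<Sum>j<n. R i j * pv K v j) s = 0)"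
    unfolding syl_pv[symmetric] by auto
  ultimately show ?thesis unfolding pker_def by simp
qed

text \<open>Indices of the multiples \<open>\<lambda>^t b\<^sub>l\<close> of degree below
  \<open>K\<close>. Their number is the dimension of the space of kernel vectors of degree below
  \<open>K\<close>.\<close>

abbreviation ker_idx :: "nat \<Rightarrow> (nat \<Rightarrow> nat) \<Rightarrow> nat \<Rightarrow> (nat \<times> nat) set" where
  "ker_idx p e K \<equiv> Sigma {..<p} (\<lambda>l. {..<K - e l})"

text \<open>The columns of \<open>syl\<close> applied to the basis are the coefficient vectors of
  the shifts \<open>\<lambda>^t b\<^sub>l\<close>; the coefficient bound of \<open>rbasis\<close>
  says that the shifts of degree below \<open>K\<close> suffice.\<close>

lemma rbasis_syl_span:
  assumes rb: "rbasis r n R p b e" and k: "pker r n R (pv K v)"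
  shows "\<exists>w. \<forall>jt\<in>{..<n} \<times> {..<K}. v jt = (\<Sum>lt\<in>ker_idx p e K. syl (\<lambda>j l. b l j) jt lt * w lt)"
proof -
  obtain c where c: "\<forall>j<n. pv K v j = (\<Sum>l<p. b l j * c l)" "\<forall>l<p. dlt (c l) (K - e l)"
    using rb k dlt_pv unfolding rbasis_def by blast
  have "v (j, s) = (\<Sum>lt\<in>ker_idx p e K. syl (\<lambda>j l. b l j) (j, s) lt * (case lt of (l, t) \<Rightarrow> coeff (c l) t))"
    if "j < n" "s < K" for j s
  proof -
    have "v (j, s) = coeff (pv K v j) s" using that by (simp add: coeff_pv)
    also have "\<dots> = (\<Sum>l<p. coeff (b l j * c l) s)" using c that by (simp add: coeff_sum)
    also have "\<dots> = (\<Sum>l<p. \<Sum>t<K - e l. shift_coeff (b l j) t s * coeff (c l) t)"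
      using c(2) by (intro sum.cong refl) (simp add: coeff_mult_dlt)
    also have "\<dots> = (\<Sum>lt\<in>ker_idx p e K. syl (\<lambda>j l. b l j) (j, s) lt * (case lt of (l, t) \<Rightarrow> coeff (c l) t))"
      by (subst sum.Sigma) (auto simp: syl_def intro!: sum.cong)
    finally show ?thesis .
  qed
  then show ?thesis by (intro exI[of _ "\<lambda>(l, t). coeff (c l) t"]) auto
qed

lemma rbasis_syl_inj:
  assumes rb: "rbasis r n R p b e"
  shows "inj_mat ({..<n} \<times> {..<K}) (ker_idx p e K) (syl (\<lambda>j l. b l j))"
  unfolding inj_mat_def
proof (intro allI impI)
  fix w assume w: "\<forall>jt\<in>{..<n} \<times> {..<K}. (\<Sum>lt\<in>ker_idx p e K. syl (\<lambda>j l. b l j) jt lt * w lt) = 0"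
  define c where "c l = pv (K - e l) w l" for l
  have "(\<Sum>l<p. b l j * c l) = 0" if j: "j < n" for j
  proof (rule dlt_eq_0)
    show "dlt (\<Sum>l<p. b l j * c l) K"
    proof (rule dlt_sum)
      fix l assume l: "l \<in> {..<p}"
      show "dlt (b l j * c l) K"
      proof (cases "e l \<le> K")
        case True
        have "dlt (b l j * c l) (K - e l + e l)"
          using rb l j unfolding c_def rbasis_def by (intro dlt_mult dlt_pv) auto
        then show ?thesis using True by simp
      qed (simp add: c_def pv_def dlt_def)
    qed
    fix s assume s: "s < K"
    have "coeff (\<Sum>l<p. b l j * c l) s =
        (\<Sum>l<p. \<Sum>t<K - e l. shift_coeff (b l j) t s * coeff (c l) t)"
      unfolding c_def coeff_sum by (intro sum.cong refl) (simp add: coeff_mult_dlt[OF dlt_pv])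
    also have "\<dots> = (\<Sum>lt\<in>ker_idx p e K. syl (\<lambda>j l. b l j) (j, s) lt * w lt)"
      by (subst sum.Sigma) (auto simp: syl_def c_def coeff_pv intro!: sum.cong)
    finally show "coeff (\<Sum>l<p. b l j * c l) s = 0" using w j s by simp
  qed
  then have "c l = 0" if "l < p" for l
    using inj_matD[of "{..<n}" "{..<p}" "\<lambda>j l. b l j" c l] rb that by (simp add: rbasis_def)
  then show "\<forall>lt\<in>ker_idx p e K. w lt = 0"
    using coeff_pv[of _ w] unfolding c_def by (metis (no_types, lifting) SigmaE coeff_0 lessThan_iff)
qed

lemma rbasis_syl_zero:
  assumes rb: "rbasis r n R p b e" and i: "i < r" and lt: "lt \<in> ker_idx p e K"
  shows "(\<Sum>jt\<in>{..<n} \<times> {..<K}. syl R (i, s) jt * syl (\<lambda>j l. b l j) jt lt) = 0"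
proof -
  obtain l t where l: "lt = (l, t)" "l < p" "t < K - e l" using lt by auto
  define x where "x j = b l j * Polynomial.monom 1 t" for j
  have "dlt (x j) K" if "j < n" for j
  proof -
    have "dlt (Polynomial.monom 1 t) (K - e l)" using l by (simp add: dlt_def)
    then have "dlt (x j) (K - e l + e l)"
      unfolding x_def using rb l that by (intro dlt_mult) (auto simp: rbasis_def)
    then show ?thesis using l by simp
  qed
  then have "(\<Sum>jt\<in>{..<n} \<times> {..<K}. syl R (i, s) jt * (case jt of (j, t) \<Rightarrow> coeff (x j) t)) =
      coeff (\<Sum>j<n. R i j * x j) s" by (rule syl_apply)
  also have "(\<Sum>j<n. R i j * x j) = (\<Sum>j<n. R i j * b l j) * Polynomial.monom 1 t"
    unfolding x_def by (simp add: sum_distrib_right mult.assoc)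
  also have "\<dots> = 0" using rb l i by (simp add: rbasis_def pker_def)
  finally have "(\<Sum>jt\<in>{..<n} \<times> {..<K}. syl R (i, s) jt * (case jt of (j, t) \<Rightarrow> coeff (x j) t)) = 0" by simp
  moreover have "(case jt of (j, t) \<Rightarrow> coeff (x j) t) = syl (\<lambda>j l. b l j) jt lt" for jt
    by (cases jt) (simp add: x_def l syl_def mult.commute[of "b l _"] coeff_monom_mult not_le)
  ultimately show ?thesis by simp
qed

lemma rbasis_stack_inj:
  assumes rb: "rbasis r n R p b e" and deg: "\<And>i j. i < r \<Longrightarrow> j < n \<Longrightarrow> degree (R i j) \<le> dd i"
  shows "inj_mat (rows_idx dd r K <+> ker_idx p e K) ({..<n} \<times> {..<K}) (stack (syl R) (syl (\<lambda>j l. b l j)))"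
proof (rule stack_inj)
  fix v assume "\<And>i. i \<in> rows_idx dd r K \<Longrightarrow> (\<Sum>j\<in>{..<n} \<times> {..<K}. syl R i j * v j) = 0"
  then have "pker r n R (pv K v)" using syl_pker[of r n R dd K v, OF deg] by blast
  then show "\<exists>w. \<forall>j\<in>{..<n} \<times> {..<K}. v j = (\<Sum>h\<in>ker_idx p e K. syl (\<lambda>j l. b l j) j h * w h)"
    by (rule rbasis_syl_span[OF rb])
qed simp

text \<open>The kernel has at least as many dimensions as there are unknowns in excess of
  equations.\<close>

lemma rbasis_dim_ge:
  assumes rb: "rbasis r n R p b e" and deg: "\<And>i j. i < r \<Longrightarrow> j < n \<Longrightarrow> degree (R i j) \<le> dd i"
  shows "n * K \<le> r * K + (\<Sum>i<r. dd i) + (\<Sum>l<p. K - e l)"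
proof -
  have "card ({..<n} \<times> {..<K}) \<le> card (rows_idx dd r K <+> ker_idx p e K)"
    by (rule inj_mat_card[OF _ _ rbasis_stack_inj[OF rb deg]]) auto
  also have "\<dots> = (\<Sum>i<r. K + dd i) + (\<Sum>l<p. K - e l)" by (simp add: card_Plus)
  finally show ?thesis by (simp add: sum.distrib)
qed

text \<open>When the equations are independent, the excess of unknowns is also an upper bound for
  the kernel.\<close>

lemma rbasis_dim_le:
  assumes rb: "rbasis r n R p b e"
    and inj: "syl_surj r n dd K R"
  shows "r * K + (\<Sum>i<r. dd i) + (\<Sum>l<p. K - e l) \<le> n * K"
proof -
  have "card (rows_idx dd r K) + card (ker_idx p e K) \<le> card ({..<n} \<times> {..<K})"
    by (rule complex_card_le[OF _ _ _ inj rbasis_syl_inj[OF rb]]) (auto intro: rbasis_syl_zero[OF rb])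
  then show ?thesis by (simp add: sum.distrib)
qed

text \<open>Both sums are kernel dimensions of Sylvester matrices of one fixed size. Only the basis
  \<open>b\<close> of the limit is stacked, so the bases at \<open>t\<close> may vary without any
  continuity.\<close>

lemma rbasis_semicontinuous:
  fixes Mt :: "'t \<Rightarrow> nat \<Rightarrow> nat \<Rightarrow> complex poly"
  assumes rb: "rbasis m n M p b e" and rbt: "\<And>t. rbasis m n (Mt t) (p' t) (b' t) (e' t)"
    and deg: "\<And>i j. i < m \<Longrightarrow> j < n \<Longrightarrow> degree (M i j) \<le> d"
    and lim: "\<And>i j s. i < m \<Longrightarrow> j < n \<Longrightarrow> ((\<lambda>t. coeff (Mt t i j) s) \<longlongrightarrow> coeff (M i j) s) F"
  shows "\<forall>\<^sub>F t in F. (\<Sum>l<p' t. K - e' t l) \<le> (\<Sum>l<p. K - e l)"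
proof -
  let ?I = "rows_idx (\<lambda>_. d) m K" and ?J = "{..<n} \<times> {..<K}"
  let ?B = "syl (\<lambda>j l. b l j)"
  have inj: "inj_mat (?I <+> ker_idx p e K) ?J (stack (syl M) ?B)"
    by (rule rbasis_stack_inj[OF rb deg])
  have lim': "((\<lambda>t. stack (syl (Mt t)) ?B i j) \<longlongrightarrow> stack (syl M) ?B i j) F"
    if "i \<in> ?I <+> ker_idx p e K" "j \<in> ?J" for i j
    using that lim by (auto simp: stack_def syl_def)
  have "\<forall>\<^sub>F t in F. inj_mat (?I <+> ker_idx p e K) ?J (stack (syl (Mt t)) ?B)"
    by (rule inj_mat_eventually[OF _ _ inj lim']) auto
  then show ?thesis
  proof eventually_elim
    case (elim t)
    have "card (ker_idx (p' t) (e' t) K) \<le> card (ker_idx p e K)"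
      by (rule stack_card_le[OF _ _ _ _ elim rbasis_syl_inj[OF rbt]])
        (auto intro: rbasis_syl_zero[OF rbt])
    then show ?case by simp
  qed
qed

section \<open>Generic rectangular polynomial matrices\<close>

text \<open>The Sylvester matrix for unknowns of degree below \<open>\<alpha>\<close> is injective, so all minimal indices of
  the kernel are at least \<open>\<alpha>\<close>; the next one is surjective, so they are at most \<open>\<alpha> + 1\<close>.\<close>

definition gen_pos :: "nat \<Rightarrow> nat \<Rightarrow> (nat \<Rightarrow> nat) \<Rightarrow> nat \<Rightarrow> (nat \<Rightarrow> nat \<Rightarrow> complex poly) \<Rightarrow> bool" where
  "gen_pos r n d \<alpha> R \<longleftrightarrow> inj_mat (rows_idx d r \<alpha>) ({..<n} \<times> {..<\<alpha>}) (syl R) \<and>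
     syl_surj r n d (Suc \<alpha>) R"

lemma syl_transpose_apply:
  "(\<Sum>is\<in>rows_idx d r K. syl R is (j, t) * u is) =
    (\<Sum>i<r. \<Sum>s<K + d i. shift_coeff (R i j) t s * u (i, s))"
  by (subst sum.Sigma) (auto simp: syl_def intro!: sum.cong)

lemma syl_transpose_inj:
  "syl_surj r n d K R \<longleftrightarrow>
    (\<forall>u. (\<forall>j<n. \<forall>t<K. (\<Sum>i<r. \<Sum>s<K + d i. shift_coeff (R i j) t s * u (i, s)) = 0)
      \<longrightarrow> (\<forall>i<r. \<forall>s<K + d i. u (i, s) = 0))"
proof -
  have "(\<forall>jt\<in>{..<n} \<times> {..<K}. (\<Sum>is\<in>rows_idx d r K. syl R is jt * u is) = 0) \<longleftrightarrow>
    (\<forall>j<n. \<forall>t<K. (\<Sum>i<r. \<Sum>s<K + d i. shift_coeff (R i j) t s * u (i, s)) = 0)" for u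
    unfolding syl_transpose_apply[symmetric] by auto
  moreover have "(\<forall>is\<in>rows_idx d r K. u is = 0) \<longleftrightarrow> (\<forall>i<r. \<forall>s<K + d i. u (i, s) = 0)"
    for u :: "nat \<times> nat \<Rightarrow> complex" by auto
  ultimately show ?thesis unfolding inj_mat_def by simp
qed

lemma syl_transpose_injD:
  assumes inj: "syl_surj r n d K R"
    and u: "\<And>j t. j < n \<Longrightarrow> t < K \<Longrightarrow>
      (\<Sum>i<r. \<Sum>s<K + d i. shift_coeff (R i j) t s * u (i, s)) = 0"
    and "i < r" "s < K + d i"
  shows "u (i, s) = 0"
  using inj[unfolded syl_transpose_inj, rule_format, of u i s] u assms(3,4) by blast

text \<open>A null vector \<open>u\<close> of the larger transposed matrix yields two null vectors
  of the smaller one: drop the last coordinate of each block, or drop the first one and shift. Both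
  vanish, and together they cover all coordinates.\<close>

lemma syl_transpose_inj_Suc:
  assumes deg: "\<And>i j. i < r \<Longrightarrow> j < n \<Longrightarrow> degree (R i j) \<le> d i" and K: "K > 0"
    and inj: "syl_surj r n d K R"
  shows "syl_surj r n d (Suc K) R"
  unfolding syl_transpose_inj
proof (intro allI impI)
  let ?c = "\<lambda>i j t s. shift_coeff (R i j) t s"
  fix u i0 s0
  assume u: "\<forall>j<n. \<forall>t<Suc K. (\<Sum>i<r. \<Sum>s<Suc K + d i. ?c i j t s * u (i, s)) = 0"
    and i0: "i0 < r" and s0: "s0 < Suc K + d i0"
  have "(\<Sum>i<r. \<Sum>s<K + d i. ?c i j t s * u (i, s)) = 0" if j: "j < n" and t: "t < K" for j t
  proof -
    \<comment> \<open>For \<open>t < K\<close> the last coordinate meets a coefficient beyond the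
      degree bound.\<close>
    have E: "(\<Sum>s<Suc K + d i. ?c i j t s * u (i, s)) = (\<Sum>s<K + d i. ?c i j t s * u (i, s))"
      if "i < r" for i
    proof -
      have "coeff (R i j) (K + d i - t) = 0" using deg[OF that j] t by (intro coeff_eq_0) linarith
      then show ?thesis by simp
    qed
    have "(\<Sum>i<r. \<Sum>s<K + d i. ?c i j t s * u (i, s)) = (\<Sum>i<r. \<Sum>s<Suc K + d i. ?c i j t s * u (i, s))"
      by (rule sum.cong[OF refl], rule E[symmetric]) simp
    also have "\<dots> = 0" using u j t by (simp del: sum.lessThan_Suc)
    finally show ?thesis .
  qed
  then have u1: "u (i, s) = 0" if "i < r" "s < K + d i" for i s
    by (rule syl_transpose_injD[OF inj, of u, OF _ that])
  define u' where "u' = (\<lambda>(i :: nat, s). u (i, Suc s))"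
  have "(\<Sum>i<r. \<Sum>s<K + d i. ?c i j t s * u' (i, s)) = 0" if j: "j < n" and t: "t < K" for j t
  proof -
    have "(\<Sum>s<Suc K + d i. ?c i j (Suc t) s * u (i, s)) = (\<Sum>s<K + d i. ?c i j t s * u' (i, s))" for i
      unfolding add_Suc sum.lessThan_Suc_shift by (simp add: u'_def cong: if_cong)
    then have "(\<Sum>i<r. \<Sum>s<K + d i. ?c i j t s * u' (i, s)) =
        (\<Sum>i<r. \<Sum>s<Suc K + d i. ?c i j (Suc t) s * u (i, s))" by (simp only:)
    also have "\<dots> = 0" using u[rule_format, OF j, of "Suc t"] t by (simp del: sum.lessThan_Suc)
    finally show ?thesis .
  qed
  then have u2: "u' (i, s) = 0" if "i < r" "s < K + d i" for i s
    by (rule syl_transpose_injD[OF inj, of u', OF _ that])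
  show "u (i0, s0) = 0"
  proof (cases s0)
    case 0
    then show ?thesis using u1[of i0 0] i0 K by simp
  next
    case (Suc s)
    then show ?thesis using u2[of i0 s] i0 s0 by (simp add: u'_def)
  qed
qed

lemma gen_pos_transpose_inj:
  assumes deg: "\<And>i j. i < r \<Longrightarrow> j < n \<Longrightarrow> degree (R i j) \<le> d i" and gen: "gen_pos r n d \<alpha> R"
    and K: "K > \<alpha>"
  shows "syl_surj r n d K R"
proof -
  have "Suc \<alpha> \<le> K" using K by simp
  then show ?thesis
  proof (induction K rule: dec_induct)
    case base
    then show ?case using gen by (simp add: gen_pos_def)
  next
    case (step K)
    show ?case by (rule syl_transpose_inj_Suc[OF deg _ step.IH]) (use step in auto)
  qed
qed

lemma gen_pos_eval_inj:
  assumes deg: "\<And>i j. i < r \<Longrightarrow> j < n \<Longrightarrow> degree (R i j) \<le> d i" and gen: "gen_pos r n d \<alpha> R"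
  shows "inj_mat {..<n} {..<r} (\<lambda>j i. poly (R i j) z)"
  unfolding inj_mat_def
proof (intro allI impI)
  fix y assume y: "\<forall>j\<in>{..<n}. (\<Sum>i<r. poly (R i j) z * y i) = 0"
  \<comment> \<open>The geometric continuation of \<open>y\<close>: equation \<open>(j, t)\<close>
    becomes \<open>z ^ t\<close> times the \<open>j\<close>-th equation for
    \<open>y\<close>.\<close>
  define u where "u = (\<lambda>(i :: nat, s). y i * z ^ s)"
  have "(\<Sum>i<r. \<Sum>s<Suc \<alpha> + d i. shift_coeff (R i j) t s * u (i, s)) = 0"
    if j: "j < n" and t: "t < Suc \<alpha>" for j t
  proof -
    have "(\<Sum>s<Suc \<alpha> + d i. shift_coeff (R i j) t s * u (i, s)) =
        z ^ t * (poly (R i j) z * y i)" if i: "i < r" for i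
    proof -
      have "(\<Sum>s<Suc \<alpha> + d i. shift_coeff (R i j) t s * u (i, s)) =
          (\<Sum>s\<in>{t..<Suc \<alpha> + d i}. coeff (R i j) (s - t) * (y i * z ^ s))"
        by (rule sum.mono_neutral_cong_right) (auto simp: u_def)
      also have "\<dots> = (\<Sum>s\<in>{0..<Suc \<alpha> + d i - t}. coeff (R i j) s * (y i * z ^ (s + t)))"
        by (rule sum.reindex_bij_witness[of _ "\<lambda>s. s + t" "\<lambda>s. s - t"]) auto
      also have "\<dots> = z ^ t * y i * (\<Sum>s\<in>{0..<Suc \<alpha> + d i - t}. coeff (R i j) s * z ^ s)"
        by (simp add: sum_distrib_left power_add ac_simps)
      also have "(\<Sum>s\<in>{0..<Suc \<alpha> + d i - t}. coeff (R i j) s * z ^ s) = poly (R i j) z"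
        unfolding poly_altdef using deg[OF i j] t
        by (intro sum.mono_neutral_right) (auto intro!: coeff_eq_0)
      finally show ?thesis by (simp add: ac_simps)
    qed
    then have "(\<Sum>i<r. \<Sum>s<Suc \<alpha> + d i. shift_coeff (R i j) t s * u (i, s)) =
        z ^ t * (\<Sum>i<r. poly (R i j) z * y i)"
      unfolding sum_distrib_left by (intro sum.cong) auto
    then show ?thesis using y j by simp
  qed
  then have "u (i, 0) = 0" if "i < r" for i
    by (rule syl_transpose_injD[OF gen[unfolded gen_pos_def, THEN conjunct2], where u = u]) (use that in auto)
  then show "\<forall>i\<in>{..<r}. y i = 0" by (simp add: u_def)
qed

lemma gen_pos_lead_inj:
  assumes deg: "\<And>i j. i < r \<Longrightarrow> j < n \<Longrightarrow> degree (R i j) \<le> d i" and gen: "gen_pos r n d \<alpha> R"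
  shows "inj_mat {..<n} {..<r} (\<lambda>j i. coeff (R i j) (d i))"
  unfolding inj_mat_def
proof (intro allI impI)
  fix y assume y: "\<forall>j\<in>{..<n}. (\<Sum>i<r. coeff (R i j) (d i) * y i) = 0"
  \<comment> \<open>Supported on the last coordinate of each block. Equation
    \<open>(j, \<alpha>)\<close> is the equation for the leading coefficients; for smaller
    \<open>t\<close> the coefficients are beyond the degree bound.\<close>
  define u where "u = (\<lambda>(i :: nat, s). if s = \<alpha> + d i then y i else 0)"
  have "(\<Sum>i<r. \<Sum>s<Suc \<alpha> + d i. shift_coeff (R i j) t s * u (i, s)) = 0"
    if j: "j < n" and t: "t < Suc \<alpha>" for j t
  proof -
    have "(\<Sum>s<Suc \<alpha> + d i. shift_coeff (R i j) t s * u (i, s)) =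
        coeff (R i j) (\<alpha> + d i - t) * y i" for i
    proof -
      have "(\<Sum>s<Suc \<alpha> + d i. shift_coeff (R i j) t s * u (i, s)) =
          (\<Sum>s\<in>{\<alpha> + d i}. shift_coeff (R i j) t s * u (i, s))"
        by (rule sum.mono_neutral_right) (auto simp: u_def)
      then show ?thesis using t by (simp add: u_def)
    qed
    then have *: "(\<Sum>i<r. \<Sum>s<Suc \<alpha> + d i. shift_coeff (R i j) t s * u (i, s)) =
        (\<Sum>i<r. coeff (R i j) (\<alpha> + d i - t) * y i)" by simp
    show ?thesis
    proof (cases "t = \<alpha>")
      case True
      then show ?thesis using y j unfolding * by simp
    next
      case False
      have "coeff (R i j) (\<alpha> + d i - t) = 0" if "i < r" for i
        using deg[OF that j] t False by (intro coeff_eq_0) linarith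
      then show ?thesis unfolding * by simp
    qed
  qed
  then have "u (i, \<alpha> + d i) = 0" if "i < r" for i
    by (rule syl_transpose_injD[OF gen[unfolded gen_pos_def, THEN conjunct2], where u = u]) (use that in auto)
  then show "\<forall>i\<in>{..<r}. y i = 0" by (simp add: u_def)
qed

text \<open>Both conditions concern matrices that are linear in \<open>R\<close>, so each of them
  fails for finitely many \<open>t\<close> only.\<close>

lemma gen_pos_perturb:
  assumes "gen_pos r n d \<alpha> R0"
  shows "finite {t. \<not> gen_pos r n d \<alpha> (\<lambda>i j. R i j + [:t:] * R0 i j)}"
proof -
  have syl: "syl (\<lambda>i j. R i j + [:t:] * R0 i j) = (\<lambda>is jt. syl R is jt + t * syl R0 is jt)" for t
    by (auto simp: syl_def fun_eq_iff)
  have "finite {t. \<not> inj_mat (rows_idx d r \<alpha>) ({..<n} \<times> {..<\<alpha>}) (\<lambda>is jt. syl R is jt + t * syl R0 is jt)}"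
    by (rule inj_mat_perturb') (use assms in \<open>auto simp: gen_pos_def\<close>)
  moreover have "finite {t. \<not> inj_mat ({..<n} \<times> {..<Suc \<alpha>}) (rows_idx d r (Suc \<alpha>))
      (\<lambda>jt is. syl R is jt + t * syl R0 is jt)}"
    by (rule inj_mat_perturb') (use assms in \<open>auto simp: gen_pos_def\<close>)
  ultimately show ?thesis
    unfolding gen_pos_def syl de_Morgan_conj Collect_disj_eq by simp
qed

lemma mset_two_values:
  fixes xs :: "nat list"
  assumes "set xs \<subseteq> {\<alpha>, Suc \<alpha>}" "sum_list xs = length xs * \<alpha> + s"
  shows "mset xs = replicate_mset (length xs - s) \<alpha> + replicate_mset s (Suc \<alpha>)"
proof -
  have "\<exists>u v. mset xs = replicate_mset u \<alpha> + replicate_mset v (Suc \<alpha>) \<and> length xs = u + v \<and>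
      sum_list xs = u * \<alpha> + v * Suc \<alpha>"
    using assms(1)
  proof (induction xs)
    case (Cons x xs)
    then obtain u v where IH: "mset xs = replicate_mset u \<alpha> + replicate_mset v (Suc \<alpha>)"
      "length xs = u + v" "sum_list xs = u * \<alpha> + v * Suc \<alpha>" by auto
    show ?case
    proof (cases "x = \<alpha>")
      case True
      then show ?thesis using IH by (intro exI[of _ "Suc u"] exI[of _ v]) simp
    next
      case False
      then have "x = Suc \<alpha>" using Cons.prems by auto
      then show ?thesis using IH by (intro exI[of _ u] exI[of _ "Suc v"]) simp
    qed
  qed simp
  then obtain u v where uv: "mset xs = replicate_mset u \<alpha> + replicate_mset v (Suc \<alpha>)"
    "length xs = u + v" "sum_list xs = u * \<alpha> + v * Suc \<alpha>" by blast
  then have "v = s" using assms(2) by (simp add: algebra_simps)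
  then show ?thesis using uv by simp
qed

lemma sum_diff_large:
  fixes e :: "nat \<Rightarrow> nat"
  assumes "\<And>l. l < p \<Longrightarrow> e l \<le> K"
  shows "(\<Sum>l<p. K - e l) + (\<Sum>l<p. e l) = p * K"
  using assms by (simp add: sum.distrib[symmetric])

text \<open>For every \<open>K > \<alpha>\<close> the kernel dimension is exactly the excess of
  unknowns over equations. Two large values of \<open>K\<close> give the number and the sum of the
  indices; the sizes \<open>\<alpha>\<close> and \<open>\<alpha> + 1\<close> confine each index to
  two values, and then the sum fixes how often each occurs.\<close>

lemma gen_pos_indices:
  assumes rb: "rbasis r n R p b e" and deg: "\<And>i j. i < r \<Longrightarrow> j < n \<Longrightarrow> degree (R i j) \<le> d i"
    and rn: "r < n" and a: "a = (\<Sum>i<r. d i)" and \<alpha>: "\<alpha> = a div (n - r)"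
    and gen: "gen_pos r n d \<alpha> R"
  shows "p = n - r"
    and "rev (sort (map e [0..<p])) =
      replicate (a mod (n - r)) (\<alpha> + 1) @ replicate (n - r - a mod (n - r)) \<alpha>"
proof -
  have eq: "n * K = r * K + a + (\<Sum>l<p. K - e l)" if "K > \<alpha>" for K
    using rbasis_dim_ge[OF rb deg, of K] rbasis_dim_le[OF rb gen_pos_transpose_inj[OF deg gen that]]
    unfolding a by linarith
  \<comment> \<open>Large enough that no difference \<open>K - e l\<close> is truncated.\<close>
  define K where "K = Suc (\<alpha> + (\<Sum>l<p. e l))"
  have eK: "e l \<le> K" if "l < p" for l
    using member_le_sum[of l "{..<p}" e] that by (simp add: K_def)
  have e1: "n * K + (\<Sum>l<p. e l) = r * K + a + p * K"
    using eq[of K] sum_diff_large[of p e K] eK by (simp add: K_def)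
  have e2: "n * Suc K + (\<Sum>l<p. e l) = r * Suc K + a + p * Suc K"
    using eq[of "Suc K"] sum_diff_large[of p e "Suc K"] eK by (simp add: K_def le_SucI)
  have "n = r + p" using e1 e2 by simp
  then show p: "p = n - r" by simp
  have sum: "(\<Sum>l<p. e l) = a" using e1 \<open>n = r + p\<close> by (simp add: algebra_simps)
  \<comment> \<open>An index below \<open>\<alpha>\<close> would be a null vector of the injective
    Sylvester matrix of size \<open>\<alpha>\<close>.\<close>
  have ge: "\<alpha> \<le> e l" if l: "l < p" for l
  proof (rule ccontr)
    assume "\<not> ?thesis"
    then have less: "e l < \<alpha>" by simp
    have dl: "dlt (b l j) \<alpha>" if "j < n" for j
    proof -
      have "degree (b l j) \<le> e l" using rb l that by (simp add: rbasis_def)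
      then show ?thesis using less unfolding dlt_def by (auto intro!: coeff_eq_0)
    qed
    have "(\<lambda>(j, t). coeff (b l j) t) jt = 0" if "jt \<in> {..<n} \<times> {..<\<alpha>}" for jt
    proof (rule inj_matD[of "rows_idx d r \<alpha>" "{..<n} \<times> {..<\<alpha>}" "syl R"])
      fix i' assume "i' \<in> rows_idx d r \<alpha>"
      then obtain i s where i: "i' = (i, s)" "i < r" by auto
      have "(\<Sum>j<n. R i j * b l j) = 0" using rb l i by (simp add: rbasis_def pker_def)
      then show "(\<Sum>jt\<in>{..<n} \<times> {..<\<alpha>}. syl R i' jt * (case jt of (j, t) \<Rightarrow> coeff (b l j) t)) = 0"
        unfolding i(1) by (subst syl_apply) (use dl in auto)
    qed (use gen that in \<open>auto simp: gen_pos_def\<close>)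
    then have b0: "b l j = 0" if "j < n" for j using dlt_eq_0[OF dl[OF that]] that by auto
    have "(if l = l then 1 else 0 :: complex poly) = 0"
    proof (rule inj_matD[of "{..<n}" "{..<p}" "\<lambda>j l. b l j" "\<lambda>l'. if l' = l then 1 else 0"])
      fix j assume "j \<in> {..<n}"
      then show "(\<Sum>l'<p. b l' j * (if l' = l then 1 else 0)) = 0"
        using b0 by (intro sum.neutral) auto
    qed (use rb l in \<open>auto simp: rbasis_def\<close>)
    then show False by simp
  qed
  have np: "n - r > 0" using rn by simp
  have am: "a = p * \<alpha> + a mod (n - r)" unfolding p \<alpha> by (simp add: mult.commute)
  \<comment> \<open>At size \<open>\<alpha> + 1\<close> an index beyond \<open>\<alpha> + 1\<close>
    would have its difference truncated to zero, and the kernel would be larger than the exact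
    formula permits.\<close>
  have le: "e l \<le> Suc \<alpha>" if l: "l < p" for l
  proof (rule ccontr)
    assume "\<not> ?thesis"
    then have gt: "e l > Suc \<alpha>" by simp
    have S: "(\<Sum>l<p. Suc \<alpha> - e l) + a = p * Suc \<alpha>"
      using eq[of "Suc \<alpha>"] \<open>n = r + p\<close> by (simp add: algebra_simps)
    have "p * Suc \<alpha> = (\<Sum>l'<p. Suc \<alpha>)" by simp
    also have "\<dots> < (\<Sum>l'<p. (Suc \<alpha> - e l') + e l')"
      by (rule sum_strict_mono_ex1) (use gt l in \<open>auto intro!: bexI[of _ l]\<close>)
    also have "\<dots> = p * Suc \<alpha>" using S sum by (simp add: sum.distrib)
    finally show False by simp
  qed
  have "set (map e [0..<p]) \<subseteq> {\<alpha>, Suc \<alpha>}" using ge le by (force simp: le_Suc_eq)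
  moreover have "sum_list (map e [0..<p]) = length (map e [0..<p]) * \<alpha> + a mod (n - r)"
    using sum am by (simp add: interv_sum_list_conv_sum_set_nat lessThan_atLeast0)
  ultimately have ms: "mset (map e [0..<p]) =
      replicate_mset (n - r - a mod (n - r)) \<alpha> + replicate_mset (a mod (n - r)) (Suc \<alpha>)"
    using mset_two_values[of "map e [0..<p]" \<alpha>] p by simp
  have "sort (map e [0..<p]) = replicate (n - r - a mod (n - r)) \<alpha> @ replicate (a mod (n - r)) (Suc \<alpha>)"
    by (rule properties_for_sort) (use ms in \<open>auto simp: sorted_append\<close>)
  then show "rev (sort (map e [0..<p])) =
      replicate (a mod (n - r)) (\<alpha> + 1) @ replicate (n - r - a mod (n - r)) \<alpha>" by simp
qed

text \<open>Locates a position \<open>\<tau>\<close> of the glued block: it is position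
  \<open>c\<close> in the block \<open>i\<close>.\<close>

lemma partial_sum_decomp:
  fixes d :: "nat \<Rightarrow> nat"
  assumes "\<tau> \<le> (\<Sum>i<Suc r. d i)"
  shows "\<exists>i c. i < Suc r \<and> c \<le> d i \<and> (\<Sum>i'<i. d i') + c = \<tau>"
  using assms
proof (induction r)
  case (Suc r)
  show ?case
  proof (cases "\<tau> \<le> (\<Sum>i<Suc r. d i)")
    case True
    then show ?thesis using Suc.IH by (meson less_SucI)
  next
    case False
    then show ?thesis using Suc.prems
      by (intro exI[of _ "Suc r"] exI[of _ "\<tau> - (\<Sum>i<Suc r. d i)"]) auto
  qed
qed auto

text \<open>Windows of length \<open>K\<close> starting at the points \<open>\<tau> k\<close> leave
  no gaps if consecutive starting points are at most \<open>K\<close> apart.\<close>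

lemma ex_between:
  fixes \<tau> :: "nat \<Rightarrow> nat"
  assumes "\<tau> 0 = 0" "\<And>k. \<tau> (Suc k) \<le> \<tau> k + K" "\<phi> < \<tau> q + K"
  shows "\<exists>k\<le>q. \<tau> k \<le> \<phi> \<and> \<phi> < \<tau> k + K"
  using assms(3)
proof (induction q)
  case (Suc q)
  show ?case
  proof (cases "\<tau> (Suc q) \<le> \<phi>")
    case False
    then have "\<phi> < \<tau> q + K" using assms(2)[of q] by simp
    then show ?thesis using Suc.IH by (meson le_SucI)
  qed (use Suc in auto)
qed (use assms(1) in auto)

lemma sum_lessThan_add:
  fixes f :: "nat \<Rightarrow> 'a::comm_monoid_add"
  shows "(\<Sum>j<m + k. f j) = (\<Sum>j<m. f j) + (\<Sum>i<k. f (m + i))"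
  by (induction k) (simp_all add: add.assoc)

lemma sum_syl_monom:
  fixes u :: "nat \<Rightarrow> complex"
  assumes "t + e < N"
  shows "(\<Sum>s<N. shift_coeff (Polynomial.monom 1 e) t s * u s) = u (e + t)"
proof -
  have "(\<Sum>s<N. shift_coeff (Polynomial.monom 1 e) t s * u s) = (\<Sum>s<N. if s = e + t then u s else 0)"
    by (intro sum.cong) auto
  also have "\<dots> = u (e + t)" using assms by (simp add: sum.delta)
  finally show ?thesis .
qed

text \<open>A matrix in general position, in the style of a zigzag matrix: the first \<open>r0\<close> columns are
  \<open>\<lambda>^(d j) e\<^sub>j - e\<^bsub>j+1\<^esub>\<close>, which glue the blocks of lengths \<open>d i\<close> to one block of length \<open>a\<close>, and the
  others are monomials that sit at the positions \<open>\<tau> k\<close> of the glued block. The gaps between these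
  positions become the minimal indices.\<close>

locale zigzag =
  fixes r0 q \<alpha> a :: nat and d \<tau> \<iota> c :: "nat \<Rightarrow> nat"
  assumes a: "a = (\<Sum>i<Suc r0. d i)"
    and \<tau>0: "\<tau> 0 = 0" and \<tau>q: "\<tau> q = a"
    and \<tau>lo: "\<And>k. \<tau> k + \<alpha> \<le> \<tau> (Suc k)" and \<tau>hi: "\<And>k. \<tau> (Suc k) \<le> \<tau> k + Suc \<alpha>"
    and \<iota>: "\<And>k. k \<le> q \<Longrightarrow> \<iota> k < Suc r0" and c: "\<And>k. k \<le> q \<Longrightarrow> c k \<le> d (\<iota> k)"
    and pos: "\<And>k. k \<le> q \<Longrightarrow> (\<Sum>i<\<iota> k. d i) + c k = \<tau> k"
begin

text \<open>The start of block \<open>i\<close> within the glued block.\<close>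

definition off where "off i = (\<Sum>i'<i. d i')"

definition ex where
  "ex i j = (if j < r0 then (if i = j then Polynomial.monom 1 (d j) else if i = Suc j then - 1 else 0)
     else if i = \<iota> (j - r0) then Polynomial.monom 1 (c (j - r0)) else (0 :: complex poly))"

lemma ex_degree:
  assumes "i < Suc r0" "j < r0 + Suc q"
  shows "degree (ex i j) \<le> d i"
proof -
  have "degree (Polynomial.monom (1 :: complex) (c (j - r0))) \<le> d (\<iota> (j - r0))" if "\<not> j < r0"
    using c[of "j - r0"] that assms by (simp add: degree_monom_eq)
  then show ?thesis by (auto simp: ex_def degree_monom_le)
qed

lemma \<tau>_gap: "k < k' \<Longrightarrow> \<tau> k + \<alpha> \<le> \<tau> k'"
proof (induction k' rule: less_induct)
  case (less k')
  then obtain k'' where k'': "k' = Suc k''" by (cases k') auto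
  show ?case
  proof (cases "k = k''")
    case False
    then have "\<tau> k + \<alpha> \<le> \<tau> k''" using less k'' by auto
    then show ?thesis using \<tau>lo[of k''] k'' by simp
  qed (use \<tau>lo k'' in simp)
qed

lemma ex_row:
  assumes i: "i < Suc r0"
  shows "(\<Sum>j<r0 + Suc q. ex i j * x j) =
    (if i < r0 then Polynomial.monom 1 (d i) * x i else 0) - (if i > 0 then x (i - 1) else 0) +
    (\<Sum>k<Suc q. if \<iota> k = i then Polynomial.monom 1 (c k) * x (r0 + k) else 0)"
proof -
  have "(\<Sum>j<r0. ex i j * x j) =
      (\<Sum>j<r0. (if j = i then Polynomial.monom 1 (d i) * x i else 0) - (if i > 0 \<and> j = i - 1 then x (i - 1) else 0))"
    by (intro sum.cong) (auto simp: ex_def)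
  also have "\<dots> = (if i < r0 then Polynomial.monom 1 (d i) * x i else 0) - (if i > 0 then x (i - 1) else 0)"
    using i by (cases i) (simp_all add: sum_subtractf sum.delta)
  finally have 1: "(\<Sum>j<r0. ex i j * x j) = \<dots>" .
  have 2: "(\<Sum>k<Suc q. ex i (r0 + k) * x (r0 + k)) =
      (\<Sum>k<Suc q. if \<iota> k = i then Polynomial.monom 1 (c k) * x (r0 + k) else 0)"
    by (intro sum.cong) (auto simp: ex_def)
  show ?thesis unfolding sum_lessThan_add 1 2 ..
qed

text \<open>Multiplying equation \<open>i\<close> by \<open>\<lambda>^(off i)\<close> and adding all
  of them makes the glueing columns telescope away; the monomials
  \<open>\<lambda>^(\<tau> k)\<close> times the other unknowns remain. As consecutive
  \<open>\<tau> k\<close> differ by at least \<open>\<alpha>\<close> and the unknowns have degree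
  below \<open>\<alpha>\<close>, the supports are disjoint and these unknowns vanish. The glueing
  unknowns then vanish one after the other.\<close>

lemma ex_inj: "inj_mat (rows_idx d (Suc r0) \<alpha>) ({..<r0 + Suc q} \<times> {..<\<alpha>}) (syl ex)"
  unfolding inj_mat_def
proof (intro allI impI)
  fix v assume "\<forall>i\<in>rows_idx d (Suc r0) \<alpha>. (\<Sum>j\<in>{..<r0 + Suc q} \<times> {..<\<alpha>}. syl ex i j * v j) = 0"
  then have ker: "pker (Suc r0) (r0 + Suc q) ex (pv \<alpha> v)"
    using syl_pker[of "Suc r0" "r0 + Suc q" ex d \<alpha> v, OF ex_degree] by blast
  define x where "x = pv \<alpha> v"
  have row: "(if i < r0 then Polynomial.monom 1 (d i) * x i else 0) - (if i > 0 then x (i - 1) else 0) +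
    (\<Sum>k<Suc q. if \<iota> k = i then Polynomial.monom 1 (c k) * x (r0 + k) else 0) = 0" if "i < Suc r0" for i
    using ker that unfolding pker_def x_def ex_row[OF that, symmetric] by blast
  define A where "A i = (if i < r0 then Polynomial.monom 1 (off (Suc i)) * x i else 0)" for i
  define B where "B i = (if i > 0 then Polynomial.monom 1 (off i) * x (i - 1) else 0)" for i
  define C where "C i = (\<Sum>k<Suc q. if \<iota> k = i then Polynomial.monom 1 (off i + c k) * x (r0 + k) else 0)" for i
  have "A i - B i + C i = 0" if i: "i < Suc r0" for i
  proof -
    have "A i - B i + C i = Polynomial.monom 1 (off i) *
      ((if i < r0 then Polynomial.monom 1 (d i) * x i else 0) - (if i > 0 then x (i - 1) else 0) +
      (\<Sum>k<Suc q. if \<iota> k = i then Polynomial.monom 1 (c k) * x (r0 + k) else 0))"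
      unfolding A_def B_def C_def distrib_left right_diff_distrib sum_distrib_left
      by (intro arg_cong2[where f = "(+)"] arg_cong2[where f = "(-)"] sum.cong refl)
        (auto simp: off_def mult_monom simp flip: mult.assoc)
    then show ?thesis using row[OF i] by simp
  qed
  then have "(\<Sum>i<Suc r0. A i - B i + C i) = 0" by (intro sum.neutral) auto
  moreover have "(\<Sum>i<Suc r0. A i) = (\<Sum>i<Suc r0. B i)"
  proof -
    have "(\<Sum>i<Suc r0. B i) = (\<Sum>i<r0. B (Suc i))"
      unfolding sum.lessThan_Suc_shift by (simp add: B_def)
    also have "\<dots> = (\<Sum>i<r0. A i)" by (intro sum.cong) (auto simp: A_def B_def)
    finally show ?thesis by (simp add: A_def)
  qed
  ultimately have "(\<Sum>i<Suc r0. C i) = 0" by (simp add: sum.distrib sum_subtractf del: sum.lessThan_Suc)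
  moreover have "(\<Sum>i<Suc r0. C i) = (\<Sum>k<Suc q. Polynomial.monom 1 (\<tau> k) * x (r0 + k))"
  proof -
    have "(\<Sum>i<Suc r0. C i) = (\<Sum>k<Suc q. \<Sum>i<Suc r0. if \<iota> k = i then Polynomial.monom 1 (off i + c k) * x (r0 + k) else 0)"
      unfolding C_def by (rule sum.swap)
    also have "\<dots> = (\<Sum>k<Suc q. Polynomial.monom 1 (\<tau> k) * x (r0 + k))"
    proof (intro sum.cong refl)
      fix k assume "k \<in> {..<Suc q}"
      then have k: "k \<le> q" by simp
      show "(\<Sum>i<Suc r0. if \<iota> k = i then Polynomial.monom 1 (off i + c k) * x (r0 + k) else 0) =
          Polynomial.monom 1 (\<tau> k) * x (r0 + k)"
        using \<iota>[OF k] pos[OF k] by (subst sum.delta') (auto simp: off_def)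
    qed
    finally show ?thesis .
  qed
  ultimately have S: "(\<Sum>k<Suc q. Polynomial.monom 1 (\<tau> k) * x (r0 + k)) = 0" by simp
  have y: "x (r0 + k) = 0" if k: "k \<le> q" for k
  proof (rule dlt_eq_0)
    show "dlt (x (r0 + k)) \<alpha>" unfolding x_def by (rule dlt_pv)
    fix t assume t: "t < \<alpha>"
    have "coeff (Polynomial.monom 1 (\<tau> k') * x (r0 + k')) (\<tau> k + t) = 0" if "k' \<noteq> k" for k'
    proof (cases "k' < k")
      case True
      then show ?thesis using \<tau>_gap[OF True] by (simp add: coeff_monom_mult x_def coeff_pv)
    next
      case False
      then have "\<tau> k + t < \<tau> k'" using \<tau>_gap[of k k'] that t by simp
      then show ?thesis by (simp add: coeff_monom_mult)
    qed
    then have "(\<Sum>k'\<in>{..<Suc q} - {k}. coeff (Polynomial.monom 1 (\<tau> k') * x (r0 + k')) (\<tau> k + t)) = 0"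
      by (intro sum.neutral) auto
    then have "coeff (\<Sum>k<Suc q. Polynomial.monom 1 (\<tau> k) * x (r0 + k)) (\<tau> k + t) = coeff (x (r0 + k)) t"
      unfolding coeff_sum using k by (subst sum.remove[of _ k]) (auto simp: coeff_monom_mult)
    then show "coeff (x (r0 + k)) t = 0" unfolding S by simp
  qed
  have g: "x i = 0" if "i < r0" for i
    using that
  proof (induction i rule: less_induct)
    case (less i)
    have "(\<Sum>k<Suc q. if \<iota> k = i then Polynomial.monom 1 (c k) * x (r0 + k) else 0) = 0"
      using y by (intro sum.neutral) auto
    moreover have "(if i > 0 then x (i - 1) else 0) = 0" using less by auto
    ultimately have "Polynomial.monom 1 (d i) * x i = 0" using row[of i] less.prems by simp
    then show ?case by simp
  qed
  have x0: "x j = 0" if "j < r0 + Suc q" for j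
    using g[of j] y[of "j - r0"] that by (cases "j < r0") auto
  show "\<forall>jt\<in>{..<r0 + Suc q} \<times> {..<\<alpha>}. v jt = 0"
  proof
    fix jt assume "jt \<in> {..<r0 + Suc q} \<times> {..<\<alpha>}"
    then obtain j t where jt: "jt = (j, t)" "j < r0 + Suc q" "t < \<alpha>" by auto
    then have "v jt = coeff (x j) t" by (simp add: x_def coeff_pv)
    then show "v jt = 0" using x0[OF jt(2)] by simp
  qed
qed

text \<open>The glueing columns make \<open>u\<close> depend only on the position
  \<open>off i + s\<close> in the glued block. The monomial columns make it vanish on the windows of
  length \<open>\<alpha> + 1\<close> starting at the points \<open>\<tau> k\<close>, and these cover
  everything because consecutive \<open>\<tau> k\<close> differ by at most
  \<open>\<alpha> + 1\<close>.\<close>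

lemma ex_transpose_inj:
  "inj_mat ({..<r0 + Suc q} \<times> {..<Suc \<alpha>}) (rows_idx d (Suc r0) (Suc \<alpha>)) (\<lambda>jt is. syl ex is jt)"
  unfolding syl_transpose_inj
proof (intro allI impI)
  let ?K = "Suc \<alpha>"
  let ?c = "\<lambda>i j t s. shift_coeff (ex i j) t s"
  fix u :: "nat \<times> nat \<Rightarrow> complex" and i0 s0
  assume u: "\<forall>j<r0 + Suc q. \<forall>t<?K. (\<Sum>i<Suc r0. \<Sum>s<?K + d i. ?c i j t s * u (i, s)) = 0"
    and i0: "i0 < Suc r0" and s0: "s0 < ?K + d i0"
  have ug: "u (j, d j + t) = u (Suc j, t)" if j: "j < r0" and t: "t < ?K" for j t
  proof -
    have *: "(\<Sum>s<?K + d i. ?c i j t s * u (i, s)) =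
        (if i = j then u (j, d j + t) else 0) - (if i = Suc j then u (Suc j, t) else 0)" for i
    proof -
      consider "i = j" | "i = Suc j" | "i \<noteq> j" "i \<noteq> Suc j" by blast
      then show ?thesis
      proof cases
        case 1
        then have ex: "ex i j = Polynomial.monom 1 (d j)" using j by (simp add: ex_def)
        show ?thesis unfolding ex using sum_syl_monom[of t "d j" "?K + d i" "\<lambda>s. u (i, s)"] t 1
          by (simp del: sum.lessThan_Suc add_Suc)
      next
        case 2
        then have ex: "ex i j = - Polynomial.monom 1 0" using j by (simp add: ex_def monom_eq_1)
        have "(\<Sum>s<?K + d i. ?c i j t s * u (i, s)) =
            - (\<Sum>s<?K + d i. (if t \<le> s then coeff (Polynomial.monom 1 0) (s - t) else 0) * u (i, s))"
          unfolding sum_negf[symmetric] ex by (intro sum.cong) auto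
        then show ?thesis using sum_syl_monom[of t 0 "?K + d i" "\<lambda>s. u (i, s)"] t 2
          by (simp del: sum.lessThan_Suc add_Suc)
      next
        case 3
        then have ex: "ex i j = 0" using j by (simp add: ex_def)
        have "(\<Sum>s<?K + d i. ?c i j t s * u (i, s)) = 0"
          unfolding ex by (intro sum.neutral) auto
        then show ?thesis using 3 by simp
      qed
    qed
    have "(\<Sum>i<Suc r0. \<Sum>s<?K + d i. ?c i j t s * u (i, s)) = u (j, d j + t) - u (Suc j, t)"
      unfolding * using j by (simp add: sum_subtractf sum.delta del: sum.lessThan_Suc)
    then show ?thesis using u j t by simp
  qed
  have uh: "u (\<iota> k, c k + t) = 0" if k: "k \<le> q" and t: "t < ?K" for k t
  proof -
    have *: "(\<Sum>s<?K + d i. ?c i (r0 + k) t s * u (i, s)) = (if i = \<iota> k then u (\<iota> k, c k + t) else 0)" for i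
    proof (cases "i = \<iota> k")
      case True
      then have ex: "ex i (r0 + k) = Polynomial.monom 1 (c k)" by (simp add: ex_def)
      show ?thesis unfolding ex using sum_syl_monom[of t "c k" "?K + d i" "\<lambda>s. u (i, s)"] t c[OF k] True
        by (simp del: sum.lessThan_Suc add_Suc)
    next
      case False
      then have ex: "ex i (r0 + k) = 0" by (simp add: ex_def)
      have "(\<Sum>s<?K + d i. ?c i (r0 + k) t s * u (i, s)) = 0"
        unfolding ex by (intro sum.neutral) auto
      then show ?thesis using False by simp
    qed
    have "(\<Sum>i<Suc r0. \<Sum>s<?K + d i. ?c i (r0 + k) t s * u (i, s)) = u (\<iota> k, c k + t)"
      unfolding * using \<iota>[OF k] by (simp add: sum.delta del: sum.lessThan_Suc)
    then show ?thesis using u[rule_format, of "r0 + k" t] k t by simp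
  qed
  \<comment> \<open>Coordinates of different blocks at the same position agree, passing through all
    blocks between them.\<close>
  have chain: "u (i, s) = u (i + \<delta>, s')"
    if "i + \<delta> < Suc r0" "s < ?K + d i" "off i + s = off (i + \<delta>) + s'" for i \<delta> s s'
    using that
  proof (induction \<delta> arbitrary: i s)
    case (Suc \<delta>)
    have "off (Suc i) \<le> off (i + Suc \<delta>)" unfolding off_def by (rule sum_mono2) auto
    then have s: "d i \<le> s" using Suc.prems by (simp add: off_def)
    have "u (i, s) = u (Suc i, s - d i)" using ug[of i "s - d i"] s Suc.prems by simp
    also have "\<dots> = u (Suc i + \<delta>, s')"
      by (rule Suc.IH) (use Suc.prems s in \<open>auto simp: off_def\<close>)
    finally show ?case by simp
  qed simp
  define \<phi> where "\<phi> = off i0 + s0"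
  have "off (Suc i0) \<le> off (Suc r0)" unfolding off_def using i0 by (intro sum_mono2) auto
  then have "\<phi> < \<tau> q + ?K" using s0 unfolding \<phi>_def \<tau>q a by (simp add: off_def)
  then obtain k where k: "k \<le> q" "\<tau> k \<le> \<phi>" "\<phi> < \<tau> k + ?K"
    using ex_between[of \<tau> ?K \<phi> q] \<tau>0 \<tau>hi by blast
  define t where "t = \<phi> - \<tau> k"
  have t: "t < ?K" using k by (auto simp: t_def)
  have offk: "off (\<iota> k) + (c k + t) = off i0 + s0"
    using pos[OF k(1)] k by (simp add: off_def[of "\<iota> k"] t_def \<phi>_def)
  show "u (i0, s0) = 0"
  proof (cases "i0 \<le> \<iota> k")
    case True
    then have "u (i0, s0) = u (i0 + (\<iota> k - i0), c k + t)"
      using \<iota>[OF k(1)] s0 offk by (intro chain) auto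
    then show ?thesis using uh[OF k(1) t] True by simp
  next
    case False
    then have "u (\<iota> k, c k + t) = u (\<iota> k + (i0 - \<iota> k), s0)"
      using i0 offk t c[OF k(1)] by (intro chain) auto
    then show ?thesis using uh[OF k(1) t] False by simp
  qed
qed

end

lemma gen_pos_exists:
  assumes r: "0 < r" "r < n" and a: "a = (\<Sum>i<r. d i)" and \<alpha>: "\<alpha> = a div (n - r)"
  shows "\<exists>R. (\<forall>i<r. \<forall>j<n. degree (R i j) \<le> d i) \<and> gen_pos r n d \<alpha> R"
proof -
  obtain r0 where r0: "r = Suc r0" using r by (cases r) auto
  define q where "q = n - r"
  have n: "n = r0 + Suc q" using r r0 by (simp add: q_def)
  \<comment> \<open>The first \<open>a mod q\<close> gaps have length \<open>\<alpha> + 1\<close>,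
    the others \<open>\<alpha>\<close>, so that \<open>\<tau> q = a\<close>. Beyond \<open>q\<close>
    the sequence only continues with legal gaps, as the locale asks for all
    \<open>k\<close>.\<close>
  define \<tau> where "\<tau> k = (if k \<le> q then k * \<alpha> + min k (a mod q) else a + (k - q) * \<alpha>)" for k
  have q0: "q > 0" using r by (simp add: q_def)
  have aq: "a = q * \<alpha> + a mod q" by (simp add: \<alpha> q_def mult.commute)
  have mq: "a mod q \<le> q" using q0 by (simp add: less_imp_le)
  have \<tau>q: "\<tau> q = a" using aq mq by (simp add: \<tau>_def min_def)
  have \<tau>s: "\<tau> k + \<alpha> \<le> \<tau> (Suc k) \<and> \<tau> (Suc k) \<le> \<tau> k + Suc \<alpha>" for k
  proof (cases "k < q")
    case True
    then show ?thesis by (auto simp: \<tau>_def min_def)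
  next
    case False
    have "\<tau> k = a + (k - q) * \<alpha>" using False \<tau>q by (cases "k = q") (auto simp: \<tau>_def)
    moreover have "\<tau> (Suc k) = a + (k - q) * \<alpha> + \<alpha>" using False by (simp add: \<tau>_def Suc_diff_le)
    ultimately show ?thesis by simp
  qed
  have \<tau>a: "\<tau> k \<le> a" if "k \<le> q" for k
    using that
  proof (induction k rule: inc_induct)
    case (step k)
    then show ?case using \<tau>s[of k] by simp
  qed (simp add: \<tau>q)
  have "\<forall>k\<in>{..q}. \<exists>ic. fst ic < Suc r0 \<and> snd ic \<le> d (fst ic) \<and> (\<Sum>i<fst ic. d i) + snd ic = \<tau> k"
  proof
    fix k assume "k \<in> {..q}"
    then have "\<tau> k \<le> (\<Sum>i<Suc r0. d i)" using \<tau>a[of k] a r0 by simp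
    from partial_sum_decomp[OF this]
    show "\<exists>ic. fst ic < Suc r0 \<and> snd ic \<le> d (fst ic) \<and> (\<Sum>i<fst ic. d i) + snd ic = \<tau> k" by auto
  qed
  from bchoice[OF this] obtain ic where
    ic: "\<forall>k\<in>{..q}. fst (ic k) < Suc r0 \<and> snd (ic k) \<le> d (fst (ic k)) \<and> (\<Sum>i<fst (ic k). d i) + snd (ic k) = \<tau> k" ..
  interpret zigzag r0 q \<alpha> a d \<tau> "\<lambda>k. fst (ic k)" "\<lambda>k. snd (ic k)"
    by unfold_locales (use a r0 \<tau>q \<tau>s ic in \<open>auto simp: \<tau>_def[of 0]\<close>)
  show ?thesis
    unfolding gen_pos_def n r0 using ex_degree ex_inj ex_transpose_inj by blast
qed

section \<open>Minimal bases of the kernel of a matrix polynomial\<close>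

interpretation tf: inj_comm_ring_hom "to_fract :: complex poly \<Rightarrow> complex poly fract"
  by unfold_locales auto

lemma common_denominator:
  fixes f :: "'i \<Rightarrow> complex poly fract"
  assumes "finite L"
  shows "\<exists>q c. q \<noteq> 0 \<and> (\<forall>l\<in>L. to_fract q * f l = to_fract (c l))"
proof -
  have "\<exists>x y. y \<noteq> 0 \<and> to_fract y * f l = to_fract x" for l
  proof -
    obtain x y where "f l = Fract x y" "y \<noteq> 0" by (cases "f l")
    then show ?thesis by (intro exI[of _ x] exI[of _ y]) (simp add: Fract_conv_to_fract)
  qed
  then obtain x y where y: "\<And>l. y l \<noteq> 0" and f: "\<And>l. to_fract (y l) * f l = to_fract (x l)"
    by metis
  have "to_fract (prod y L) * f l = to_fract (prod y (L - {l}) * x l)" if "l \<in> L" for l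
  proof -
    have "prod y L = prod y (L - {l}) * y l" using prod.remove[OF assms that, of y] by (simp add: mult.commute)
    then show ?thesis using f[of l] by (simp add: mult.assoc)
  qed
  moreover have "prod y L \<noteq> 0" using assms y by simp
  ultimately show ?thesis
    by (intro exI[of _ "prod y L"] exI[of _ "\<lambda>l. prod y (L - {l}) * x l"] conjI ballI)
qed

lemma pbasis_cong:
  assumes "\<And>l j. l < p \<Longrightarrow> j < n \<Longrightarrow> b l j = b' l j"
  shows "pbasis m n M p b \<longleftrightarrow> pbasis m n M p b'"
proof -
  have "pker m n M (b l) \<longleftrightarrow> pker m n M (b' l)" if "l < p" for l
    using assms that by (intro pker_cong) auto
  moreover have "inj_mat {..<n} {..<p} (\<lambda>j l. b l j) \<longleftrightarrow> inj_mat {..<n} {..<p} (\<lambda>j l. b' l j)"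
    using assms by (intro inj_mat_cong) auto
  moreover have "(\<Sum>l<p. b l j * c l) = (\<Sum>l<p. b' l j * c l)" if "j < n" for j c
    using assms that by (intro sum.cong) auto
  ultimately show ?thesis unfolding pbasis_def by simp
qed

text \<open>Rank-nullity for multiplication by \<open>A\<close>; its image is the column space,
  whose dimension is the rank. It converts \<open>normal_rank\<close> into a count of minimal
  indices.\<close>

lemma (in kernel) rank_plus_dim: "vec_space.rank nr A + dim = nc"
proof -
  interpret NR: vec_space "TYPE('a)" nr .
  interpret T: linear_map class_ring NC.V NR.V "\<lambda>v. A *\<^sub>v v"
    by unfold_locales
      (use A in \<open>auto simp: module_hom_def module_vec_simps class_ring_simps
        mult_add_distrib_mat_vec[OF A] mult_mat_vec[OF A]\<close>)
  have ker: "T.kerT = mat_kernel A"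
    unfolding T.ker_def mat_kernel[OF A] by (auto simp: module_vec_simps)
  have im: "T.imT = NR.span (set (cols A))"
  proof -
    have "NR.span (set (cols A)) = {y \<in> carrier_vec nr. \<exists>x\<in>carrier_vec nc. A *\<^sub>v x = y}"
      using NR.col_space_eq[OF A] A unfolding NR.col_space_def by simp
    also have "\<dots> = (\<lambda>v. A *\<^sub>v v) ` carrier_vec nc"
      using mult_mat_vec_carrier[OF A] by blast
    finally show ?thesis unfolding T.im_def module_vec_simps by simp
  qed
  show ?thesis
    using T.rank_nullity[OF NC.fin_dim] unfolding ker im NC.dim_is_n NR.rank_def by simp
qed

context
  fixes P :: "complex poly mat" and m n :: nat
  assumes P: "P \<in> carrier_mat m n"
begin

abbreviation (input) "ratP \<equiv> rat_mat P"
abbreviation (input) "entP \<equiv> (\<lambda>i j. P $$ (i, j))"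

lemma ratP: "ratP \<in> carrier_mat m n" using P by simp

interpretation kernel m n ratP by unfold_locales (rule ratP)

lemma rat_vec_kernel_iff:
  "vec n f \<in> mat_kernel ratP \<longleftrightarrow> (\<forall>i<m. (\<Sum>j<n. to_fract (entP i j) * f j) = 0)"
proof -
  have "(ratP *\<^sub>v vec n f) $ i = (\<Sum>j<n. to_fract (entP i j) * f j)" if "i < m" for i
    using that P by (simp add: scalar_prod_def lessThan_atLeast0)
  then show ?thesis unfolding mat_kernel[OF ratP] using P by (auto simp: vec_eq_iff)
qed

lemma poly_vec_kernel_iff: "vec n (\<lambda>j. to_fract (x j)) \<in> mat_kernel ratP \<longleftrightarrow> pker m n entP x"
proof -
  have "(\<Sum>j<n. to_fract (entP i j) * to_fract (x j)) = to_fract (\<Sum>j<n. entP i j * x j)" for i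
    by (simp only: tf.hom_sum tf.hom_mult)
  then show ?thesis unfolding rat_vec_kernel_iff pker_def by (simp only: tf.hom_0_iff)
qed

context
  fixes B :: "complex poly vec list"
  assumes B: "set B \<subseteq> carrier_vec n" and dist: "distinct B"
begin

abbreviation (input) "vecsB \<equiv> map_vec to_fract ` set B"
abbreviation (input) "entB \<equiv> (\<lambda>l j. B ! l $ j)"
abbreviation (input) "lenB \<equiv> length B"

lemma B_carrier: "l < lenB \<Longrightarrow> B ! l \<in> carrier_vec n" using B by auto

lemma bij_S: "bij_betw (\<lambda>l. map_vec to_fract (B ! l)) {..<lenB} vecsB"
proof -
  have "inj_on (map_vec to_fract) (set B)"
    by (rule inj_onI) (metis tf.vec_hom_inj)
  then have "bij_betw (map_vec to_fract) (set B) vecsB" by (simp add: bij_betw_def)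
  moreover have "bij_betw ((!) B) {..<lenB} (set B)" using dist by (intro bij_betw_nth) auto
  ultimately show ?thesis using bij_betw_trans by (fastforce simp: o_def)
qed

lemma S_kernel_iff: "vecsB \<subseteq> mat_kernel ratP \<longleftrightarrow> (\<forall>l<lenB. pker m n entP (entB l))"
proof -
  have *: "map_vec to_fract (B ! l) = vec n (\<lambda>j. to_fract (entB l j))" if "l < lenB" for l
    using B_carrier[OF that] by auto
  have "vecsB \<subseteq> mat_kernel ratP \<longleftrightarrow> (\<forall>l<lenB. map_vec to_fract (B ! l) \<in> mat_kernel ratP)"
    by (auto simp: set_conv_nth)
  also have "\<dots> \<longleftrightarrow> (\<forall>l<lenB. pker m n entP (entB l))"
    using poly_vec_kernel_iff by (simp add: *)
  finally show ?thesis .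
qed

lemma sum_S: "(\<Sum>x\<in>vecsB. g x) = (\<Sum>l<lenB. g (map_vec to_fract (B ! l)))"
  using sum.reindex_bij_betw[OF bij_S, of g] by simp

lemma lincomb_S:
  assumes "vecsB \<subseteq> mat_kernel ratP" and j: "j < n"
  shows "lincomb a vecsB $ j = (\<Sum>l<lenB. a (map_vec to_fract (B ! l)) * to_fract (entB l j))"
proof -
  have "lincomb a vecsB $ j = (\<Sum>x\<in>vecsB. a x * x $ j)" by (rule lincomb_index[OF j assms(1)])
  also have "\<dots> = (\<Sum>l<lenB. a (map_vec to_fract (B ! l)) * to_fract (entB l j))"
    unfolding sum_S
  proof (intro sum.cong refl)
    fix l assume "l \<in> {..<lenB}"
    then have "dim_vec (B ! l) = n" using B_carrier[of l] by (intro carrier_vecD) simp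
    then show "a (map_vec to_fract (B ! l)) * map_vec to_fract (B ! l) $ j =
        a (map_vec to_fract (B ! l)) * to_fract (entB l j)" using j by simp
  qed
  finally show ?thesis .
qed

text \<open>Transports coefficients from positions in \<open>B\<close> to the vectors themselves,
  which index \<open>lincomb\<close>.\<close>

definition coefB :: "(nat \<Rightarrow> complex poly fract) \<Rightarrow> complex poly fract vec \<Rightarrow> complex poly fract" where
  "coefB v x = v (inv_into {..<lenB} (\<lambda>l. map_vec to_fract (B ! l)) x)"

lemma coefB: "l < lenB \<Longrightarrow> coefB v (map_vec to_fract (B ! l)) = v l"
  by (simp only: coefB_def inv_into_f_f[OF bij_betw_imp_inj_on[OF bij_S]] lessThan_iff)

lemma lincomb_carrier: "vecsB \<subseteq> mat_kernel ratP \<Longrightarrow> lincomb a vecsB \<in> carrier_vec n"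
  using Ker.lincomb_closed[of vecsB a] mat_kernel_carrier[OF ratP] by (auto simp: class_ring_simps)

lemma lin_dep_iff:
  assumes SK: "vecsB \<subseteq> mat_kernel ratP"
  shows "lin_dep vecsB \<longleftrightarrow> \<not> inj_mat {..<n} {..<lenB} (\<lambda>j l. entB l j)"
proof
  assume "lin_dep vecsB"
  then obtain a x where a: "lincomb a vecsB = 0\<^sub>v n" "x \<in> vecsB" "a x \<noteq> 0"
    using Ker.finite_lin_dep[of vecsB] SK by (auto simp: class_ring_simps)
  obtain q c where q: "q \<noteq> 0" and c: "\<And>l. l < lenB \<Longrightarrow> to_fract q * a (map_vec to_fract (B ! l)) = to_fract (c l)"
    using common_denominator[of "{..<lenB}" "\<lambda>l. a (map_vec to_fract (B ! l))"] by auto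
  have zero: "(\<Sum>l<lenB. entB l j * c l) = 0" if j: "j < n" for j
  proof -
    have "to_fract (\<Sum>l<lenB. entB l j * c l) = to_fract q * (lincomb a vecsB $ j)"
      unfolding lincomb_S[OF SK j] sum_distrib_left
      using c by (simp add: tf.hom_sum tf.hom_mult mult.assoc[symmetric] mult.commute)
    also have "\<dots> = 0" using a j by simp
    finally show ?thesis by (simp only: tf.hom_0_iff)
  qed
  obtain l where l: "l < lenB" "x = map_vec to_fract (B ! l)" using a(2) by (auto simp: in_set_conv_nth)
  have "c l \<noteq> 0"
  proof
    assume "c l = 0"
    then have "to_fract q * a x = 0" using c[OF l(1)] l by simp
    then show False using q a by simp
  qed
  then show "\<not> inj_mat {..<n} {..<lenB} (\<lambda>j l. entB l j)"
    using zero l(1) unfolding inj_mat_def by auto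
next
  assume "\<not> inj_mat {..<n} {..<lenB} (\<lambda>j l. entB l j)"
  then obtain v l where v: "\<And>j. j < n \<Longrightarrow> (\<Sum>l<lenB. entB l j * v l) = 0" and l: "l < lenB" "v l \<noteq> 0"
    unfolding inj_mat_def by auto
  let ?a = "coefB (\<lambda>l. to_fract (v l))"
  have "lincomb ?a vecsB $ j = 0" if j: "j < n" for j
  proof -
    have "lincomb ?a vecsB $ j = to_fract (\<Sum>l<lenB. entB l j * v l)"
      unfolding lincomb_S[OF SK j] tf.hom_sum using coefB
      by (intro sum.cong) (auto simp: tf.hom_mult mult.commute)
    then show ?thesis using v[OF j] by simp
  qed
  then have "lincomb ?a vecsB = 0\<^sub>v n" using lincomb_carrier[OF SK] by auto
  moreover have "map_vec to_fract (B ! l) \<in> vecsB" using l by simp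
  moreover have "?a (map_vec to_fract (B ! l)) \<noteq> 0" using coefB[OF l(1)] l by simp
  ultimately show "lin_dep vecsB"
    unfolding Ker.lin_dep_def by (intro exI[of _ vecsB] exI[of _ ?a] exI) (auto simp: class_ring_simps)
qed

lemma gen_set_iff:
  assumes SK: "vecsB \<subseteq> mat_kernel ratP"
  shows "gen_set vecsB \<longleftrightarrow> (\<forall>x. pker m n entP x \<longrightarrow> (\<exists>q c. q \<noteq> 0 \<and> (\<forall>j<n. q * x j = (\<Sum>l<lenB. entB l j * c l))))"
proof
  assume gen: "gen_set vecsB"
  show "\<forall>x. pker m n entP x \<longrightarrow> (\<exists>q c. q \<noteq> 0 \<and> (\<forall>j<n. q * x j = (\<Sum>l<lenB. entB l j * c l)))"
  proof (intro allI impI)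
    fix x assume "pker m n entP x"
    then have "vec n (\<lambda>j. to_fract (x j)) \<in> span vecsB" using gen poly_vec_kernel_iff by simp
    then obtain a where a: "vec n (\<lambda>j. to_fract (x j)) = lincomb a vecsB"
      using Ker.finite_span[of vecsB] SK by auto
    obtain q c where q: "q \<noteq> 0" and c: "\<And>l. l < lenB \<Longrightarrow> to_fract q * a (map_vec to_fract (B ! l)) = to_fract (c l)"
      using common_denominator[of "{..<lenB}" "\<lambda>l. a (map_vec to_fract (B ! l))"] by auto
    have "q * x j = (\<Sum>l<lenB. entB l j * c l)" if j: "j < n" for j
    proof -
      have "to_fract (q * x j) = to_fract q * (lincomb a vecsB $ j)" using a j by (metis index_vec tf.hom_mult)
      also have "\<dots> = to_fract (\<Sum>l<lenB. entB l j * c l)"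
        unfolding lincomb_S[OF SK j] sum_distrib_left
        using c by (simp add: tf.hom_sum tf.hom_mult mult.assoc[symmetric] mult.commute)
      finally show ?thesis by (simp only: tf.eq_iff)
    qed
    then show "\<exists>q c. q \<noteq> 0 \<and> (\<forall>j<n. q * x j = (\<Sum>l<lenB. entB l j * c l))" using q by blast
  qed
next
  assume *: "\<forall>x. pker m n entP x \<longrightarrow> (\<exists>q c. q \<noteq> 0 \<and> (\<forall>j<n. q * x j = (\<Sum>l<lenB. entB l j * c l)))"
  have "f \<in> span vecsB" if f: "f \<in> mat_kernel ratP" for f
  proof -
    have fc: "f \<in> carrier_vec n" using f mat_kernel_carrier[OF ratP] by auto
    then have fv: "f = vec n (\<lambda>j. f $ j)" by auto
    obtain q x where q: "q \<noteq> 0" and x: "\<And>j. j < n \<Longrightarrow> to_fract q * f $ j = to_fract (x j)"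
      using common_denominator[of "{..<n}" "\<lambda>j. f $ j"] by auto
    have "pker m n entP x"
      unfolding poly_vec_kernel_iff[symmetric] rat_vec_kernel_iff
    proof (intro allI impI)
      fix i assume i: "i < m"
      have "(\<Sum>j<n. to_fract (entP i j) * to_fract (x j)) = (\<Sum>j<n. to_fract (entP i j) * (to_fract q * f $ j))"
        using x by (intro sum.cong) auto
      also have "\<dots> = to_fract q * (\<Sum>j<n. to_fract (entP i j) * f $ j)"
        unfolding sum_distrib_left by (intro sum.cong refl) (simp only: mult.left_commute)
      also have "\<dots> = 0" using f fv i rat_vec_kernel_iff[of "\<lambda>j. f $ j"] by simp
      finally show "(\<Sum>j<n. to_fract (entP i j) * to_fract (x j)) = 0" .
    qed
    then obtain q' c where q': "q' \<noteq> 0" and c: "\<And>j. j < n \<Longrightarrow> q' * x j = (\<Sum>l<lenB. entB l j * c l)"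
      using * by blast
    let ?k = "inverse (to_fract q' * to_fract q)"
    let ?a = "coefB (\<lambda>l. ?k * to_fract (c l))"
    have "f = lincomb ?a vecsB"
    proof (rule eq_vecI)
      fix j assume "j < dim_vec (lincomb ?a vecsB)"
      then have j: "j < n" using lincomb_carrier[OF SK, of ?a] by auto
      have "lincomb ?a vecsB $ j = ?k * to_fract (\<Sum>l<lenB. entB l j * c l)"
        unfolding lincomb_S[OF SK j] tf.hom_sum sum_distrib_left using coefB
        by (intro sum.cong) (auto simp: tf.hom_mult mult.commute mult.left_commute)
      also have "\<dots> = ?k * (to_fract q' * to_fract q) * f $ j"
        unfolding c[OF j, symmetric] tf.hom_mult x[OF j, symmetric] by (simp only: mult.assoc)
      also have "?k * (to_fract q' * to_fract q) = 1" using q q' by (intro left_inverse) simp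
      finally show "f $ j = lincomb ?a vecsB $ j" by simp
    qed (use fc lincomb_carrier[OF SK, of ?a] in auto)
    then show ?thesis using Ker.finite_span[of vecsB] SK by (auto simp: class_ring_simps)
  qed
  moreover have "span vecsB \<subseteq> mat_kernel ratP" using Ker.span_is_subset2[of vecsB] SK by simp
  ultimately show "gen_set vecsB" by auto
qed

lemma basis_iff: "basis vecsB \<longleftrightarrow> pbasis m n entP lenB entB"
proof (cases "vecsB \<subseteq> mat_kernel ratP")
  case True
  then have k: "\<forall>l<lenB. pker m n entP (entB l)" using S_kernel_iff by (rule iffD1[rotated])
  show ?thesis
    using gen_set_iff[OF True] True k unfolding Ker.basis_def pbasis_def lin_dep_iff[OF True] by simp
next
  case False
  then have nk: "\<not> (\<forall>l<lenB. pker m n entP (entB l))" by (simp only: S_kernel_iff not_False_eq_True)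
  show ?thesis unfolding Ker.basis_def pbasis_def by (simp only: S_kernel_iff nk simp_thms)
qed

end

lemma polynomial_basis_iff:
  "polynomial_basis n (mat_kernel ratP) B \<longleftrightarrow>
    set B \<subseteq> carrier_vec n \<and> pbasis m n entP (length B) (\<lambda>l j. B ! l $ j)"
proof
  assume L: "polynomial_basis n (mat_kernel ratP) B"
  then have dist: "distinct B" and bas: "basis (map_vec to_fract ` set B)"
    unfolding polynomial_basis_def by auto
  have B: "set B \<subseteq> carrier_vec n"
  proof
    fix v assume "v \<in> set B"
    then have "map_vec to_fract v \<in> mat_kernel ratP" using bas unfolding Ker.basis_def by auto
    then have "map_vec to_fract v \<in> carrier_vec n"
      by (rule subsetD[OF mat_kernel_carrier[OF ratP]])
    then have "dim_vec (map_vec to_fract v) = n" by (rule carrier_vecD)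
    then show "v \<in> carrier_vec n" by (intro carrier_vecI) (simp only: index_map_vec(2))
  qed
  show "set B \<subseteq> carrier_vec n \<and> pbasis m n entP (length B) (\<lambda>l j. B ! l $ j)"
    using B iffD1[OF basis_iff[OF B dist] bas] by (rule conjI)
next
  assume R: "set B \<subseteq> carrier_vec n \<and> pbasis m n entP (length B) (\<lambda>l j. B ! l $ j)"
  have dist: "distinct B"
    unfolding distinct_conv_nth
  proof (intro allI impI notI)
    fix k l assume kl: "k < length B" "l < length B" "k \<noteq> l" "B ! k = B ! l"
    \<comment> \<open>Equal entries at positions \<open>k\<close> and \<open>l\<close> would be a
      dependency with coefficients 1 and -1, so independence already implies distinctness.\<close>
    define v :: "nat \<Rightarrow> complex poly" where "v i = (if i = k then 1 else if i = l then - 1 else 0)" for i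
    have "(\<Sum>i<length B. B ! i $ j * v i) = 0" for j
    proof -
      have "(\<Sum>i<length B. B ! i $ j * v i) =
          (\<Sum>i<length B. (if i = k then B ! k $ j else 0) - (if i = l then B ! l $ j else 0))"
        using kl by (intro sum.cong) (auto simp: v_def)
      then show ?thesis using kl by (simp add: sum_subtractf sum.delta)
    qed
    then have "v k = 0"
      using inj_matD[of "{..<n}" "{..<length B}" "\<lambda>j l. B ! l $ j" v k] R kl(1)
      by (simp add: pbasis_def)
    then show False by (simp add: v_def)
  qed
  show "polynomial_basis n (mat_kernel ratP) B"
    unfolding polynomial_basis_def
    using dist iffD2[OF basis_iff[OF conjunct1[OF R] dist] conjunct2[OF R]] by (rule conjI)
qed

lemma polynomial_basis_length:
  assumes "polynomial_basis n (mat_kernel ratP) B"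
  shows "length B + normal_rank P = n"
proof -
  have dist: "distinct B" and bas: "basis (map_vec to_fract ` set B)"
    using assms unfolding polynomial_basis_def by auto
  have "set B \<subseteq> carrier_vec n" using assms polynomial_basis_iff by blast
  from bij_S[OF this dist] have "card (map_vec to_fract ` set B) = length B"
    by (metis bij_betw_same_card card_lessThan)
  then have "dim = length B" using Ker.dim_basis[OF _ bas] by simp
  then show ?thesis using rank_plus_dim P unfolding normal_rank_def by simp
qed

lemma vec_degree_eq: "v \<in> carrier_vec n \<Longrightarrow> vec_degree v = vdeg n (\<lambda>j. v $ j)"
  unfolding vec_degree_def vdeg_def vec_set_def by (auto intro!: arg_cong[where f = Max] simp: lessThan_atLeast0)

lemma sum_vec_degree:
  assumes "set B \<subseteq> carrier_vec n"
  shows "sum_list (map vec_degree B) = (\<Sum>l<length B. vdeg n (\<lambda>j. B ! l $ j))"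
proof -
  have "sum_list (map vec_degree B) = (\<Sum>l<length B. vec_degree (B ! l))"
    by (simp add: sum_list_sum_nth lessThan_atLeast0)
  also have "\<dots> = (\<Sum>l<length B. vdeg n (\<lambda>j. B ! l $ j))"
    using assms by (intro sum.cong vec_degree_eq) auto
  finally show ?thesis .
qed

text \<open>All polynomial bases of the kernel have the same length, so being minimal among families
  of length \<open>p\<close> is the same as being minimal among all bases.\<close>

lemma pmin_imp_minimal_basis:
  assumes pm: "pmin m n entP p b"
  shows "minimal_basis n (mat_kernel ratP) (map (\<lambda>l. vec n (b l)) [0..<p])"
    and "map vec_degree (map (\<lambda>l. vec n (b l)) [0..<p]) = map (\<lambda>l. vdeg n (b l)) [0..<p]"
proof -
  let ?B = "map (\<lambda>l. vec n (b l)) [0..<p]"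
  have carr: "set ?B \<subseteq> carrier_vec n" by auto
  have deg: "vec_degree (vec n (b l)) = vdeg n (b l)" for l
    unfolding vec_degree_eq[OF vec_carrier] vdeg_def by (auto intro!: arg_cong[where f = Max])
  then show "map vec_degree ?B = map (\<lambda>l. vdeg n (b l)) [0..<p]" by simp
  have "pbasis m n entP p (\<lambda>l j. ?B ! l $ j)"
    using pm pbasis_cong[of p n b "\<lambda>l j. ?B ! l $ j" m entP] by (simp add: pmin_def)
  then have pbB: "polynomial_basis n (mat_kernel ratP) ?B" unfolding polynomial_basis_iff using carr by simp
  show "minimal_basis n (mat_kernel ratP) ?B"
    unfolding minimal_basis_def
  proof (intro conjI allI impI pbB)
    fix B' assume B': "polynomial_basis n (mat_kernel ratP) B'"
    have len: "length B' = p" using polynomial_basis_length[OF B'] polynomial_basis_length[OF pbB] by simp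
    have "(\<Sum>l<p. vdeg n (b l)) \<le> (\<Sum>l<p. vdeg n (\<lambda>j. B' ! l $ j))"
      using pm B' len unfolding pmin_def polynomial_basis_iff by simp
    also have "\<dots> = sum_list (map vec_degree B')"
      using sum_vec_degree B' len unfolding polynomial_basis_iff by simp
    finally show "sum_list (map vec_degree ?B) \<le> sum_list (map vec_degree B')"
      using deg by (simp add: sum_list_sum_nth lessThan_atLeast0)
  qed
qed

lemma minimal_basis_imp_pmin:
  assumes "minimal_basis n (mat_kernel ratP) B"
  shows "pmin m n entP (length B) (\<lambda>l j. B ! l $ j)" "set B \<subseteq> carrier_vec n"
proof -
  have pb: "polynomial_basis n (mat_kernel ratP) B" using assms by (simp add: minimal_basis_def)
  then show carr: "set B \<subseteq> carrier_vec n" by (simp add: polynomial_basis_iff)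
  show "pmin m n entP (length B) (\<lambda>l j. B ! l $ j)"
    unfolding pmin_def
  proof (intro conjI allI impI)
    show "pbasis m n entP (length B) (\<lambda>l j. B ! l $ j)" using pb by (simp add: polynomial_basis_iff)
    fix b' assume b': "pbasis m n entP (length B) b'"
    let ?B = "map (\<lambda>l. vec n (b' l)) [0..<length B]"
    have carr': "set ?B \<subseteq> carrier_vec n" by auto
    have "pbasis m n entP (length B) (\<lambda>l j. ?B ! l $ j)"
      using b' pbasis_cong[of "length B" n b' "\<lambda>l j. ?B ! l $ j" m entP] by simp
    then have "polynomial_basis n (mat_kernel ratP) ?B" unfolding polynomial_basis_iff by auto
    then have "sum_list (map vec_degree B) \<le> sum_list (map vec_degree ?B)"
      using assms unfolding minimal_basis_def by blast
    also have "\<dots> = (\<Sum>l<length B. vdeg n (\<lambda>j. ?B ! l $ j))"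
      using sum_vec_degree[OF carr'] by simp
    also have "\<dots> = (\<Sum>l<length B. vdeg n (b' l))"
      by (intro sum.cong refl) (simp add: vdeg_def cong: image_cong_simp)
    finally show "(\<Sum>l<length B. vdeg n (\<lambda>j. B ! l $ j)) \<le> (\<Sum>l<length B. vdeg n (b' l))"
      using sum_vec_degree[OF carr] by simp
  qed
qed

text \<open>The interface to the definitions: from here on minimal indices and the normal rank are
  accessed through some \<open>rbasis\<close> of the kernel.\<close>

lemma right_minimal_indices_rbasis:
  "\<exists>p b e. rbasis m n entP p b e \<and> right_minimal_indices P = rev (sort (map e [0..<p])) \<and>
     p + normal_rank P = n"
proof -
  obtain p b where pm: "pmin m n entP p b" using pmin_exists by blast
  let ?B = "map (\<lambda>l. vec n (b l)) [0..<p]" and ?e = "\<lambda>l. vdeg n (b l)"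
  note B = pmin_imp_minimal_basis[OF pm]
  have rb: "rbasis m n entP p b ?e" using pm by (rule pmin_rbasis)
  have "minimal_indices n (mat_kernel ratP) = rev (sort (map ?e [0..<p]))"
    unfolding minimal_indices_def
  proof (rule the_equality)
    show "\<exists>B. minimal_basis n (mat_kernel ratP) B \<and> rev (sort (map ?e [0..<p])) = rev (sort (map vec_degree B))"
      using B by metis
    fix l assume "\<exists>B. minimal_basis n (mat_kernel ratP) B \<and> l = rev (sort (map vec_degree B))"
    then obtain B' where B': "minimal_basis n (mat_kernel ratP) B'" "l = rev (sort (map vec_degree B'))" by blast
    note pm' = minimal_basis_imp_pmin[OF B'(1)]
    have "mset (map ?e [0..<p]) = mset (map (\<lambda>l. vdeg n (\<lambda>j. B' ! l $ j)) [0..<length B'])"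
      by (rule rbasis_unique[OF rb pmin_rbasis[OF pm'(1)]])
    also have "map (\<lambda>l. vdeg n (\<lambda>j. B' ! l $ j)) [0..<length B'] = map vec_degree B'"
      by (intro nth_equalityI) (simp_all add: vec_degree_eq subsetD[OF pm'(2) nth_mem])
    finally have "sort (map ?e [0..<p]) = sort (map vec_degree B')"
      by (metis properties_for_sort mset_sort sorted_sort)
    then show "l = rev (sort (map ?e [0..<p]))" using B' by simp
  qed
  then have "right_minimal_indices P = rev (sort (map ?e [0..<p]))"
    unfolding right_minimal_indices_def using P by simp
  moreover have "p + normal_rank P = n"
    using polynomial_basis_length[of ?B] B(1) by (simp add: minimal_basis_def)
  ultimately show ?thesis using rb by blast
qed

end

lemma left_minimal_indices_transpose: "left_minimal_indices P = right_minimal_indices (P\<^sup>T)"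
proof -
  have "(rat_mat P)\<^sup>T = rat_mat (P\<^sup>T)" by (rule eq_matI) auto
  then show ?thesis unfolding left_minimal_indices_def right_minimal_indices_def by simp
qed

section \<open>Full rank factorizations and the Smith form\<close>

lemma unimodular_mult: "unimodular k U \<Longrightarrow> unimodular k V \<Longrightarrow> unimodular k (U * V)"
proof -
  assume "unimodular k U" "unimodular k V"
  then obtain c c' where "U \<in> carrier_mat k k" "V \<in> carrier_mat k k" "c \<noteq> 0" "c' \<noteq> 0"
    "det U = [:c:]" "det V = [:c':]" unfolding unimodular_def by blast
  then show ?thesis
    unfolding unimodular_def by (intro conjI exI[of _ "c * c'"]) (auto simp: det_mult[of _ k])
qed

lemma unimodular_one: "unimodular k (1\<^sub>m k)"
  unfolding unimodular_def by (auto intro!: exI[of _ 1] simp: one_pCons)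

lemma unimodular_transpose: "unimodular k U \<Longrightarrow> unimodular k (U\<^sup>T)"
  unfolding unimodular_def by (auto simp: det_transpose[of _ k])

section \<open>Unimodular reduction of matrices with full column rank at every point\<close>

definition unit_cols :: "nat \<Rightarrow> nat \<Rightarrow> complex poly mat \<Rightarrow> bool" where
  "unit_cols m l L \<longleftrightarrow> (\<forall>j<l. \<forall>i<m. L $$ (i, j) = (if i = j then 1 else 0))"

definition eval_inj :: "nat \<Rightarrow> nat \<Rightarrow> complex poly mat \<Rightarrow> complex \<Rightarrow> bool" where
  "eval_inj m r L z \<longleftrightarrow> inj_mat {..<m} {..<r} (\<lambda>i j. poly (L $$ (i, j)) z)"

definition row_equiv :: "nat \<Rightarrow> complex poly mat \<Rightarrow> complex poly mat \<Rightarrow> bool" where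
  "row_equiv m L L' \<longleftrightarrow> (\<exists>U. unimodular m U \<and> L' = U * L)"

lemma row_equiv_refl: "L \<in> carrier_mat m r \<Longrightarrow> row_equiv m L L"
  unfolding row_equiv_def using unimodular_one by (intro exI[of _ "1\<^sub>m m"]) auto

lemma row_equiv_carrier: "row_equiv m L L' \<Longrightarrow> L \<in> carrier_mat m r \<Longrightarrow> L' \<in> carrier_mat m r"
  unfolding row_equiv_def unimodular_def by auto

lemma row_equiv_trans:
  assumes "L \<in> carrier_mat m r" "row_equiv m L L'" "row_equiv m L' L''"
  shows "row_equiv m L L''"
proof -
  obtain U V where U: "unimodular m U" "L' = U * L" and V: "unimodular m V" "L'' = V * L'"
    using assms unfolding row_equiv_def by blast
  have "L'' = (V * U) * L" using U V assms(1) by (simp add: unimodular_def assoc_mult_mat[of _ m m _ m _ r])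
  then show ?thesis using unimodular_mult[OF V(1) U(1)] unfolding row_equiv_def by blast
qed

lemma row_equiv_addrow:
  assumes "L \<in> carrier_mat m r" "l < m" "k \<noteq> l"
  shows "row_equiv m L (addrow a k l L)"
  unfolding row_equiv_def
  by (intro exI[of _ "addrow_mat m a k l"] conjI addrow_mat[OF assms(1,2)])
    (auto simp: unimodular_def det_addrow_mat[OF assms(3)] one_pCons intro!: exI[of _ 1])

lemma row_equiv_multrow:
  assumes "L \<in> carrier_mat m r" "k < m" "c \<noteq> 0"
  shows "row_equiv m L (multrow k [:c:] L)"
  unfolding row_equiv_def
  by (intro exI[of _ "multrow_mat m k [:c:]"] conjI multrow_mat[OF assms(1)])
    (use assms in \<open>auto simp: unimodular_def det_multrow_mat\<close>)

lemma poly_index_mult: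
  assumes "A \<in> carrier_mat a k" "B \<in> carrier_mat k b" "i < a" "j < b"
  shows "poly ((A * B) $$ (i, j)) z = (\<Sum>l<k. poly (A $$ (i, l)) z * poly (B $$ (l, j)) z)"
  using assms by (simp add: scalar_prod_def lessThan_atLeast0 poly_sum)

lemma mult_mat_assoc4:
  assumes "U \<in> carrier_mat a b" "L \<in> carrier_mat b c" "R \<in> carrier_mat c d" "V \<in> carrier_mat d e"
  shows "U * (L * R) * V = (U * L) * (R * V)"
proof -
  have "U * (L * R) * V = U * L * R * V" using assoc_mult_mat[OF assms(1,2,3)] by simp
  also have "\<dots> = (U * L) * (R * V)" using assms by (intro assoc_mult_mat) auto
  finally show ?thesis .
qed

text \<open>The adjugate of a unimodular matrix undoes it up to the constant \<open>c\<close>, also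
  after evaluation at \<open>z\<close>.\<close>

lemma eval_inj_row_equiv:
  assumes L: "L \<in> carrier_mat m r" and eq: "row_equiv m L L'" and inj: "eval_inj m r L z"
  shows "eval_inj m r L' z"
proof -
  obtain U c where U: "U \<in> carrier_mat m m" "c \<noteq> 0" "det U = [:c:]" and L': "L' = U * L"
    using eq unfolding row_equiv_def unimodular_def by blast
  let ?W = "adj_mat U"
  have W: "?W \<in> carrier_mat m m" "?W * U = det U \<cdot>\<^sub>m 1\<^sub>m m" using adj_mat[OF U(1)] by auto
  have L'c: "L' \<in> carrier_mat m r" using L' U L by simp
  have "?W * L' = (?W * U) * L" unfolding L' using assoc_mult_mat[OF W(1) U(1) L] by simp
  also have "\<dots> = [:c:] \<cdot>\<^sub>m L" unfolding W U using L by (simp add: mult_smult_assoc_mat[of _ m m _ r])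
  finally have WL: "?W * L' = [:c:] \<cdot>\<^sub>m L" .
  have "(\<Sum>l<m. poly (?W $$ (i, l)) z * poly (L' $$ (l, j)) z) = c * poly (L $$ (i, j)) z"
    if "i < m" "j < r" for i j
    unfolding poly_index_mult[OF W(1) L'c that, symmetric] WL using that L by simp
  then have "inj_mat {..<m} {..<r} (\<lambda>i j. \<Sum>l<m. poly (?W $$ (i, l)) z * poly (L' $$ (l, j)) z) \<longleftrightarrow>
      inj_mat {..<m} {..<r} (\<lambda>i j. c * poly (L $$ (i, j)) z)"
    by (intro inj_mat_cong) auto
  then have "inj_mat {..<m} {..<r} (\<lambda>i j. \<Sum>l<m. poly (?W $$ (i, l)) z * poly (L' $$ (l, j)) z)"
    using inj U(2) by (simp add: eval_inj_def inj_mat_scale)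
  then show ?thesis unfolding eval_inj_def by (rule inj_mat_comp)
qed

text \<open>Euclid's algorithm on the entries of column \<open>l\<close> from row \<open>l\<close> on.\<close>

lemma reduce_column:
  assumes "L \<in> carrier_mat m r" "l < r" "l < m" "unit_cols m l L"
  shows "\<exists>L' i0. row_equiv m L L' \<and> unit_cols m l L' \<and> l \<le> i0 \<and> i0 < m \<and>
    (\<forall>i\<in>{l..<m}. i \<noteq> i0 \<longrightarrow> L' $$ (i, l) = 0)"
  using assms
proof (induction "\<Sum>i\<in>{l..<m}. if L $$ (i, l) = 0 then 0 else Suc (degree (L $$ (i, l)))"
    arbitrary: L rule: less_induct)
  case less
  show ?case
  proof (cases "\<exists>i1\<in>{l..<m}. \<exists>i2\<in>{l..<m}. i1 \<noteq> i2 \<and> L $$ (i1, l) \<noteq> 0 \<and> L $$ (i2, l) \<noteq> 0")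
    case False
    show ?thesis
    proof (cases "\<exists>i0\<in>{l..<m}. L $$ (i0, l) \<noteq> 0")
      case True
      then obtain i0 where "i0 \<in> {l..<m}" "L $$ (i0, l) \<noteq> 0" by blast
      moreover have "L $$ (i, l) = 0" if "i \<in> {l..<m}" "i \<noteq> i0" for i
        using False that calculation by blast
      ultimately show ?thesis using less.prems row_equiv_refl[of L m r]
        by (intro exI[of _ L] exI[of _ i0]) auto
    next
      case False
      then show ?thesis using less.prems row_equiv_refl[of L m r]
        by (intro exI[of _ L] exI[of _ l]) auto
    qed
  next
    case True
    have "\<exists>i1 i2. i1 \<in> {l..<m} \<and> i2 \<in> {l..<m} \<and> i1 \<noteq> i2 \<and> L $$ (i1, l) \<noteq> 0 \<and> L $$ (i2, l) \<noteq> 0 \<and>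
        degree (L $$ (i1, l)) \<le> degree (L $$ (i2, l))"
      using True by (metis linear)
    then obtain i1 i2 where i: "i1 \<in> {l..<m}" "i2 \<in> {l..<m}" "i1 \<noteq> i2" "L $$ (i1, l) \<noteq> 0" "L $$ (i2, l) \<noteq> 0"
      "degree (L $$ (i1, l)) \<le> degree (L $$ (i2, l))" by blast
    define a where "a = - (L $$ (i2, l) div L $$ (i1, l))"
    let ?L = "addrow a i2 i1 L"
    have eq: "row_equiv m L ?L" using i less.prems by (intro row_equiv_addrow) auto
    have carr: "?L \<in> carrier_mat m r" using less.prems by simp
    have new: "?L $$ (i2, l) = L $$ (i2, l) mod L $$ (i1, l)"
      using i less.prems by (simp add: a_def minus_div_mult_eq_mod[symmetric] del: minus_div_mult_eq_mod)
    have old: "?L $$ (i, l) = L $$ (i, l)" if "i \<noteq> i2" "i < m" for i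
      using that less.prems by simp
    have unit: "unit_cols m l ?L"
      using less.prems i unfolding unit_cols_def by auto
    \<comment> \<open>Zero counts less than a nonzero constant, so a division without remainder
      decreases the measure as well.\<close>
    let ?\<mu> = "\<lambda>L :: complex poly mat. \<lambda>i. if L $$ (i, l) = 0 then 0 else Suc (degree (L $$ (i, l)))"
    have "sum (?\<mu> ?L) {l..<m} < sum (?\<mu> L) {l..<m}"
    proof (rule sum_strict_mono_ex1)
      have less2: "?\<mu> ?L i2 < ?\<mu> L i2"
        using i degree_mod_less[OF i(4), of "L $$ (i2, l)"] unfolding new by auto
      then show "\<exists>i\<in>{l..<m}. ?\<mu> ?L i < ?\<mu> L i" using i(2) by blast
      show "\<forall>i\<in>{l..<m}. ?\<mu> ?L i \<le> ?\<mu> L i"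
      proof
        fix i assume "i \<in> {l..<m}"
        then show "?\<mu> ?L i \<le> ?\<mu> L i" using old[of i] less2 by (cases "i = i2") auto
      qed
    qed simp
    from less.hyps[OF this carr less.prems(2,3) unit]
    show ?thesis using row_equiv_trans[OF less.prems(1) eq] by blast
  qed
qed

lemma clear_column:
  assumes L: "L \<in> carrier_mat m r" and l: "l < r" "l < m" and unit: "unit_cols m l L"
    and one: "L $$ (l, l) = 1" and k: "k \<le> m"
  shows "\<exists>L'. row_equiv m L L' \<and> unit_cols m l L' \<and> L' $$ (l, l) = 1 \<and>
    (\<forall>i<k. i \<noteq> l \<longrightarrow> L' $$ (i, l) = 0)"
  using k
proof (induction k)
  case 0
  then show ?case using row_equiv_refl[OF L] unit one by blast
next
  case (Suc k)
  then obtain L' where L': "row_equiv m L L'" "unit_cols m l L'" "L' $$ (l, l) = 1"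
    "\<forall>i<k. i \<noteq> l \<longrightarrow> L' $$ (i, l) = 0" by auto
  have carr: "L' \<in> carrier_mat m r" by (rule row_equiv_carrier[OF L'(1) L])
  show ?case
  proof (cases "k = l")
    case True
    then show ?thesis using L' by (intro exI[of _ L']) (auto simp: less_Suc_eq)
  next
    case False
    let ?L = "addrow (- (L' $$ (k, l))) k l L'"
    have "row_equiv m L' ?L" using carr l False by (intro row_equiv_addrow) auto
    then have "row_equiv m L ?L" by (rule row_equiv_trans[OF L L'(1)])
    moreover have "unit_cols m l ?L" using L'(2) l carr unfolding unit_cols_def by auto
    moreover have "?L $$ (l, l) = 1" using L'(3) l carr False by simp
    moreover have "\<forall>i<Suc k. i \<noteq> l \<longrightarrow> ?L $$ (i, l) = 0"
      using L'(3,4) l carr Suc.prems by (auto simp: less_Suc_eq)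
    ultimately show ?thesis by blast
  qed
qed

text \<open>After Euclid's algorithm, column \<open>l\<close> has at most one nonzero entry from row
  \<open>l\<close> on. A root \<open>z\<close> of this pivot would make the column dependent on the
  preceding unit columns at \<open>z\<close>; hence the pivot is a nonzero constant and can be used
  to clear the column.\<close>

lemma extend_unit_cols:
  assumes L: "L \<in> carrier_mat m r" and l: "l < r" "l < m" and unit: "unit_cols m l L"
    and inj: "\<And>z. eval_inj m r L z"
  shows "\<exists>L'. row_equiv m L L' \<and> unit_cols m (Suc l) L'"
proof -
  obtain L1 i0 where L1: "row_equiv m L L1" "unit_cols m l L1" and i0: "l \<le> i0" "i0 < m"
    and zero: "\<And>i. i \<in> {l..<m} \<Longrightarrow> i \<noteq> i0 \<Longrightarrow> L1 $$ (i, l) = 0"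
    using reduce_column[OF L l unit] by auto
  have c1: "L1 \<in> carrier_mat m r" by (rule row_equiv_carrier[OF L1(1) L])
  have "poly (L1 $$ (i0, l)) z \<noteq> 0" for z
  proof
    assume z: "poly (L1 $$ (i0, l)) z = 0"
    \<comment> \<open>The dependency of column \<open>l\<close> on the unit columns, in case the
      pivot vanishes at \<open>z\<close>.\<close>
    define v where "v j = (if j < l then - poly (L1 $$ (j, l)) z else if j = l then 1 else 0)" for j
    have "(\<Sum>j<r. poly (L1 $$ (i, j)) z * v j) = 0" if i: "i < m" for i
    proof -
      have "(\<Sum>j<r. poly (L1 $$ (i, j)) z * v j) = (\<Sum>j<Suc l. poly (L1 $$ (i, j)) z * v j)"
        using l by (intro sum.mono_neutral_right) (auto simp: v_def)
      also have "\<dots> = (\<Sum>j<l. if j = i then - poly (L1 $$ (i, l)) z else 0) + poly (L1 $$ (i, l)) z"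
      proof -
        have "poly (L1 $$ (i, j)) z * v j = (if j = i then - poly (L1 $$ (i, l)) z else 0)" if "j < l" for j
          using L1(2) i that by (auto simp: unit_cols_def v_def)
        then show ?thesis by (simp add: v_def)
      qed
      also have "\<dots> = 0" using zero[of i] z i by (cases "i < l"; cases "i = i0") (auto simp: sum.delta)
      finally show ?thesis .
    qed
    then have "v l = 0"
      using inj_matD[of "{..<m}" "{..<r}" "\<lambda>i j. poly (L1 $$ (i, j)) z" v l]
        eval_inj_row_equiv[OF L L1(1) inj[of z]] l unfolding eval_inj_def by simp
    then show False by (simp add: v_def)
  qed
  then have "constant (poly (L1 $$ (i0, l)))" using fundamental_theorem_of_algebra by blast
  then have "degree (L1 $$ (i0, l)) = 0" by (simp add: constant_degree)
  then obtain c where c: "L1 $$ (i0, l) = [:c:]" by (rule degree_eq_zeroE)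
  then have "c \<noteq> 0" using \<open>\<And>z. poly (L1 $$ (i0, l)) z \<noteq> 0\<close>[of 0] by simp
  define L2 where "L2 = multrow i0 [:inverse c:] L1"
  have c2: "L2 \<in> carrier_mat m r" using c1 by (simp add: L2_def)
  have e2: "row_equiv m L L2" unfolding L2_def
    by (rule row_equiv_trans[OF L L1(1)], rule row_equiv_multrow[OF c1 i0(2)]) (use \<open>c \<noteq> 0\<close> in simp)
  have u2: "unit_cols m l L2" using L1(2) c1 l i0 unfolding L2_def unit_cols_def by auto
  have one2: "L2 $$ (i0, l) = 1" using c c1 l i0 \<open>c \<noteq> 0\<close> by (simp add: L2_def one_pCons)
  have zero2: "L2 $$ (i, l) = 0" if "i \<in> {l..<m}" "i \<noteq> i0" for i
    using zero[OF that] that c1 l by (simp add: L2_def)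
  have "\<exists>L3. row_equiv m L L3 \<and> unit_cols m l L3 \<and> L3 $$ (l, l) = 1"
  proof (cases "i0 = l")
    case True
    then show ?thesis using e2 u2 one2 by blast
  next
    case False
    \<comment> \<open>The entry at \<open>(l, l)\<close> is zero here, so adding the pivot row puts
      a 1 there. The first \<open>l\<close> columns are unaffected, since the pivot row is zero in
      them.\<close>
    let ?L = "addrow 1 l i0 L2"
    have "row_equiv m L2 ?L" using c2 i0 False by (intro row_equiv_addrow) auto
    then have "row_equiv m L ?L" by (rule row_equiv_trans[OF L e2])
    moreover have "unit_cols m l ?L" using u2 c2 l i0 unfolding unit_cols_def by auto
    moreover have "?L $$ (l, l) = 1" using one2 zero2[of l] c2 l False by simp
    ultimately show ?thesis by blast
  qed
  then obtain L3 where L3: "row_equiv m L L3" "unit_cols m l L3" "L3 $$ (l, l) = 1" by blast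
  have c3: "L3 \<in> carrier_mat m r" by (rule row_equiv_carrier[OF L3(1) L])
  obtain L4 where L4: "row_equiv m L3 L4" "unit_cols m l L4" "L4 $$ (l, l) = 1"
    "\<forall>i<m. i \<noteq> l \<longrightarrow> L4 $$ (i, l) = 0"
    using clear_column[OF c3 l L3(2,3), of m] by auto
  have "unit_cols m (Suc l) L4" using L4 unfolding unit_cols_def by (auto simp: less_Suc_eq)
  then show ?thesis using row_equiv_trans[OF L L3(1) L4(1)] by blast
qed

lemma eval_inj_le: "eval_inj m r L z \<Longrightarrow> r \<le> m"
  unfolding eval_inj_def using inj_mat_card[of "{..<m}" "{..<r}"] by fastforce

lemma eval_inj_reduces:
  assumes L: "L \<in> carrier_mat m r" and inj: "\<And>z. eval_inj m r L z"
  shows "\<exists>U. unimodular m U \<and> U * L = mat m r (\<lambda>(i, j). if i = j then 1 else 0)"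
proof -
  have "\<exists>L'. row_equiv m L L' \<and> unit_cols m l L'" if "l \<le> r" for l
    using that
  proof (induction l)
    case 0
    then show ?case using row_equiv_refl[OF L] by (auto simp: unit_cols_def)
  next
    case (Suc l)
    then obtain L' where L': "row_equiv m L L'" "unit_cols m l L'" by auto
    have "\<exists>L''. row_equiv m L' L'' \<and> unit_cols m (Suc l) L''"
    proof (rule extend_unit_cols[OF row_equiv_carrier[OF L'(1) L] _ _ L'(2)])
      show "eval_inj m r L' z" for z by (rule eval_inj_row_equiv[OF L L'(1) inj])
    qed (use Suc.prems eval_inj_le[OF inj] in auto)
    then show ?case using row_equiv_trans[OF L L'(1)] by blast
  qed
  then obtain L' where L': "row_equiv m L L'" "unit_cols m r L'" by blast
  have "L' = mat m r (\<lambda>(i, j). if i = j then 1 else 0)"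
    using row_equiv_carrier[OF L'(1) L] L'(2) unfolding unit_cols_def by (intro eq_matI) auto
  then show ?thesis using L'(1) unfolding row_equiv_def by metis
qed

text \<open>Existence comes from reducing \<open>L\<close> by row operations and \<open>R\<close> by
  column operations. Uniqueness matters because \<open>invariant_polynomials\<close> is a definite
  description: a root of an invariant polynomial would lower the rank of the product at that point,
  whereas both factors keep full rank there.\<close>

lemma full_rank_factorization_smith:
  assumes L: "L \<in> carrier_mat m r" and R: "R \<in> carrier_mat r n"
    and injL: "\<And>z. eval_inj m r L z" and injR: "\<And>z. eval_inj n r (R\<^sup>T) z"
    and rank: "normal_rank (L * R) = r"
  shows "is_smith_form (L * R) gs \<longleftrightarrow> gs = replicate r 1"
proof
  assume "gs = replicate r 1"
  moreover have "is_smith_form (L * R) (replicate r 1)"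
  proof -
    obtain U where U: "unimodular m U" "U * L = mat m r (\<lambda>(i, j). if i = j then 1 else 0)"
      using eval_inj_reduces[OF L injL] by blast
    obtain V where V: "unimodular n V" "V * R\<^sup>T = mat n r (\<lambda>(i, j). if i = j then 1 else 0)"
      using eval_inj_reduces[of "R\<^sup>T" n r] R injR by auto
    have Uc: "U \<in> carrier_mat m m" and Vc: "V \<in> carrier_mat n n"
      using U V by (auto simp: unimodular_def)
    have RV: "R * V\<^sup>T = mat r n (\<lambda>(i, j). if i = j then 1 else 0)"
    proof -
      have "R * V\<^sup>T = (V * R\<^sup>T)\<^sup>T" using R Vc by (simp add: transpose_mult[of _ n n])
      then show ?thesis unfolding V by auto
    qed
    have le: "r \<le> m" "r \<le> n" using eval_inj_le[OF injL] eval_inj_le[OF injR] .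
    have "U * (L * R) * V\<^sup>T = (U * L) * (R * V\<^sup>T)"
      using Vc by (intro mult_mat_assoc4[OF Uc L R]) auto
    also have "\<dots> = mat m n (\<lambda>(i, j). if i = j \<and> i < length (replicate r (1 :: complex poly)) then replicate r 1 ! i else 0)" (is "_ = ?D")
    proof (rule eq_matI)
      fix i j assume "i < dim_row (?D)"
        "j < dim_col (?D)"
      then have ij: "i < m" "j < n" by auto
      have "((U * L) * (R * V\<^sup>T)) $$ (i, j) = (\<Sum>k<r. (if i = k then 1 else 0) * (if k = j then 1 else 0))"
        unfolding U RV using ij by (simp add: scalar_prod_def lessThan_atLeast0)
      also have "\<dots> = (\<Sum>k<r. if k = i then (if i = j then 1 else 0) else 0)"
        by (intro sum.cong) auto
      finally show "((U * L) * (R * V\<^sup>T)) $$ (i, j) =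
          ?D $$ (i, j)"
        using ij by (simp add: sum.delta)
    qed (use U RV in auto)
    finally show ?thesis
      unfolding is_smith_form_def using L R rank U(1) unimodular_transpose[OF V(1)] by auto
  qed
  ultimately show "is_smith_form (L * R) gs" by simp
next
  assume S: "is_smith_form (L * R) gs"
  then have len: "length gs = r" and monic: "\<And>g. g \<in> set gs \<Longrightarrow> lead_coeff g = 1"
    using rank by (auto simp: is_smith_form_def)
  obtain U V where UV: "unimodular m U" "unimodular n V" and D: "U * (L * R) * V =
      mat m n (\<lambda>(i, j). if i = j \<and> i < length gs then gs ! i else 0)"
    using S L R unfolding is_smith_form_def by auto
  have Uc: "U \<in> carrier_mat m m" and Vc: "V \<in> carrier_mat n n" using UV by (auto simp: unimodular_def)
  let ?X = "U * L" and ?Y = "R * V"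
  have X: "?X \<in> carrier_mat m r" and Y: "?Y \<in> carrier_mat r n" using L R Uc Vc by auto
  have XY: "?X * ?Y = mat m n (\<lambda>(i, j). if i = j \<and> i < length gs then gs ! i else 0)"
    unfolding D[symmetric] by (rule mult_mat_assoc4[OF Uc L R Vc, symmetric])
  have injX: "eval_inj m r ?X z" for z
    using eval_inj_row_equiv[OF L _ injL] UV(1) unfolding row_equiv_def by blast
  have "?Y\<^sup>T = V\<^sup>T * R\<^sup>T" using R Vc by (simp add: transpose_mult[of _ r n])
  then have injY: "eval_inj n r (?Y\<^sup>T) z" for z
    using eval_inj_row_equiv[of "R\<^sup>T" n r "?Y\<^sup>T", OF _ _ injR] R unimodular_transpose[OF UV(2)]
    unfolding row_equiv_def by auto
  have noroot: "poly (gs ! k) z \<noteq> 0" if k: "k < r" for k z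
  proof
    assume root: "poly (gs ! k) z = 0"
    \<comment> \<open>At the root, only the \<open>r - 1\<close> rows other than \<open>k\<close> of
      the diagonal form can be nonzero. As \<open>R V\<close> has independent rows at
      \<open>z\<close>, the remaining rows of \<open>U L\<close> vanish at \<open>z\<close>, which
      leaves too few rows for injectivity.\<close>
    have zero: "poly (?X $$ (i, l)) z = 0" if i: "i < m" "i \<notin> {..<r} - {k}" and l: "l < r" for i l
    proof -
      have "(\<Sum>l<r. poly (?Y\<^sup>T $$ (j, l)) z * poly (?X $$ (i, l)) z) = 0" if j: "j < n" for j
      proof -
        have "(\<Sum>l<r. poly (?Y\<^sup>T $$ (j, l)) z * poly (?X $$ (i, l)) z) = poly ((?X * ?Y) $$ (i, j)) z"
          unfolding poly_index_mult[OF X Y i(1) j] using R Vc j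
          by (intro sum.cong) (auto simp: mult.commute)
        also have "\<dots> = 0" unfolding XY using i j root len by auto
        finally show ?thesis .
      qed
      then show ?thesis
        using inj_matD[of "{..<n}" "{..<r}" "\<lambda>j l. poly (?Y\<^sup>T $$ (j, l)) z" "\<lambda>l. poly (?X $$ (i, l)) z" l]
          injY[of z] l unfolding eval_inj_def by simp
    qed
    have "inj_mat ({..<r} - {k}) {..<r} (\<lambda>i j. poly (?X $$ (i, j)) z)"
      unfolding inj_mat_def
    proof (intro allI impI)
      fix v assume v: "\<forall>i\<in>{..<r} - {k}. (\<Sum>j<r. poly (?X $$ (i, j)) z * v j) = 0"
      have "(\<Sum>j<r. poly (?X $$ (i, j)) z * v j) = 0" if "i < m" for i
        using v zero[OF that] by (cases "i \<in> {..<r} - {k}") auto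
      then show "\<forall>j\<in>{..<r}. v j = 0" using injX[of z] unfolding eval_inj_def inj_mat_def by blast
    qed
    then have "card {..<r} \<le> card ({..<r} - {k})" by (intro inj_mat_card) auto
    then show False using k by simp
  qed
  have "g = 1" if "g \<in> set gs" for g
  proof -
    obtain k where k: "k < r" "g = gs ! k" using \<open>g \<in> set gs\<close> len unfolding in_set_conv_nth by blast
    have "constant (poly g)" using noroot[OF k(1)] fundamental_theorem_of_algebra unfolding k by blast
    then have "degree g = 0" by (simp add: constant_degree)
    then obtain c where "g = [:c:]" by (rule degree_eq_zeroE)
    then show ?thesis using monic[OF that] by (simp add: one_pCons)
  qed
  then show "gs = replicate r 1" using len by (metis replicate_eqI)
qed

lemma full_rank_factorization_elementary_divisors:
  assumes "L \<in> carrier_mat m r" "R \<in> carrier_mat r n"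
    and "\<And>z. eval_inj m r L z" and "\<And>z. eval_inj n r (R\<^sup>T) z"
    and "normal_rank (L * R) = r"
  shows "elementary_divisors (L * R) \<alpha> = {#}"
proof -
  have "invariant_polynomials (L * R) = replicate r 1"
    unfolding invariant_polynomials_def full_rank_factorization_smith[OF assms] by simp
  then show ?thesis by (simp add: elementary_divisors_def)
qed

section \<open>Dual minimal bases\<close>

lemma rbasis_ker_cong:
  assumes "\<And>x. pker m n M x \<longleftrightarrow> pker m' n M' x"
  shows "rbasis m n M p b e \<longleftrightarrow> rbasis m' n M' p b e"
  unfolding rbasis_def assms ..

text \<open>A combination that vanishes at \<open>z\<close> is divided by
  \<open>\<lambda> - z\<close> and the quotient expanded in the basis again. Comparing coefficients
  gives \<open>(\<lambda> - z) c\<^sub>l = y\<^sub>l\<close>, and evaluation at \<open>z\<close>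
  gives \<open>y\<^sub>l = 0\<close>.\<close>

lemma rbasis_eval_inj:
  assumes rb: "rbasis m n M p b e"
  shows "inj_mat {..<n} {..<p} (\<lambda>j l. poly (b l j) z)"
  unfolding inj_mat_def
proof (intro allI impI ballI)
  fix y l assume y: "\<forall>j\<in>{..<n}. (\<Sum>l<p. poly (b l j) z * y l) = 0" and l: "l \<in> {..<p}"
  define f where "f j = (\<Sum>l<p. b l j * [:y l:])" for j
  have dvd: "[:-z, 1:] dvd f j" if "j < n" for j
    unfolding poly_eq_0_iff_dvd[symmetric] f_def using y that by (simp add: poly_sum mult.commute)
  define x where "x j = f j div [:-z, 1:]" for j
  have x: "f j = [:-z, 1:] * x j" if "j < n" for j
    unfolding x_def by (rule dvd_mult_div_cancel[symmetric, OF dvd[OF that]])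
  have kf: "pker m n M f" unfolding f_def
    by (rule pker_comb) (use rb in \<open>auto simp: rbasis_def\<close>)
  have "pker m n M (\<lambda>j. [:-z, 1:] * x j)" using kf x pker_cong[of n f] by simp
  then have kx: "pker m n M x" by (rule pker_cancel[rotated]) simp
  have "\<forall>j<n. dlt (x j) (Suc (vdeg n x))" by (simp add: dlt_iff_degree degree_le_vdeg)
  then obtain c where c: "\<forall>j<n. x j = (\<Sum>l<p. b l j * c l)"
    using rb kx unfolding rbasis_def by blast
  have "[:-z, 1:] * c l - [:y l:] = 0"
  proof (rule inj_matD[of "{..<n}" "{..<p}" "\<lambda>j l. b l j" "\<lambda>l. [:-z, 1:] * c l - [:y l:]"])
    fix j assume j: "j \<in> {..<n}"
    have "(\<Sum>l<p. b l j * ([:-z, 1:] * c l - [:y l:])) = [:-z, 1:] * (\<Sum>l<p. b l j * c l) - f j"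
      unfolding f_def sum_distrib_left sum_subtractf[symmetric]
      by (intro sum.cong refl) (simp only: right_diff_distrib mult.left_commute)
    also have "\<dots> = 0" using c x j by simp
    finally show "(\<Sum>l<p. b l j * ([:-z, 1:] * c l - [:y l:])) = 0" .
  qed (use rb l in \<open>auto simp: rbasis_def\<close>)
  then have "poly ([:-z, 1:] * c l - [:y l:]) z = 0" by (simp only: poly_0)
  then show "y l = 0" by simp
qed

text \<open>Evaluated at \<open>z\<close>, the rows of \<open>R\<close> and the basis vectors are
  independent families that annihilate each other.\<close>

lemma rbasis_card_le:
  assumes rb: "rbasis r n R p b e" and inj: "inj_mat {..<n} {..<r} (\<lambda>j i. poly (R i j) z)"
  shows "r + p \<le> n"
proof -
  have "card {..<r} + card {..<p} \<le> card {..<n}"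
  proof (rule complex_card_le[where A = "\<lambda>i j. poly (R i j) z" and B = "\<lambda>j l. poly (b l j) z"])
    fix i l assume il: "i \<in> {..<r}" "l \<in> {..<p}"
    have "(\<Sum>j<n. R i j * b l j) = 0" using rb il by (simp add: rbasis_def pker_def)
    then have "poly (\<Sum>j<n. R i j * b l j) z = 0" by simp
    then show "(\<Sum>j<n. poly (R i j) z * poly (b l j) z) = 0" by (simp add: poly_sum)
  qed (use inj rbasis_eval_inj[OF rb] in auto)
  then show ?thesis by simp
qed

lemma rbasis_card_ge:
  assumes rb: "rbasis r n R p b e"
  shows "n \<le> r + p"
proof (rule ccontr)
  assume "\<not> ?thesis"
  then have less: "Suc (r + p) \<le> n" by simp
  define d where "d = (\<Sum>i<r. \<Sum>j<n. degree (R i j))"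
  have deg: "degree (R i j) \<le> d" if "i < r" "j < n" for i j
  proof -
    have "degree (R i j) \<le> (\<Sum>j<n. degree (R i j))" using that by (intro member_le_sum) auto
    also have "\<dots> \<le> d" unfolding d_def
      using that member_le_sum[of i "{..<r}" "\<lambda>i. \<Sum>j<n. degree (R i j)"] by auto
    finally show ?thesis .
  qed
  \<comment> \<open>If \<open>n > r + p\<close>, the unknowns exceed equations and kernel by at
    least \<open>K - r * d\<close>, which this choice makes positive.\<close>
  define K where "K = Suc (r * d)"
  have "n * K \<le> r * K + (\<Sum>i<r. d) + (\<Sum>l<p. K - e l)" using rb deg by (rule rbasis_dim_ge)
  also have "(\<Sum>l<p. K - e l) \<le> (\<Sum>l<p. K)" by (intro sum_mono) auto
  finally have "n * K \<le> (r + p) * K + r * d" by (simp add: algebra_simps)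
  moreover have "Suc (r + p) * K \<le> n * K" using less by (intro mult_right_mono) auto
  ultimately show False by (simp add: K_def)
qed

text \<open>Here \<open>b'\<close> is a minimal basis of the row space of \<open>M\<close>. The rows
  of \<open>M\<close> are combinations of \<open>b'\<close>, hence the kernels agree and each of
  \<open>b\<close>, \<open>b'\<close> is a minimal basis of the kernel of the other. The excess of
  unknowns over equations, counted both ways, bounds each degree sum by the other.\<close>

lemma rbasis_dual:
  assumes rb: "rbasis m n M p b e" and rb': "rbasis p n b p' b' e'"
  shows "p + p' = n" "(\<Sum>l<p. e l) = (\<Sum>l<p'. e' l)" "\<And>x. pker p' n b' x \<longleftrightarrow> pker m n M x"
proof -
  have ortho: "(\<Sum>j<n. b' l j * x j) = 0" if x: "pker m n M x" and l: "l < p'" for x l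
  proof -
    have "\<forall>j<n. dlt (x j) (Suc (vdeg n x))" by (simp add: dlt_iff_degree degree_le_vdeg)
    then obtain c where c: "\<forall>j<n. x j = (\<Sum>k<p. b k j * c k)"
      using rb x unfolding rbasis_def by blast
    have "(\<Sum>j<n. b' l j * x j) = (\<Sum>j<n. b' l j * (\<Sum>k<p. b k j * c k))"
      using c by (intro sum.cong) auto
    also have "\<dots> = (\<Sum>k<p. (\<Sum>j<n. b k j * b' l j) * c k)"
      unfolding sum_distrib_left sum_distrib_right by (subst sum.swap) (simp add: ac_simps)
    also have "\<dots> = 0" using rb' l by (intro sum.neutral) (auto simp: rbasis_def pker_def)
    finally show ?thesis .
  qed
  show ker: "pker p' n b' x \<longleftrightarrow> pker m n M x" for x
  proof
    assume "pker m n M x"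
    then show "pker p' n b' x" using ortho by (simp add: pker_def)
  next
    assume x: "pker p' n b' x"
    show "pker m n M x"
      unfolding pker_def
    proof (intro allI impI)
      fix i assume i: "i < m"
      have "pker p n b (M i)" using rb i by (simp add: rbasis_def pker_def mult.commute)
      moreover have "\<forall>j<n. dlt (M i j) (Suc (vdeg n (M i)))" by (simp add: dlt_iff_degree degree_le_vdeg)
      ultimately obtain c where c: "\<forall>j<n. M i j = (\<Sum>k<p'. b' k j * c k)"
        using rb' unfolding rbasis_def by blast
      have "(\<Sum>j<n. M i j * x j) = (\<Sum>j<n. (\<Sum>k<p'. b' k j * c k) * x j)"
        using c by (intro sum.cong) auto
      also have "\<dots> = (\<Sum>k<p'. c k * (\<Sum>j<n. b' k j * x j))"
        unfolding sum_distrib_left sum_distrib_right by (subst sum.swap) (simp add: ac_simps)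
      also have "\<dots> = 0" using x by (simp add: pker_def)
      finally show "(\<Sum>j<n. M i j * x j) = 0" .
    qed
  qed
  have rb2: "rbasis p' n b' p b e" using rb rbasis_ker_cong[OF ker] by blast
  have "p' + p \<le> n" by (rule rbasis_card_le[OF rb2 rbasis_eval_inj[OF rb']])
  moreover have "n \<le> p' + p" by (rule rbasis_card_ge[OF rb2])
  ultimately show n: "p + p' = n" by simp
  define K where "K = (\<Sum>l<p. e l) + (\<Sum>l<p'. e' l)"
  have eK: "e l \<le> K" if "l < p" for l using member_le_sum[of l "{..<p}" e] that by (simp add: K_def)
  have eK': "e' l \<le> K" if "l < p'" for l using member_le_sum[of l "{..<p'}" e'] that by (simp add: K_def)
  have 1: "n * K \<le> p' * K + (\<Sum>l<p'. e' l) + (\<Sum>l<p. K - e l)"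
    by (rule rbasis_dim_ge[OF rb2]) (use rb' in \<open>auto simp: rbasis_def\<close>)
  have 2: "n * K \<le> p * K + (\<Sum>l<p. e l) + (\<Sum>l<p'. K - e' l)"
    by (rule rbasis_dim_ge[OF rb']) (use rb in \<open>auto simp: rbasis_def\<close>)
  have nK: "n * K = p * K + p' * K" using n by (simp add: add_mult_distrib[symmetric])
  show "(\<Sum>l<p. e l) = (\<Sum>l<p'. e' l)"
    using 1 2 nK sum_diff_large[of p e K, OF eK] sum_diff_large[of p' e' K, OF eK'] by linarith
qed

text \<open>The rows of \<open>M\<close> have degree at most \<open>d\<close> and lie in the kernel
  of \<open>b\<close>. Expanding them in a minimal basis \<open>b'\<close> of this kernel gives
  \<open>L\<close>, and the coefficient bound with \<open>K = d + 1\<close> gives its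
  degrees.\<close>

lemma rbasis_factorization:
  assumes rb: "rbasis m n M p b e" and deg: "\<And>i j. i < m \<Longrightarrow> j < n \<Longrightarrow> degree (M i j) \<le> d"
  shows "\<exists>p' \<delta> L R. p + p' = n \<and> (\<Sum>l<p'. \<delta> l) = (\<Sum>l<p. e l) \<and> (\<forall>l<p'. \<delta> l \<le> d) \<and>
    (\<forall>l<p'. \<forall>j<n. degree (R l j) \<le> \<delta> l) \<and> (\<forall>i<m. \<forall>l<p'. degree (L i l) \<le> d - \<delta> l) \<and>
    (\<forall>i<m. \<forall>j<n. M i j = (\<Sum>l<p'. L i l * R l j))"
proof -
  obtain p' b' where "pmin p n b p' b'" using pmin_exists by blast
  define e' where "e' l = vdeg n (b' l)" for l
  have rb': "rbasis p n b p' b' e'" unfolding e'_def by (rule pmin_rbasis) fact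
  note dual = rbasis_dual[OF rb rb']
  have "\<exists>c. (\<forall>j<n. M i j = (\<Sum>l<p'. b' l j * c l)) \<and> (\<forall>l<p'. dlt (c l) (Suc d - e' l))" if i: "i \<in> {..<m}" for i
  proof -
    have "pker p n b (M i)" using rb i by (simp add: rbasis_def pker_def mult.commute)
    moreover have "\<forall>j<n. dlt (M i j) (Suc d)" using deg i by (simp add: dlt_iff_degree)
    ultimately show ?thesis using rb' unfolding rbasis_def by blast
  qed
  then have "\<forall>i\<in>{..<m}. \<exists>c. (\<forall>j<n. M i j = (\<Sum>l<p'. b' l j * c l)) \<and> (\<forall>l<p'. dlt (c l) (Suc d - e' l))" ..
  from bchoice[OF this] obtain L where
    "\<forall>i\<in>{..<m}. (\<forall>j<n. M i j = (\<Sum>l<p'. b' l j * L i l)) \<and> (\<forall>l<p'. dlt (L i l) (Suc d - e' l))" ..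
  then have L: "\<And>i j. i < m \<Longrightarrow> j < n \<Longrightarrow> M i j = (\<Sum>l<p'. b' l j * L i l)"
    and dL: "\<And>i l. i < m \<Longrightarrow> l < p' \<Longrightarrow> dlt (L i l) (Suc d - e' l)" by simp_all
  \<comment> \<open>A basis vector of degree above \<open>d\<close> could not occur in any row of
    \<open>M\<close>. Then \<open>M\<close> would factor through \<open>p' - 1\<close> rows, which
    forces a kernel of dimension above \<open>p\<close>.\<close>
  have le: "e' l0 \<le> d" if l0: "l0 < p'" for l0
  proof (rule ccontr)
    assume "\<not> ?thesis"
    then have "Suc d - e' l0 = 0" by simp
    then have z: "L i l0 = 0" if "i < m" for i using dL[OF that l0] by (auto simp: dlt_def intro!: poly_eqI)
    define S where "S = {..<p'} - {l0}"
    have card: "card S = p' - 1" using l0 by (simp add: S_def)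
    obtain \<sigma> where \<sigma>: "bij_betw \<sigma> {..<p' - 1} S"
      using ex_bij_betw_nat_finite[of S] unfolding card by (auto simp: S_def lessThan_atLeast0)
    have factor: "M i j = (\<Sum>k<p' - 1. b' (\<sigma> k) j * L i (\<sigma> k))" if "i < m" "j < n" for i j
    proof -
      have "M i j = (\<Sum>l\<in>S. b' l j * L i l)"
        unfolding L[OF that] S_def using l0 z[OF that(1)] by (subst sum.remove[of _ l0]) auto
      also have "\<dots> = (\<Sum>k<p' - 1. b' (\<sigma> k) j * L i (\<sigma> k))"
        using sum.reindex_bij_betw[OF \<sigma>, of "\<lambda>l. b' l j * L i l"] by simp
      finally show ?thesis .
    qed
    have "pker (p' - 1) n (\<lambda>k. b' (\<sigma> k)) x \<longleftrightarrow> pker m n M x" for x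
    proof
      assume "pker m n M x"
      then have "pker p' n b' x" using dual(3) by simp
      then show "pker (p' - 1) n (\<lambda>k. b' (\<sigma> k)) x"
        using bij_betwE[OF \<sigma>] by (auto simp: pker_def S_def)
    next
      assume x: "pker (p' - 1) n (\<lambda>k. b' (\<sigma> k)) x"
      show "pker m n M x"
        unfolding pker_def
      proof (intro allI impI)
        fix i assume i: "i < m"
        have "(\<Sum>j<n. M i j * x j) = (\<Sum>j<n. (\<Sum>k<p' - 1. b' (\<sigma> k) j * L i (\<sigma> k)) * x j)"
          using factor[OF i] by (intro sum.cong) auto
        also have "\<dots> = (\<Sum>k<p' - 1. L i (\<sigma> k) * (\<Sum>j<n. b' (\<sigma> k) j * x j))"
          unfolding sum_distrib_left sum_distrib_right by (subst sum.swap) (simp add: ac_simps)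
        also have "\<dots> = 0" using x by (simp add: pker_def)
        finally show "(\<Sum>j<n. M i j * x j) = 0" .
      qed
    qed
    from rbasis_ker_cong[OF this] have "rbasis (p' - 1) n (\<lambda>k. b' (\<sigma> k)) p b e" using rb by blast
    then have "n \<le> p' - 1 + p" by (rule rbasis_card_ge)
    then show False using dual(1) l0 by simp
  qed
  show ?thesis
  proof (intro exI conjI allI impI)
    show "p + p' = n" "(\<Sum>l<p'. e' l) = (\<Sum>l<p. e l)" using dual by simp_all
    show "e' l \<le> d" if "l < p'" for l by (rule le[OF that])
    show "degree (b' l j) \<le> e' l" if "l < p'" "j < n" for l j using rb' that by (simp add: rbasis_def)
    show "degree (L i l) \<le> d - e' l" if "i < m" "l < p'" for i l
      using dL[OF that] le[OF that(2)] by (simp add: Suc_diff_le dlt_iff_degree)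
    show "M i j = (\<Sum>l<p'. L i l * b' l j)" if "i < m" "j < n" for i j
      using L[OF that] by (simp add: mult.commute)
  qed
qed

section \<open>Products with generic eigenstructure\<close>

lemma coeff_rev_poly: "coeff (rev_poly d f) k = (if k \<le> d then coeff f (d - k) else 0)"
proof -
  have "coeff (rev_poly d f) k = (\<Sum>i\<le>d. if d - i = k then coeff f i else 0)"
    by (simp add: rev_poly_def coeff_sum coeff_monom)
  also have "\<dots> = (\<Sum>i\<le>d. if i = d - k then (if k \<le> d then coeff f (d - k) else 0) else 0)"
    by (intro sum.cong) auto
  finally show ?thesis by (simp add: sum.delta)
qed

lemma poly_rev_poly:
  assumes "degree f \<le> d" "z \<noteq> 0"
  shows "poly (rev_poly d f) z = z ^ d * poly f (inverse z)"
proof -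
  have "poly f (inverse z) = (\<Sum>i\<le>d. coeff f i * inverse z ^ i)"
    unfolding poly_altdef using assms(1)
    by (intro sum.mono_neutral_left) (auto intro!: coeff_eq_0)
  then have "z ^ d * poly f (inverse z) = (\<Sum>i\<le>d. coeff f i * z ^ (d - i))"
    using assms(2) by (simp add: sum_distrib_left power_diff power_inverse field_simps)
  then show ?thesis by (simp add: rev_poly_def poly_sum poly_monom)
qed

lemma poly_rev_poly_0: "poly (rev_poly d f) 0 = coeff f d"
  by (simp add: poly_0_coeff_0 coeff_rev_poly)

lemma poly_eqI_nonzero:
  fixes f g :: "complex poly"
  assumes "\<And>z. z \<noteq> 0 \<Longrightarrow> poly f z = poly g z"
  shows "f = g"
proof -
  have "poly ([:0, 1:] * (f - g)) z = 0" for z using assms[of z] by (cases "z = 0") auto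
  then have "[:0, 1:] * (f - g) = 0" by (intro iffD1[OF poly_all_0_iff_0] allI)
  then show ?thesis by simp
qed

text \<open>Reversal is multiplicative if the grades of the factors add up to the grade of the
  product; it is checked at \<open>z \<noteq> 0\<close>, where reversing means \<open>z ^ d\<close>
  times the value at \<open>1 / z\<close>.\<close>

lemma rev_poly_sum_mult:
  fixes r :: nat
  assumes "\<And>l. l < r \<Longrightarrow> degree (f l) \<le> d - \<delta> l" "\<And>l. l < r \<Longrightarrow> degree (g l) \<le> \<delta> l"
    "\<And>l. l < r \<Longrightarrow> \<delta> l \<le> d"
  shows "rev_poly d (\<Sum>l<r. f l * g l) = (\<Sum>l<r. rev_poly (d - \<delta> l) (f l) * rev_poly (\<delta> l) (g l))"
proof (rule poly_eqI_nonzero)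
  fix z :: complex assume z: "z \<noteq> 0"
  have "degree (f l * g l) \<le> d" if "l < r" for l
    using degree_mult_le[of "f l" "g l"] assms[OF that] by linarith
  then have deg: "degree (\<Sum>l<r. f l * g l) \<le> d" by (intro degree_sum_le) auto
  have "poly (rev_poly d (\<Sum>l<r. f l * g l)) z = (\<Sum>l<r. z ^ d * (poly (f l) (inverse z) * poly (g l) (inverse z)))"
    by (simp add: poly_rev_poly[OF deg z] poly_sum sum_distrib_left)
  also have "\<dots> = (\<Sum>l<r. (z ^ (d - \<delta> l) * poly (f l) (inverse z)) * (z ^ \<delta> l * poly (g l) (inverse z)))"
  proof (intro sum.cong refl)
    fix l assume "l \<in> {..<r}"
    then have "z ^ d = z ^ (d - \<delta> l) * z ^ \<delta> l" using assms(3)[of l] by (simp flip: power_add)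
    then show "z ^ d * (poly (f l) (inverse z) * poly (g l) (inverse z)) =
        (z ^ (d - \<delta> l) * poly (f l) (inverse z)) * (z ^ \<delta> l * poly (g l) (inverse z))" by simp
  qed
  also have "\<dots> = poly (\<Sum>l<r. rev_poly (d - \<delta> l) (f l) * rev_poly (\<delta> l) (g l)) z"
    unfolding poly_sum poly_mult using assms z by (intro sum.cong refl) (simp add: poly_rev_poly)
  finally show "poly (rev_poly d (\<Sum>l<r. f l * g l)) z =
      poly (\<Sum>l<r. rev_poly (d - \<delta> l) (f l) * rev_poly (\<delta> l) (g l)) z" .
qed

text \<open>Away from 0 the reversed entries are the values at \<open>1 / z\<close> with row
  \<open>i\<close> scaled by \<open>z ^ \<delta> i\<close>; at 0 they are the leading
  coefficients.\<close>

lemma gen_pos_rev_eval_inj: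
  assumes deg: "\<And>i j. i < r \<Longrightarrow> j < n \<Longrightarrow> degree (R i j) \<le> \<delta> i" and gen: "gen_pos r n \<delta> \<alpha> R"
  shows "inj_mat {..<n} {..<r} (\<lambda>j i. poly (rev_poly (\<delta> i) (R i j)) z)"
proof (cases "z = 0")
  case True
  then show ?thesis using gen_pos_lead_inj[OF deg gen] by (simp add: poly_rev_poly_0)
next
  case False
  show ?thesis
    unfolding inj_mat_def
  proof (intro allI impI ballI)
    fix v i assume v: "\<forall>j\<in>{..<n}. (\<Sum>i<r. poly (rev_poly (\<delta> i) (R i j)) z * v i) = 0" and i: "i \<in> {..<r}"
    have "(\<Sum>i<r. poly (R i j) (inverse z) * (z ^ \<delta> i * v i)) = 0" if j: "j < n" for j
    proof -
      have "(\<Sum>i<r. poly (R i j) (inverse z) * (z ^ \<delta> i * v i)) =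
          (\<Sum>i<r. poly (rev_poly (\<delta> i) (R i j)) z * v i)"
        using deg j False by (intro sum.cong) (auto simp: poly_rev_poly)
      then show ?thesis using v j by simp
    qed
    then have "z ^ \<delta> i * v i = 0"
      using inj_matD[OF gen_pos_eval_inj[OF deg gen, of "inverse z"], of "\<lambda>i. z ^ \<delta> i * v i" i] i by simp
    then show "v i = 0" using False by simp
  qed
qed

lemma factorization_pker:
  assumes L: "L \<in> carrier_mat m r" and R: "R \<in> carrier_mat r n" and injL: "\<And>z. eval_inj m r L z"
  shows "pker m n (\<lambda>i j. (L * R) $$ (i, j)) x \<longleftrightarrow> pker r n (\<lambda>i j. R $$ (i, j)) x"
proof -
  define y where "y l = (\<Sum>j<n. R $$ (l, j) * x j)" for l
  have *: "(\<Sum>j<n. (L * R) $$ (i, j) * x j) = (\<Sum>l<r. L $$ (i, l) * y l)" if "i < m" for i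
  proof -
    have "(\<Sum>j<n. (L * R) $$ (i, j) * x j) = (\<Sum>j<n. (\<Sum>l<r. L $$ (i, l) * R $$ (l, j)) * x j)"
      using L R that by (intro sum.cong refl) (simp add: scalar_prod_def lessThan_atLeast0)
    also have "\<dots> = (\<Sum>l<r. L $$ (i, l) * y l)"
      unfolding y_def sum_distrib_left sum_distrib_right by (subst sum.swap) (simp add: mult.assoc)
    finally show ?thesis .
  qed
  show ?thesis
  proof
    assume "pker r n (\<lambda>i j. R $$ (i, j)) x"
    then have "y l = 0" if "l < r" for l using that by (simp add: y_def pker_def)
    then show "pker m n (\<lambda>i j. (L * R) $$ (i, j)) x" by (simp add: pker_def *)
  next
    assume "pker m n (\<lambda>i j. (L * R) $$ (i, j)) x"
    then have Ly: "(\<Sum>l<r. L $$ (i, l) * y l) = 0" if "i < m" for i using that by (simp add: pker_def *)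
    have "poly (y l) z = 0" if l: "l < r" for l z
    proof -
      have "(\<Sum>l<r. poly (L $$ (i, l)) z * poly (y l) z) = 0" if "i < m" for i
        using arg_cong[OF Ly[OF that], of "\<lambda>f. poly f z"] by (simp add: poly_sum)
      then show ?thesis
        using inj_matD[of "{..<m}" "{..<r}" "\<lambda>i l. poly (L $$ (i, l)) z" "\<lambda>l. poly (y l) z" l] injL[of z] l
        unfolding eval_inj_def by simp
    qed
    then have "y l = 0" if "l < r" for l using that by (simp flip: poly_all_0_iff_0)
    then show "pker r n (\<lambda>i j. R $$ (i, j)) x" by (simp add: pker_def y_def)
  qed
qed

text \<open>The kernel of \<open>L * R\<close> is that of \<open>R\<close>, and full row rank of
  \<open>R\<close> at the point 0 shows that its dimension is \<open>n - r\<close>.\<close>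

lemma factorization_normal_rank:
  assumes L: "L \<in> carrier_mat m r" and R: "R \<in> carrier_mat r n"
    and injL: "\<And>z. eval_inj m r L z" and injR: "\<And>z. eval_inj n r (R\<^sup>T) z"
  shows "normal_rank (L * R) = r"
proof -
  have LR: "L * R \<in> carrier_mat m n" using L R by simp
  obtain p b e where rb: "rbasis m n (\<lambda>i j. (L * R) $$ (i, j)) p b e" and p: "p + normal_rank (L * R) = n"
    using right_minimal_indices_rbasis[OF LR] by blast
  have rb': "rbasis r n (\<lambda>i j. R $$ (i, j)) p b e"
    using rb rbasis_ker_cong[OF factorization_pker[OF L R injL]] by blast
  have "inj_mat {..<n} {..<r} (\<lambda>j i. poly (R $$ (i, j)) 0)"
    using injR[of 0] R inj_mat_cong[of "{..<n}" "{..<r}" "\<lambda>j i. poly (R\<^sup>T $$ (j, i)) 0" "\<lambda>j i. poly (R $$ (i, j)) 0"]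
    unfolding eval_inj_def by simp
  then have "r + p \<le> n" by (rule rbasis_card_le[OF rb'])
  moreover have "n \<le> r + p" by (rule rbasis_card_ge[OF rb'])
  ultimately show ?thesis using p by simp
qed

section \<open>Pairs of factors with complementary degree bounds\<close>

definition mat_of_fun :: "nat \<Rightarrow> nat \<Rightarrow> (nat \<Rightarrow> nat \<Rightarrow> complex poly) \<Rightarrow> complex poly mat" where
  "mat_of_fun m n f = mat m n (\<lambda>(i, j). f i j)"

lemma mat_of_fun [simp]:
  "mat_of_fun m n f \<in> carrier_mat m n"
  "i < m \<Longrightarrow> j < n \<Longrightarrow> mat_of_fun m n f $$ (i, j) = f i j"
  "dim_row (mat_of_fun m n f) = m" "dim_col (mat_of_fun m n f) = n"
  by (simp_all add: mat_of_fun_def)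

lemma mat_of_fun_mult:
  assumes "i < m" "j < n"
  shows "(mat_of_fun m r L * mat_of_fun r n R) $$ (i, j) = (\<Sum>l<r. L i l * R l j)"
  using assms by (simp add: scalar_prod_def lessThan_atLeast0)

text \<open>The factors may have any rank within the degree bounds, so that factorizations of
  matrices of smaller rank, padded with zeros, are included.\<close>

locale factor_pair =
  fixes m n r d a :: nat and \<delta> :: "nat \<Rightarrow> nat" and L R :: "nat \<Rightarrow> nat \<Rightarrow> complex poly"
  assumes r: "0 < r" "r < m" "r < n"
    and \<delta>: "\<And>l. l < r \<Longrightarrow> \<delta> l \<le> d" and a: "a = (\<Sum>l<r. \<delta> l)"
    and degL: "\<And>i l. i < m \<Longrightarrow> l < r \<Longrightarrow> degree (L i l) \<le> d - \<delta> l"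
    and degR: "\<And>l j. l < r \<Longrightarrow> j < n \<Longrightarrow> degree (R l j) \<le> \<delta> l"
begin

definition P where "P = mat_of_fun m r L * mat_of_fun r n R"

lemma P_carrier: "P \<in> carrier_mat m n"
  unfolding P_def by (rule mult_carrier_mat[of _ m r _ n]) simp_all

lemma P_index: "i < m \<Longrightarrow> j < n \<Longrightarrow> P $$ (i, j) = (\<Sum>l<r. L i l * R l j)"
  unfolding P_def by (rule mat_of_fun_mult)

lemma P_POL: "P \<in> POL d m n"
proof -
  have "degree (L i l * R l j) \<le> d" if "i < m" "j < n" "l < r" for i j l
    using degree_mult_le[of "L i l" "R l j"] degL[OF that(1,3)] degR[OF that(3,2)] \<delta>[OF that(3)] by linarith
  then have "degree (P $$ (i, j)) \<le> d" if "i < m" "j < n" for i j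
    unfolding P_index[OF that] using that by (intro degree_sum_le) auto
  then show ?thesis using P_carrier by (simp add: POL_def)
qed

lemma sum_codegree: "(\<Sum>l<r. d - \<delta> l) = r * d - a"
  using sum_diff_large[of r \<delta> d, OF \<delta>] unfolding a by linarith

lemma a_le: "a \<le> r * d"
  unfolding a using sum_bounded_above[of "{..<r}" \<delta> d] \<delta> by simp

end

locale generic_factor_pair = factor_pair +
  assumes genR: "gen_pos r n \<delta> (a div (n - r)) R"
    and genL: "gen_pos r m (\<lambda>l. d - \<delta> l) ((r * d - a) div (m - r)) (\<lambda>l i. L i l)"
begin

lemma injL: "eval_inj m r (mat_of_fun m r L) z"
proof -
  have "inj_mat {..<m} {..<r} (\<lambda>i l. poly (L i l) z)"
    by (rule gen_pos_eval_inj[OF _ genL]) (rule degL)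
  then show ?thesis
    unfolding eval_inj_def by (subst inj_mat_cong[where B = "\<lambda>i l. poly (L i l) z"]) auto
qed

lemma injR: "eval_inj n r ((mat_of_fun r n R)\<^sup>T) z"
  unfolding eval_inj_def using gen_pos_eval_inj[OF degR genR, of z]
  by (subst inj_mat_cong[where B = "\<lambda>j l. poly (R l j) z"]) auto

definition L' where "L' = mat_of_fun m r (\<lambda>i l. rev_poly (d - \<delta> l) (L i l))"
definition R' where "R' = mat_of_fun r n (\<lambda>l j. rev_poly (\<delta> l) (R l j))"

lemma injL': "eval_inj m r L' z"
proof -
  have "inj_mat {..<m} {..<r} (\<lambda>i l. poly (rev_poly (d - \<delta> l) (L i l)) z)"
    by (rule gen_pos_rev_eval_inj[OF _ genL]) (rule degL)
  then show ?thesis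
    unfolding eval_inj_def L'_def
    by (subst inj_mat_cong[where B = "\<lambda>i l. poly (rev_poly (d - \<delta> l) (L i l)) z"]) auto
qed

lemma injR': "eval_inj n r (R'\<^sup>T) z"
  unfolding eval_inj_def R'_def using gen_pos_rev_eval_inj[OF degR genR, of z]
  by (subst inj_mat_cong[where B = "\<lambda>j l. poly (rev_poly (\<delta> l) (R l j)) z"]) auto

lemma rev_P: "rev_mat d P = L' * R'"
proof (rule eq_matI)
  fix i j assume "i < dim_row (L' * R')" "j < dim_col (L' * R')"
  then have ij: "i < m" "j < n" by (auto simp: L'_def R'_def)
  have "rev_mat d P $$ (i, j) = rev_poly d (\<Sum>l<r. L i l * R l j)"
    using ij P_carrier by (simp add: rev_mat_def P_index)
  also have "\<dots> = (\<Sum>l<r. rev_poly (d - \<delta> l) (L i l) * rev_poly (\<delta> l) (R l j))"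
    by (rule rev_poly_sum_mult) (use ij degL degR \<delta> in auto)
  also have "\<dots> = (L' * R') $$ (i, j)" unfolding L'_def R'_def mat_of_fun_mult[OF ij] ..
  finally show "rev_mat d P $$ (i, j) = (L' * R') $$ (i, j)" .
qed (use P_carrier in \<open>auto simp: rev_mat_def L'_def R'_def\<close>)

lemma rank: "normal_rank P = r"
  unfolding P_def by (rule factorization_normal_rank[OF _ _ injL injR]) simp_all

lemma finite_div: "elementary_divisors P z = {#}"
  unfolding P_def
  by (rule full_rank_factorization_elementary_divisors[OF _ _ injL injR rank[unfolded P_def]]) simp_all

lemma infinite_div: "elementary_divisors (rev_mat d P) z = {#}"
proof -
  have c: "L' \<in> carrier_mat m r" "R' \<in> carrier_mat r n" by (simp_all add: L'_def R'_def)
  show ?thesis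
    unfolding rev_P by (rule full_rank_factorization_elementary_divisors[OF c injL' injR'
      factorization_normal_rank[OF c injL' injR']])
qed

lemma right: "right_minimal_indices P =
  replicate (a mod (n - r)) (a div (n - r) + 1) @ replicate (n - r - a mod (n - r)) (a div (n - r))"
proof -
  obtain p b e where rb: "rbasis m n (\<lambda>i j. P $$ (i, j)) p b e"
    and eq: "right_minimal_indices P = rev (sort (map e [0..<p]))"
    using right_minimal_indices_rbasis[OF P_carrier] by blast
  have "pker m n (\<lambda>i j. P $$ (i, j)) x \<longleftrightarrow> pker r n R x" for x
  proof -
    have "pker m n (\<lambda>i j. P $$ (i, j)) x \<longleftrightarrow> pker r n (\<lambda>i j. mat_of_fun r n R $$ (i, j)) x"
      unfolding P_def by (rule factorization_pker[OF _ _ injL]) simp_all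
    then show ?thesis by (simp add: pker_def)
  qed
  from rbasis_ker_cong[OF this] have rb': "rbasis r n R p b e" using rb by blast
  show ?thesis unfolding eq by (rule gen_pos_indices(2)[OF rb' degR r(3) a refl genR])
qed

end

text \<open>Transposing the product exchanges the factors and turns the degree bound
  \<open>\<delta> l\<close> into \<open>d - \<delta> l\<close>; doing so twice is the identity
  because \<open>\<delta> l \<le> d\<close>.\<close>

lemma generic_factor_pair_swap:
  assumes "generic_factor_pair m n r d a \<delta> L R"
  shows "generic_factor_pair n m r d (r * d - a) (\<lambda>l. d - \<delta> l) (\<lambda>i l. R l i) (\<lambda>l i. L i l)"
proof -
  interpret generic_factor_pair m n r d a \<delta> L R by fact
  have dd: "d - (d - \<delta> l) = \<delta> l" if "l < r" for l using \<delta>[OF that] by simp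
  have "rows_idx (\<lambda>l. d - (d - \<delta> l)) r K = rows_idx \<delta> r K" for K
    by (intro Sigma_cong refl) (simp only: dd lessThan_iff)
  then have gen: "gen_pos r n (\<lambda>l. d - (d - \<delta> l)) \<alpha> R \<longleftrightarrow> gen_pos r n \<delta> \<alpha> R" for \<alpha>
    by (simp only: gen_pos_def)
  show ?thesis
  proof unfold_locales
    show "gen_pos r n (\<lambda>l. d - (d - \<delta> l)) ((r * d - (r * d - a)) div (n - r)) (\<lambda>l i. R l i)"
      using genR a_le unfolding gen by simp
    show "gen_pos r m (\<lambda>l. d - \<delta> l) ((r * d - a) div (m - r)) (\<lambda>l i. L i l)" by (rule genL)
  qed (use r degL degR dd sum_codegree in auto)
qed

context generic_factor_pair
begin

lemma left: "left_minimal_indices P =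
  replicate ((r * d - a) mod (m - r)) ((r * d - a) div (m - r) + 1) @
  replicate (m - r - (r * d - a) mod (m - r)) ((r * d - a) div (m - r))"
proof -
  interpret swap: generic_factor_pair n m r d "r * d - a" "\<lambda>l. d - \<delta> l" "\<lambda>i l. R l i" "\<lambda>l i. L i l"
    by (rule generic_factor_pair_swap) (rule generic_factor_pair_axioms)
  have "P\<^sup>T = swap.P"
    by (rule eq_matI) (use P_carrier swap.P_carrier in \<open>auto simp: P_index swap.P_index mult.commute\<close>)
  then show ?thesis unfolding left_minimal_indices_transpose using swap.right by simp
qed

text \<open>The coefficient matrix of \<open>\<lambda>^d\<close> is the value of the reversal at 0,
  a product of a matrix with independent columns and one with independent rows. It is nonzero
  because \<open>r > 0\<close>.\<close>

lemma degree_eq: "mat_degree P = d"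
proof -
  have "\<exists>i<m. \<exists>j<n. coeff (P $$ (i, j)) d \<noteq> 0"
  proof (rule ccontr)
    assume "\<not> ?thesis"
    then have zero: "coeff (P $$ (i, j)) d = 0" if "i < m" "j < n" for i j using that by blast
    have c: "L' \<in> carrier_mat m r" "R' \<in> carrier_mat r n" by (simp_all add: L'_def R'_def)
    have L0: "poly (L' $$ (i, l)) 0 = 0" if i: "i < m" and l: "l < r" for i l
    proof -
      have "(\<Sum>l<r. poly (R'\<^sup>T $$ (j, l)) 0 * poly (L' $$ (i, l)) 0) = 0" if j: "j < n" for j
      proof -
        have "(\<Sum>l<r. poly (R'\<^sup>T $$ (j, l)) 0 * poly (L' $$ (i, l)) 0) = poly ((L' * R') $$ (i, j)) 0"
          unfolding poly_index_mult[OF c i j] using c j by (intro sum.cong) (auto simp: mult.commute)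
        also have "\<dots> = coeff (P $$ (i, j)) d"
          unfolding rev_P[symmetric] using i j P_carrier by (simp add: rev_mat_def poly_rev_poly_0)
        finally show ?thesis using zero[OF i j] by simp
      qed
      then show ?thesis
        using inj_matD[of "{..<n}" "{..<r}" "\<lambda>j l. poly (R'\<^sup>T $$ (j, l)) 0" "\<lambda>l. poly (L' $$ (i, l)) 0" l]
          injR'[of 0] l unfolding eval_inj_def by simp
    qed
    have "(1 :: complex) = 0"
      using inj_matD[of "{..<m}" "{..<r}" "\<lambda>i l. poly (L' $$ (i, l)) 0" "\<lambda>_. 1" 0]
        injL'[of 0] r L0 unfolding eval_inj_def by simp
    then show False by simp
  qed
  then obtain i j where ij: "i < m" "j < n" "coeff (P $$ (i, j)) d \<noteq> 0" by blast
  then have deg: "degree (P $$ (i, j)) = d"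
    using P_POL by (auto simp: POL_def intro!: antisym le_degree)
  have fin: "finite (elements_mat P)" by (rule finite_subset[of _ "(\<lambda>(i, j). P $$ (i, j)) ` ({..<m} \<times> {..<n})"])
      (use P_carrier in \<open>auto simp: elements_mat_def\<close>)
  have "P $$ (i, j) \<in> elements_mat P" by (rule elements_matI[OF P_carrier ij(1,2) refl])
  then have "d \<le> mat_degree P" unfolding mat_degree_def using fin deg by (intro Max_ge) auto
  moreover have "mat_degree P \<le> d"
    unfolding mat_degree_def using fin P_POL by (auto simp: POL_def elements_mat_def)
  ultimately show ?thesis by simp
qed

lemma generic: "is_generic m n r d a P"
  unfolding is_generic_def complete_eigenstructure_def generic_eigenstructure_def Let_def
  using P_POL degree_eq rank finite_div infinite_div right left by (simp add: fun_eq_iff)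

end

section \<open>Closures of orbits\<close>

lemma norm_coeff_le_POL_dist:
  assumes "i \<le> d" "k < m" "l < n"
  shows "cmod (coeff (P $$ (k, l)) i - coeff (Q $$ (k, l)) i) \<le> POL_dist d m n P Q"
  unfolding POL_dist_L2_set
  using member_le_L2_set[of "{..d} \<times> {..<m} \<times> {..<n}" "(i, k, l)"
      "\<lambda>(i, k, l). cmod (coeff (P $$ (k, l)) i - coeff (Q $$ (k, l)) i)"] assms by simp

lemma tendsto_POL_dist:
  assumes "\<And>i k l. k < m \<Longrightarrow> l < n \<Longrightarrow> ((\<lambda>t. coeff (Pt t $$ (k, l)) i) \<longlongrightarrow> coeff (P $$ (k, l)) i) F"
  shows "((\<lambda>t. POL_dist d m n P (Pt t)) \<longlongrightarrow> 0) F"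
proof -
  have "((\<lambda>t. case x of (i, k, l) \<Rightarrow> cmod (coeff (P $$ (k, l)) i - coeff (Pt t $$ (k, l)) i)) \<longlongrightarrow> 0) F"
    if "x \<in> {..d} \<times> {..<m} \<times> {..<n}" for x
  proof -
    obtain i k l where "x = (i, k, l)" by (cases x)
    with that have x: "x = (i, k, l)" "k < m" "l < n" by simp_all
    have "((\<lambda>t. cmod (coeff (P $$ (k, l)) i - coeff (Pt t $$ (k, l)) i)) \<longlongrightarrow>
        cmod (coeff (P $$ (k, l)) i - coeff (P $$ (k, l)) i)) F"
      by (intro tendsto_intros assms x)
    then show ?thesis using x by simp
  qed
  then have "((\<lambda>t. POL_dist d m n P (Pt t)) \<longlongrightarrow> sqrt (\<Sum>x\<in>{..d} \<times> {..<m} \<times> {..<n}. 0\<^sup>2)) F"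
    unfolding POL_dist_L2_set L2_set_def
    by (intro tendsto_real_sqrt tendsto_sum tendsto_power) auto
  then show ?thesis by simp
qed

lemma POL_closure_of:
  "POL_topology d m n closure_of S = {P \<in> POL d m n. \<forall>e>0. \<exists>Q\<in>S. Q \<in> POL d m n \<and> POL_dist d m n P Q < e}"
proof -
  interpret Metric_space "POL d m n" "POL_dist d m n" by (rule Metric_space_POL)
  show ?thesis unfolding metric_closure_of by auto
qed

lemma topspace_POL: "topspace (POL_topology d m n) = POL d m n"
proof -
  interpret Metric_space "POL d m n" "POL_dist d m n" by (rule Metric_space_POL)
  show ?thesis by simp
qed

lemma POL_closure_sequence:
  assumes P: "P \<in> POL_topology d m n closure_of S"
  shows "\<exists>Pt. (\<forall>t :: nat. Pt t \<in> S \<and> Pt t \<in> POL d m n) \<and>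
    (\<forall>k<m. \<forall>l<n. \<forall>i. (\<lambda>t. coeff (Pt t $$ (k, l)) i) \<longlonglongrightarrow> coeff (P $$ (k, l)) i)"
proof -
  have "\<forall>t. \<exists>Q. Q \<in> S \<and> Q \<in> POL d m n \<and> POL_dist d m n P Q < inverse (real (Suc t))"
  proof
    fix t
    have "inverse (real (Suc t)) > 0" by simp
    then show "\<exists>Q. Q \<in> S \<and> Q \<in> POL d m n \<and> POL_dist d m n P Q < inverse (real (Suc t))"
      using P unfolding POL_closure_of by blast
  qed
  from choice[OF this] obtain Pt where Pt: "\<And>t. Pt t \<in> S" "\<And>t. Pt t \<in> POL d m n"
    "\<And>t. POL_dist d m n P (Pt t) < inverse (real (Suc t))" by blast
  have "(\<lambda>t. coeff (Pt t $$ (k, l)) i) \<longlonglongrightarrow> coeff (P $$ (k, l)) i" if kl: "k < m" "l < n" for k l i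
  proof (cases "i \<le> d")
    case True
    show ?thesis
    proof (rule Lim_transform_bound[where g = "\<lambda>t. inverse (real (Suc t))", THEN LIM_zero_cancel])
      show "\<forall>\<^sub>F t in sequentially. norm (coeff (Pt t $$ (k, l)) i - coeff (P $$ (k, l)) i)
          \<le> norm (inverse (real (Suc t)))"
      proof (intro always_eventually allI)
        fix t
        show "norm (coeff (Pt t $$ (k, l)) i - coeff (P $$ (k, l)) i) \<le> norm (inverse (real (Suc t)))"
          using norm_coeff_le_POL_dist[OF True kl, of P "Pt t"] Pt(3)[of t]
          by (simp add: norm_minus_commute)
      qed
    qed (rule LIMSEQ_inverse_real_of_nat)
  next
    case False
    have "coeff (Q $$ (k, l)) i = 0" if "Q \<in> POL d m n" for Q
    proof (rule coeff_eq_0)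
      have "degree (Q $$ (k, l)) \<le> d" using that kl by (simp add: POL_def)
      then show "degree (Q $$ (k, l)) < i" using False by simp
    qed
    moreover have "P \<in> POL d m n" using P unfolding POL_closure_of by blast
    ultimately show ?thesis using Pt(2) by simp
  qed
  then show ?thesis using Pt by blast
qed

lemma eventually_at_not_in_finite:
  fixes S :: "complex set"
  assumes "finite S"
  shows "\<forall>\<^sub>F t in at x. t \<notin> S"
proof -
  have "\<forall>\<^sub>F t in at x. t \<in> - (S - {x})"
  proof (rule eventually_at_in_open')
    show "open (- (S - {x}))" using assms by (intro open_Compl finite_imp_closed) simp
  qed simp
  then show ?thesis using eventually_neq_at_within[of x x UNIV] by eventually_elim auto
qed

text \<open>Both factors are moved along lines in the direction of examples in general position with
  the same degree bounds. All but finitely many parameters \<open>t\<close> give a generic product,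
  and 0 is a limit of such parameters.\<close>

lemma (in factor_pair) in_closure_generic:
  "P \<in> POL_topology d m n closure_of {Q. is_generic m n r d a Q}"
proof -
  obtain R0 where R0: "\<forall>l<r. \<forall>j<n. degree (R0 l j) \<le> \<delta> l" "gen_pos r n \<delta> (a div (n - r)) R0"
    using gen_pos_exists[OF r(1,3) a refl] by blast
  obtain L0 where L0: "\<forall>l<r. \<forall>i<m. degree (L0 l i) \<le> d - \<delta> l"
    "gen_pos r m (\<lambda>l. d - \<delta> l) ((r * d - a) div (m - r)) L0"
    using gen_pos_exists[OF r(1,2) sum_codegree[symmetric] refl] by blast
  define Lt where "Lt t i l = L i l + [:t:] * L0 l i" for t i l
  define Rt where "Rt t l j = R l j + [:t:] * R0 l j" for t l j
  define Pt where "Pt t = mat_of_fun m r (Lt t) * mat_of_fun r n (Rt t)" for t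
  define bad where "bad = {t. \<not> gen_pos r n \<delta> (a div (n - r)) (\<lambda>l j. R l j + [:t:] * R0 l j)} \<union>
    {t. \<not> gen_pos r m (\<lambda>l. d - \<delta> l) ((r * d - a) div (m - r)) (\<lambda>l i. L i l + [:t:] * L0 l i)}"
  have "finite bad" unfolding bad_def
    using gen_pos_perturb[OF R0(2), of R] gen_pos_perturb[OF L0(2), of "\<lambda>l i. L i l"] by simp
  then have ev: "\<forall>\<^sub>F t in at 0. t \<notin> bad" by (rule eventually_at_not_in_finite)
  have gen: "is_generic m n r d a (Pt t)" if "t \<notin> bad" for t
  proof -
    interpret gp: generic_factor_pair m n r d a \<delta> "Lt t" "Rt t"
    proof unfold_locales
      show "gen_pos r n \<delta> (a div (n - r)) (Rt t)"
        using that unfolding bad_def Rt_def by blast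
      show "gen_pos r m (\<lambda>l. d - \<delta> l) ((r * d - a) div (m - r)) (\<lambda>l i. Lt t i l)"
        using that unfolding bad_def Lt_def by blast
      show "degree (Lt t i l) \<le> d - \<delta> l" if "i < m" "l < r" for i l
        unfolding Lt_def using that degL L0(1)
        by (intro degree_add_le) (auto intro: order_trans[OF degree_smult_le])
      show "degree (Rt t l j) \<le> \<delta> l" if "l < r" "j < n" for l j
        unfolding Rt_def using that degR R0(1)
        by (intro degree_add_le) (auto intro: order_trans[OF degree_smult_le])
    qed (use r \<delta> a in auto)
    show ?thesis using gp.generic unfolding gp.P_def Pt_def .
  qed
  have lim: "((\<lambda>t. coeff (Pt t $$ (k, l)) i) \<longlongrightarrow> coeff (P $$ (k, l)) i) (at 0)" if kl: "k < m" "l < n" for i k l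
  proof -
    \<comment> \<open>Each coefficient of the product is a quadratic polynomial in \<open>t\<close>,
      with the coefficient of \<open>P\<close> as its constant term.\<close>
    have expand: "coeff (Pt t $$ (k, l)) i = coeff (\<Sum>j<r. L k j * R j l) i +
        t * coeff (\<Sum>j<r. L k j * R0 j l + L0 j k * R j l) i + t * t * coeff (\<Sum>j<r. L0 j k * R0 j l) i" for t
    proof -
      have "Pt t $$ (k, l) = (\<Sum>j<r. Lt t k j * Rt t j l)"
        unfolding Pt_def by (rule mat_of_fun_mult[OF kl])
      also have "\<dots> = (\<Sum>j<r. L k j * R j l + smult t (L k j * R0 j l + L0 j k * R j l) +
          smult (t * t) (L0 j k * R0 j l))"
        by (intro sum.cong refl) (simp add: Lt_def Rt_def algebra_simps smult_add_right)
      finally show ?thesis by (simp add: sum.distrib coeff_sum sum_distrib_left distrib_left)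
    qed
    have "((\<lambda>t. coeff (Pt t $$ (k, l)) i) \<longlongrightarrow> coeff (\<Sum>j<r. L k j * R j l) i +
        0 * coeff (\<Sum>j<r. L k j * R0 j l + L0 j k * R j l) i + 0 * 0 * coeff (\<Sum>j<r. L0 j k * R0 j l) i) (at 0)"
      unfolding expand by (intro tendsto_intros)
    then show ?thesis using P_index[OF kl] by simp
  qed
  have dist: "((\<lambda>t. POL_dist d m n P (Pt t)) \<longlongrightarrow> 0) (at 0)" by (rule tendsto_POL_dist) (rule lim)
  show ?thesis
    unfolding POL_closure_of
  proof (intro CollectI conjI allI impI P_POL)
    fix e :: real assume "e > 0"
    then have "\<forall>\<^sub>F t in at 0. POL_dist d m n P (Pt t) < e" using dist by (auto dest: order_tendstoD(2))
    with ev have "\<forall>\<^sub>F t in at 0. t \<notin> bad \<and> POL_dist d m n P (Pt t) < e" by (rule eventually_conj)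
    then obtain t where t: "t \<notin> bad" "POL_dist d m n P (Pt t) < e"
      using eventually_happens[of _ "at (0 :: complex)"] by auto
    have "Pt t \<in> POL d m n" using gen[OF t(1)] by (simp add: is_generic_def)
    then show "\<exists>Q\<in>{Q. is_generic m n r d a Q}. Q \<in> POL d m n \<and> POL_dist d m n P Q < e"
      using gen[OF t(1)] t(2) by blast
  qed
qed

lemma ex_bounded_composition:
  fixes d r a :: nat
  assumes "a \<le> r * d"
  shows "\<exists>\<delta>. (\<forall>l<r. \<delta> l \<le> d) \<and> a = (\<Sum>l<r. \<delta> l)"
  using assms
proof (induction r arbitrary: a)
  case (Suc r)
  have "a - min a d \<le> r * d" 
    using Suc.prems by (cases "a \<le> d") (simp_all add: min_def le_diff_conv ac_simps)
  then obtain \<delta> where \<delta>: "\<forall>l<r. \<delta> l \<le> d" "a - min a d = (\<Sum>l<r. \<delta> l)" using Suc.IH by blast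
  have "(\<Sum>l<r. (\<delta>(r := min a d)) l) = (\<Sum>l<r. \<delta> l)" by (intro sum.cong) auto
  then show ?case using \<delta> by (intro exI[of _ "\<delta>(r := min a d)"]) (auto simp: less_Suc_eq)
qed auto

text \<open>The zero polynomial, as the product of zero factors with any degree bounds of sum
  \<open>a\<close>, is a limit of generic ones; so there are some.\<close>

lemma generic_exists:
  assumes r: "0 < r" "r < m" "r < n" and a: "a \<le> r * d"
  shows "\<exists>P. is_generic m n r d a P"
proof -
  obtain \<delta> where \<delta>: "\<forall>l<r. \<delta> l \<le> d" "a = (\<Sum>l<r. \<delta> l)" using ex_bounded_composition[OF a] by blast
  interpret factor_pair m n r d a \<delta> "\<lambda>_ _. 0" "\<lambda>_ _. 0"
    by unfold_locales (use r \<delta> in auto)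
  have "\<exists>Q\<in>{Q. is_generic m n r d a Q}. Q \<in> POL d m n \<and> POL_dist d m n P Q < 1"
    using in_closure_generic unfolding POL_closure_of by (simp only: mem_Collect_eq zero_less_one)
  then show ?thesis by blast
qed

lemma sum_list_map_rev_sort:
  fixes f :: "nat \<Rightarrow> nat"
  shows "sum_list (map f (rev (sort (map e [0..<p])))) = (\<Sum>l<p. f (e l))"
proof -
  have "sum_list (map f (rev (sort (map e [0..<p])))) = sum_list (map f (map e [0..<p]))"
    unfolding sum_mset_sum_list[symmetric] by (simp add: multiset.map_comp)
  then show ?thesis by (simp add: interv_sum_list_conv_sum_set_nat lessThan_atLeast0 o_def)
qed

lemma in_closure_generic:
  assumes r: "0 < r" "r < m" "r < n" and M: "M \<in> POL d m n" and rank: "normal_rank M \<le> r"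
    and a: "a = sum_list (right_minimal_indices M)"
  shows "a \<le> r * d" "M \<in> POL_topology d m n closure_of {Q. is_generic m n r d a Q}"
proof -
  have Mc: "M \<in> carrier_mat m n" and degM: "\<And>i j. i < m \<Longrightarrow> j < n \<Longrightarrow> degree (M $$ (i, j)) \<le> d"
    using M by (auto simp: POL_def)
  obtain p b e where rb: "rbasis m n (\<lambda>i j. M $$ (i, j)) p b e"
    and eq: "right_minimal_indices M = rev (sort (map e [0..<p]))" and p: "p + normal_rank M = n"
    using right_minimal_indices_rbasis[OF Mc] by blast
  have ae: "a = (\<Sum>l<p. e l)"
    unfolding a eq using sum_list_map_rev_sort[of "\<lambda>x. x" e p] by simp
  obtain \<rho> \<delta> L R where f: "p + \<rho> = n" "(\<Sum>l<\<rho>. \<delta> l) = (\<Sum>l<p. e l)" "\<forall>l<\<rho>. \<delta> l \<le> d"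
    "\<forall>l<\<rho>. \<forall>j<n. degree (R l j) \<le> \<delta> l" "\<forall>i<m. \<forall>l<\<rho>. degree (L i l) \<le> d - \<delta> l"
    "\<forall>i<m. \<forall>j<n. M $$ (i, j) = (\<Sum>l<\<rho>. L i l * R l j)"
    using rbasis_factorization[OF rb degM] by blast
  have \<rho>: "\<rho> \<le> r" using p f(1) rank by simp
  \<comment> \<open>The added rows of \<open>R\<close> get degree bound 0, which keeps the sum equal
    to \<open>a\<close>. The matching columns of \<open>L\<close> get the bound \<open>d\<close>,
    which leaves room for the perturbation.\<close>
  define \<delta>' where "\<delta>' l = (if l < \<rho> then \<delta> l else 0)" for l
  define L' where "L' i l = (if l < \<rho> then L i l else 0)" for i l
  define R' where "R' l j = (if l < \<rho> then R l j else 0)" for l j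
  have sum: "(\<Sum>l<r. \<delta>' l) = (\<Sum>l<\<rho>. \<delta> l)"
    using \<rho> by (intro sum.mono_neutral_cong_right) (auto simp: \<delta>'_def)
  interpret factor_pair m n r d a \<delta>' L' R'
    by unfold_locales (use r f sum ae in \<open>auto simp: \<delta>'_def L'_def R'_def\<close>)
  have "M = P"
  proof (rule eq_matI)
    fix i j assume "i < dim_row P" "j < dim_col P"
    then have ij: "i < m" "j < n" using P_carrier by auto
    have "(\<Sum>l<r. L' i l * R' l j) = (\<Sum>l<\<rho>. L i l * R l j)"
      using \<rho> by (intro sum.mono_neutral_cong_right) (auto simp: L'_def R'_def)
    then show "M $$ (i, j) = P $$ (i, j)" using f(6) ij by (simp add: P_index)
  qed (use Mc P_carrier in auto)
  then show "M \<in> POL_topology d m n closure_of {Q. is_generic m n r d a Q}"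
    using in_closure_generic by simp
  show "a \<le> r * d" by (rule a_le)
qed

section \<open>Invariants of limits of orbits\<close>

text \<open>The dimension of the space of vectors of degree below \<open>K\<close> in a space with minimal indices \<open>xs\<close>.\<close>

definition syzygy_dim :: "nat \<Rightarrow> nat list \<Rightarrow> nat" where
  "syzygy_dim K xs = sum_list (map (\<lambda>e. K - e) xs)"

lemma syzygy_dim_rev_sort: "syzygy_dim K (rev (sort (map e [0..<p]))) = (\<Sum>l<p. K - e l)"
  unfolding syzygy_dim_def by (rule sum_list_map_rev_sort)

lemma syzygy_dim_semicontinuous:
  assumes M: "M \<in> carrier_mat m n" and Mt: "\<And>t. Mt t \<in> carrier_mat m n"
    and lim: "\<And>i j s. i < m \<Longrightarrow> j < n \<Longrightarrow> (\<lambda>t :: nat. coeff (Mt t $$ (i, j)) s) \<longlonglongrightarrow> coeff (M $$ (i, j)) s"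
    and deg: "\<And>i j. i < m \<Longrightarrow> j < n \<Longrightarrow> degree (M $$ (i, j)) \<le> d"
    and const: "\<And>t. right_minimal_indices (Mt t) = xs"
  shows "syzygy_dim K xs \<le> syzygy_dim K (right_minimal_indices M)"
proof -
  obtain p b e where rb: "rbasis m n (\<lambda>i j. M $$ (i, j)) p b e"
    and eq: "right_minimal_indices M = rev (sort (map e [0..<p]))"
    using right_minimal_indices_rbasis[OF M] by blast
  have "\<forall>t. \<exists>x. rbasis m n (\<lambda>i j. Mt t $$ (i, j)) (fst x) (fst (snd x)) (snd (snd x)) \<and>
      right_minimal_indices (Mt t) = rev (sort (map (snd (snd x)) [0..<fst x]))"
  proof
    fix t
    obtain p b e where "rbasis m n (\<lambda>i j. Mt t $$ (i, j)) p b e"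
      "right_minimal_indices (Mt t) = rev (sort (map e [0..<p]))"
      using right_minimal_indices_rbasis[OF Mt] by blast
    then show "\<exists>x. rbasis m n (\<lambda>i j. Mt t $$ (i, j)) (fst x) (fst (snd x)) (snd (snd x)) \<and>
      right_minimal_indices (Mt t) = rev (sort (map (snd (snd x)) [0..<fst x]))"
      by (intro exI[of _ "(p, b, e)"]) simp
  qed
  from choice[OF this] obtain f where
    rbt: "\<And>t. rbasis m n (\<lambda>i j. Mt t $$ (i, j)) (fst (f t)) (fst (snd (f t))) (snd (snd (f t)))" and
    eqt: "\<And>t. right_minimal_indices (Mt t) = rev (sort (map (snd (snd (f t))) [0..<fst (f t)]))" by blast
  have "\<forall>\<^sub>F t in sequentially. (\<Sum>l<fst (f t). K - snd (snd (f t)) l) \<le> (\<Sum>l<p. K - e l)"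
    by (rule rbasis_semicontinuous[OF rb rbt]) (use deg lim in auto)
  then obtain t where "(\<Sum>l<fst (f t). K - snd (snd (f t)) l) \<le> (\<Sum>l<p. K - e l)"
    using eventually_happens'[OF sequentially_bot] by blast
  then have "syzygy_dim K (right_minimal_indices (Mt t)) \<le> syzygy_dim K (right_minimal_indices M)"
    unfolding eq eqt syzygy_dim_rev_sort .
  then show ?thesis by (simp only: const)
qed

lemma closure_syzygy_dim:
  assumes M: "M \<in> POL_topology d m n closure_of S"
  shows "(\<And>Q. Q \<in> S \<Longrightarrow> right_minimal_indices Q = xs) \<Longrightarrow>
      syzygy_dim K xs \<le> syzygy_dim K (right_minimal_indices M)"
    and "(\<And>Q. Q \<in> S \<Longrightarrow> left_minimal_indices Q = xs) \<Longrightarrow>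
      syzygy_dim K xs \<le> syzygy_dim K (left_minimal_indices M)"
proof -
  from POL_closure_sequence[OF M] obtain Mt where
    seq: "(\<forall>t :: nat. Mt t \<in> S \<and> Mt t \<in> POL d m n) \<and>
      (\<forall>k<m. \<forall>l<n. \<forall>i. (\<lambda>t. coeff (Mt t $$ (k, l)) i) \<longlonglongrightarrow> coeff (M $$ (k, l)) i)" ..
  then have Mt: "\<And>t. Mt t \<in> S" "\<And>t. Mt t \<in> POL d m n" and
    lim: "\<And>k l i. k < m \<Longrightarrow> l < n \<Longrightarrow> (\<lambda>t. coeff (Mt t $$ (k, l)) i) \<longlonglongrightarrow> coeff (M $$ (k, l)) i"
    by simp_all
  have "M \<in> POL d m n" using M unfolding POL_closure_of by blast
  then have Mc: "M \<in> carrier_mat m n" and deg: "\<And>i j. i < m \<Longrightarrow> j < n \<Longrightarrow> degree (M $$ (i, j)) \<le> d"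
    by (auto simp: POL_def)
  have Mtc: "Mt t \<in> carrier_mat m n" for t using Mt(2)[of t] by (simp add: POL_def)
  show "syzygy_dim K xs \<le> syzygy_dim K (right_minimal_indices M)"
    if "\<And>Q. Q \<in> S \<Longrightarrow> right_minimal_indices Q = xs"
    by (rule syzygy_dim_semicontinuous[OF Mc Mtc lim deg that[OF Mt(1)]])
  show "syzygy_dim K xs \<le> syzygy_dim K (left_minimal_indices M)"
    if xs: "\<And>Q. Q \<in> S \<Longrightarrow> left_minimal_indices Q = xs"
    unfolding left_minimal_indices_transpose
  proof (rule syzygy_dim_semicontinuous[where Mt = "\<lambda>t. (Mt t)\<^sup>T" and d = d])
    show "M\<^sup>T \<in> carrier_mat n m" "(Mt t)\<^sup>T \<in> carrier_mat n m" for t using Mc Mtc by auto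
    show "(\<lambda>t. coeff ((Mt t)\<^sup>T $$ (i, j)) s) \<longlonglongrightarrow> coeff (M\<^sup>T $$ (i, j)) s" if "i < n" "j < m" for i j s
    proof -
      have "(Mt t)\<^sup>T $$ (i, j) = Mt t $$ (j, i)" for t using carrier_matD[OF Mtc[of t]] that by simp
      moreover have "M\<^sup>T $$ (i, j) = M $$ (j, i)" using carrier_matD[OF Mc] that by simp
      ultimately show ?thesis using lim[OF that(2,1), of s] by (simp only:)
    qed
    show "degree (M\<^sup>T $$ (i, j)) \<le> d" if "i < n" "j < m" for i j using deg[OF that(2,1)] that Mc by simp
    show "right_minimal_indices ((Mt t)\<^sup>T) = xs" for t
      using xs[OF Mt(1)] unfolding left_minimal_indices_transpose .
  qed
qed

text \<open>The indices are those of \<open>a\<close> distributed evenly over \<open>q\<close>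
  places, so they sum to \<open>a\<close>. Each of them is at most
  \<open>a div q + 1 \<le> K\<close>, hence nothing is truncated.\<close>

lemma syzygy_dim_balanced:
  assumes q: "0 < q" and K: "a < K"
  shows "syzygy_dim K (replicate (a mod q) (a div q + 1) @ replicate (q - a mod q) (a div q)) + a = q * K"
proof -
  have d: "a div q \<le> a" by simp
  then have "K - (a div q + 1) + (a div q + 1) = K" "K - a div q + a div q = K" using K by linarith+
  moreover have m: "a mod q + (q - a mod q) = q" using q by (simp add: less_imp_le)
  moreover have "a = a mod q * (a div q + 1) + (q - a mod q) * (a div q)"
  proof -
    have "a mod q * (a div q + 1) + (q - a mod q) * (a div q) =
        (a mod q + (q - a mod q)) * (a div q) + a mod q" by (simp only: algebra_simps)
    then show ?thesis unfolding m by simp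
  qed
  ultimately have "a mod q * (K - (a div q + 1)) + (q - a mod q) * (K - a div q) + a =
      a mod q * K + (q - a mod q) * K"
    by (smt (verit) add.assoc add.commute add.left_commute distrib_left)
  also have "\<dots> = q * K" using m by (metis add_mult_distrib)
  finally show ?thesis by (simp add: syzygy_dim_def sum_list_replicate)
qed

lemma syzygy_dim_le: "syzygy_dim K xs \<le> length xs * K"
  unfolding syzygy_dim_def by (induction xs) auto

lemma is_generic_indices:
  assumes "is_generic m n r d a P"
  shows "right_minimal_indices P = replicate (a mod (n - r)) (a div (n - r) + 1) @
      replicate (n - r - a mod (n - r)) (a div (n - r))"
    and "left_minimal_indices P = replicate ((r * d - a) mod (m - r)) ((r * d - a) div (m - r) + 1) @
      replicate (m - r - (r * d - a) mod (m - r)) ((r * d - a) div (m - r))"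
  using assms by (auto simp: is_generic_def complete_eigenstructure_def generic_eigenstructure_def Let_def)

lemma right_minimal_indices_length:
  assumes "M \<in> carrier_mat m n"
  shows "length (right_minimal_indices M) + normal_rank M = n"
proof -
  obtain p b e where "right_minimal_indices M = rev (sort (map e [0..<p]))" "p + normal_rank M = n"
    using right_minimal_indices_rbasis[OF assms] by blast
  then show ?thesis by simp
qed

text \<open>After the existence claim, \<open>K\<close> ranges over all choices of representatives.
  This is harmless since an orbit is determined by the complete eigenstructure.\<close>

theorem theorem3p2:
  fixes m n r d :: nat
  assumes "m \<ge> 2" and "n \<ge> 2" and "d \<ge> 1" and "1 \<le> r" and "r \<le> min m n - 1"
  shows "(\<forall>a\<le>r * d. \<exists>P. is_generic m n r d a P) \<and>
    (\<forall>K :: nat \<Rightarrow> complex poly mat. (\<forall>a\<le>r * d. is_generic m n r d a (K a)) \<longrightarrow>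
       (\<forall>M\<in>POL d m n. normal_rank M \<le> r \<longrightarrow>
          (\<exists>a\<le>r * d. orbit_closure d (K a) \<supseteq> orbit_closure d M)) \<and>
       (\<forall>a\<le>r * d. \<forall>a'\<le>r * d. a \<noteq> a' \<longrightarrow>
          \<not> orbit_closure d (K a) \<supseteq> orbit_closure d (K a')) \<and>
       closedin (POL_topology d m n) {M \<in> POL d m n. normal_rank M \<le> r} \<and>
       {M \<in> POL d m n. normal_rank M \<le> r} = (\<Union>a\<le>r * d. orbit_closure d (K a)))"
proof (intro conjI allI impI)
  have r: "0 < r" "r < m" "r < n" using assms by auto
  show "\<exists>P. is_generic m n r d a P" if "a \<le> r * d" for a by (rule generic_exists[OF r that])
  fix K :: "nat \<Rightarrow> complex poly mat"
  assume "\<forall>a\<le>r * d. is_generic m n r d a (K a)"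
  then have K: "is_generic m n r d a (K a)" if "a \<le> r * d" for a using that by blast
  let ?T = "POL_topology d m n"
  have KP: "K a \<in> POL d m n" if "a \<le> r * d" for a using K[OF that] by (simp add: is_generic_def)
  have oc: "orbit_closure d Q = ?T closure_of orbit d Q" if "Q \<in> POL d m n" for Q
    using that by (auto simp: orbit_closure_def POL_def)
  have orbitD: "Q' \<in> POL d m n" "right_minimal_indices Q' = right_minimal_indices Q"
    "left_minimal_indices Q' = left_minimal_indices Q"
    if "Q' \<in> orbit d Q" "Q \<in> POL d m n" for Q Q'
    using that by (auto simp: orbit_def complete_eigenstructure_def POL_def)
  have self: "Q \<in> orbit_closure d Q" if Q: "Q \<in> POL d m n" for Q
  proof -
    have "Q \<in> orbit d Q" using Q by (auto simp: orbit_def POL_def)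
    moreover have "orbit d Q \<subseteq> POL d m n" using orbitD(1)[OF _ Q] by blast
    ultimately show ?thesis
      unfolding oc[OF Q] using closure_of_subset[of "orbit d Q" ?T] topspace_POL by blast
  qed
  have generic_orbit: "{Q. is_generic m n r d a Q} \<subseteq> orbit d (K a)" if "a \<le> r * d" for a
    using K[OF that] KP[OF that] by (auto simp: is_generic_def orbit_def POL_def)
  \<comment> \<open>The number \<open>a\<close> and the rank can be read off the right minimal
    indices, so they are the same on the whole orbit of \<open>M\<close>, and the approximation
    applies to each of its members with the same \<open>a\<close>.\<close>
  have cover: "\<exists>a\<le>r * d. orbit_closure d M \<subseteq> orbit_closure d (K a)"
    if M: "M \<in> POL d m n" and rank: "normal_rank M \<le> r" for M
  proof -
    define a where "a = sum_list (right_minimal_indices M)"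
    have a: "a \<le> r * d" by (rule in_closure_generic(1)[OF r M rank a_def])
    have "orbit d M \<subseteq> orbit_closure d (K a)"
    proof
      fix Q assume Q: "Q \<in> orbit d M"
      note QM = orbitD[OF Q M]
      have "normal_rank Q = normal_rank M"
        using right_minimal_indices_length[of Q m n] right_minimal_indices_length[of M m n] QM M
        by (simp add: POL_def)
      then have "Q \<in> ?T closure_of {Q. is_generic m n r d a Q}"
        using in_closure_generic(2)[OF r QM(1) _ a_def[folded QM(2)]] rank by simp
      then show "Q \<in> orbit_closure d (K a)"
        unfolding oc[OF KP[OF a]] using closure_of_mono[OF generic_orbit[OF a]] by blast
    qed
    then have "orbit_closure d M \<subseteq> orbit_closure d (K a)"
      unfolding oc[OF M] oc[OF KP[OF a]] by (intro closure_of_minimal) auto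
    then show ?thesis using a by blast
  qed
  then show "\<forall>M\<in>POL d m n. normal_rank M \<le> r \<longrightarrow>
      (\<exists>a\<le>r * d. orbit_closure d (K a) \<supseteq> orbit_closure d M)" by blast
  \<comment> \<open>The bound \<open>r * d < k\<close> keeps both \<open>a\<close> and
    \<open>r * d - a\<close> below \<open>k\<close>, as required for the exact dimensions on the
    generic orbit.\<close>
  have right_le: "(n - r) * k - a \<le> syzygy_dim k (right_minimal_indices M)"
    and left_le: "(m - r) * k - (r * d - a) \<le> syzygy_dim k (left_minimal_indices M)"
    if a: "a \<le> r * d" and M: "M \<in> orbit_closure d (K a)" and k: "r * d < k" for a M k
  proof -
    note cl = closure_syzygy_dim[OF M[unfolded oc[OF KP[OF a]]], of _ k]
    show "(n - r) * k - a \<le> syzygy_dim k (right_minimal_indices M)"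
      using cl(1)[OF trans[OF orbitD(2)[OF _ KP[OF a]] is_generic_indices(1)[OF K[OF a]]]]
        syzygy_dim_balanced[of "n - r" a k] r a k by linarith
    show "(m - r) * k - (r * d - a) \<le> syzygy_dim k (left_minimal_indices M)"
      using cl(2)[OF trans[OF orbitD(3)[OF _ KP[OF a]] is_generic_indices(2)[OF K[OF a]]]]
        syzygy_dim_balanced[of "m - r" "r * d - a" k] r a k by linarith
  qed
  show "\<not> orbit_closure d (K a) \<supseteq> orbit_closure d (K a')"
    if a: "a \<le> r * d" and a': "a' \<le> r * d" and ne: "a \<noteq> a'" for a a'
  proof
    assume "orbit_closure d (K a') \<subseteq> orbit_closure d (K a)"
    then have M: "K a' \<in> orbit_closure d (K a)" using self[OF KP[OF a']] by blast
    define k where "k = Suc (r * d)"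
    have k: "r * d < k" by (simp add: k_def)
    \<comment> \<open>The right kernel dimension can only grow in the limit, which gives
      \<open>a' \<le> a\<close>; the left one below gives the opposite inequality.\<close>
    have "(n - r) * k - a + a' \<le> (n - r) * k"
      using right_le[OF a M k] syzygy_dim_balanced[of "n - r" a' k] r a' k
      unfolding is_generic_indices(1)[OF K[OF a']] by linarith
    moreover have "a \<le> (n - r) * k" using a k r by (cases "n - r") auto
    ultimately have "a' \<le> a" by linarith
    have "(m - r) * k - (r * d - a) + (r * d - a') \<le> (m - r) * k"
      using left_le[OF a M k] syzygy_dim_balanced[of "m - r" "r * d - a'" k] r a' k
      unfolding is_generic_indices(2)[OF K[OF a']] by linarith
    moreover have "r * d - a \<le> (m - r) * k" using k r by (cases "m - r") auto
    ultimately have "r * d - a' \<le> r * d - a" by linarith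
    then show False using \<open>a' \<le> a\<close> a a' ne by linarith
  qed
  have sub: "orbit_closure d (K a) \<subseteq> {M \<in> POL d m n. normal_rank M \<le> r}" if a: "a \<le> r * d" for a
  proof
    fix M assume M: "M \<in> orbit_closure d (K a)"
    then have MP: "M \<in> POL d m n" unfolding oc[OF KP[OF a]] POL_closure_of by blast
    define k where "k = Suc (r * d)"
    have k: "r * d < k" by (simp add: k_def)
    let ?p = "length (right_minimal_indices M)"
    have p: "?p + normal_rank M = n" using MP by (intro right_minimal_indices_length[of M m n]) (simp add: POL_def)
    \<comment> \<open>With fewer than \<open>n - r\<close> right indices the kernel dimension would
      be at most \<open>(n - r - 1) * k\<close>, but semicontinuity demands at least
      \<open>(n - r) * k - a\<close>, and \<open>a < k\<close>.\<close>
    have "n - r \<le> ?p"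
    proof (rule ccontr)
      assume "\<not> ?thesis"
      then have "Suc ?p * k \<le> (n - r) * k" by (intro mult_right_mono) auto
      moreover have "(n - r) * k - a \<le> ?p * k"
        using right_le[OF a M k] syzygy_dim_le[of k "right_minimal_indices M"] by linarith
      ultimately show False using a k by simp
    qed
    then show "M \<in> {M \<in> POL d m n. normal_rank M \<le> r}" using p MP r by simp
  qed
  show union: "{M \<in> POL d m n. normal_rank M \<le> r} = (\<Union>a\<le>r * d. orbit_closure d (K a))"
  proof
    show "{M \<in> POL d m n. normal_rank M \<le> r} \<subseteq> (\<Union>a\<le>r * d. orbit_closure d (K a))"
      using cover self by blast
  qed (use sub in blast)
  show "closedin ?T {M \<in> POL d m n. normal_rank M \<le> r}"
    unfolding union by (intro closedin_Union) (auto simp: oc[OF KP])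
qed

end
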